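(* Let $m,k\geq 1$ be integers with $m\geq 2k$. Let $\mathcal{P}((\mathbb{R}^m)^k)\otimes\mathbb{S}$ be the space of spinor valued polynomials in $k$ vector variables of $\mathbb{R}^m$ and let $\mathcal{M}\subset \mathcal{P}((\mathbb{R}^m)^k)\otimes\mathbb{S}$ be the subspace of monogenic polynomials. For $J\subset\{1,2,\ldots,k\}$, $J=\{j_1<\cdots<j_r\}$, put $\underline{x}_J=\underline{x}_{j_1}\cdots\underline{x}_{j_r}$ (with $\underline{x}_\emptyset=1$), and for $1\leq i\leq j\leq k$ put $r_{ij}^2=x_{1i}x_{1j}+x_{2i}x_{2j}+\cdots+x_{mi}x_{mj}$. Then $$\mathcal{P}((\mathbb{R}^m)^k)\otimes\mathbb{S}=\bigoplus_{J,\{n_{ij}\}}\Big(\prod_{1\leq i\leq j\leq k}r_{ij}^{2n_{ij}}\Big)\,\underline{x}_J\,\mathcal{M},$$ where the direct sum is taken over all subsets $J$ of $\{1,2,\ldots,k\}$ and all families $\{n_{ij}\mid 1\leq i\leq j\leq k\}$ of numbers in $\mathbb{N}_0$, and $r_{ij}^{2n_{ij}}$ means $(r_{ij}^2)^{n_{ij}}$.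
   Context: $(\mathbb{R}^m)^k$ is identified with real $m\times k$ matrices $x=(x_{ij})$, whose columns are $x_j=(x_{1j},\ldots,x_{mj})\in\mathbb{R}^m$, $j=1,\ldots,k$. $\mathcal{P}=\mathcal{P}((\mathbb{R}^m)^k)$ is the space of complex valued polynomials on $(\mathbb{R}^m)^k$. Clifford algebra and spinors: $\mathcal{C}_m$ is the complex Clifford algebra generated by an orthonormal basis $e_1,\ldots,e_m$ of $\mathbb{R}^m$ with relations $e_ie_j+e_je_i=-2\delta_{ij}$; $\mathcal{C}_m^+$ is its even part. For $m=2n$ even, $\mathbb{S}$ is the unique irreducible $\mathcal{C}_m$-module; for $m=2n+1$ odd, $\mathbb{S}$ is the unique irreducible $\mathcal{C}_m^+$-module, made into a $\mathcal{C}_m$-module by a fixed choice of extension (so the $e_i$ act on $\mathbb{S}$). In both cases $\dim\mathbb{S}=2^n$. Vector variables and Dirac operators: $\underline{x}_j=\sum_{i=1}^m e_i x_{ij}$ acts on $\mathcal{P}\otimes\mathbb{S}$ by left multiplication, and $\partial_{\underline{x}_j}=\sum_{i=1}^m e_i\partial_{x_{ij}}$, for $j=1,\ldots,k$. A polynomial $P\in\mathcal{P}\otimes\mathbb{S}$ is monogenic if $\partial_{\underline{x}_1}P=0,\ldots,\partial_{\underline{x}_k}P=0$; $\mathcal{M}$ is the space of all monogenic polynomials. *)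

theory Defs
  imports Complex_Main "HOL-Library.Poly_Mapping" "HOL-Library.FuncSet"
begin

section \<open>The complex Clifford algebra\<close>

text \<open>
  An element of the algebra is its family of coefficients with respect to the standard basis
  \<open>e\<^sub>A = e\<^sub>a\<^sub>1 \<dots> e\<^sub>a\<^sub>r\<close>, where \<open>A = {a\<^sub>1 < \<dots> < a\<^sub>r} \<subseteq> {1..m}\<close>.  Since the generators
  anticommute and square to \<open>-1\<close>, one has \<open>e\<^sub>A e\<^sub>B = \<plusminus> e\<^sub>C\<close> with \<open>C\<close> the symmetric difference of
  \<open>A\<close> and \<open>B\<close>; the sign counts the transpositions \<open>e\<^sub>a e\<^sub>b = - e\<^sub>b e\<^sub>a\<close> for \<open>a > b\<close> and the
  cancellations \<open>e\<^sub>a e\<^sub>a = -1\<close>.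
\<close>

type_synonym cliff = "nat set \<Rightarrow>\<^sub>0 complex"

definition cl_sign :: "nat set \<Rightarrow> nat set \<Rightarrow> complex" where
  "cl_sign A B = (-1) ^ card {(a, b) \<in> A \<times> B. b \<le> a}"

definition cl_mult :: "cliff \<Rightarrow> cliff \<Rightarrow> cliff" where
  "cl_mult a b = (\<Sum>A\<in>Poly_Mapping.keys a. \<Sum>B\<in>Poly_Mapping.keys b.
     Poly_Mapping.single (sym_diff A B)
       (cl_sign A B * Poly_Mapping.lookup a A * Poly_Mapping.lookup b B))"

definition cl_scale :: "complex \<Rightarrow> cliff \<Rightarrow> cliff" where
  "cl_scale c a = Poly_Mapping.map ((*) c) a"

definition cl_one :: cliff where
  "cl_one = Poly_Mapping.single {} 1"

definition cl_gen :: "nat \<Rightarrow> cliff" where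
  "cl_gen i = Poly_Mapping.single {i} 1"

definition clifford :: "nat \<Rightarrow> cliff set" where
  "clifford m = {a. Poly_Mapping.keys a \<subseteq> Pow {1..m}}"

definition clifford_even :: "nat \<Rightarrow> cliff set" where
  "clifford_even m = {a \<in> clifford m. \<forall>A\<in>Poly_Mapping.keys a. even (card A)}"

lemma cl_mult_single:
  "cl_mult (Poly_Mapping.single A x) (Poly_Mapping.single B y)
     = Poly_Mapping.single (sym_diff A B) (cl_sign A B * x * y)"
  by (auto simp: cl_mult_def)

text \<open>The defining relations, associativity on the basis, and generation by the \<open>e\<^sub>i\<close>.\<close>

lemma cl_gen_relations:
  "cl_mult (cl_gen i) (cl_gen j) + cl_mult (cl_gen j) (cl_gen i)
     = cl_scale (if i = j then -2 else 0) cl_one"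
proof -
  have card: "card {(a, b). a = p \<and> b = q \<and> b \<le> a} = (if q \<le> p then 1 else 0)" for p q :: nat
  proof -
    have "{(a, b). a = p \<and> b = q \<and> b \<le> a} = (if q \<le> p then {(p, q)} else {})" by auto
    then show ?thesis by simp
  qed
  have sgn: "cl_sign {p} {q} = (if q \<le> p then -1 else 1)" for p q
    unfolding cl_sign_def using card[of p q] by simp
  have sd: "sym_diff {i} {j} = sym_diff {j} {i}" by auto
  show ?thesis
  proof (cases "i = j")
    case True
    then show ?thesis
      by (intro poly_mapping_eqI)
         (auto simp: cl_gen_def cl_one_def cl_scale_def cl_mult_single sgn lookup_add
            lookup_single map.rep_eq when_def)
  next
    case False
    then have "(j \<le> i) \<noteq> (i \<le> j)" by auto
    then show ?thesis using False sd
      by (intro poly_mapping_eqI)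
         (auto simp: cl_gen_def cl_one_def cl_scale_def cl_mult_single sgn lookup_add
            lookup_single map.rep_eq when_def)
  qed
qed

lemma cl_sign_prod:
  assumes "finite A" "finite B"
  shows "cl_sign A B = (\<Prod>a\<in>A. \<Prod>b\<in>B. if b \<le> a then -1 else 1)"
proof -
  have fin: "finite (A \<times> B)" using assms by simp
  have "(\<Prod>a\<in>A. \<Prod>b\<in>B. if b \<le> a then -1 else 1 :: complex)
      = (\<Prod>p\<in>A \<times> B. if snd p \<le> fst p then -1 else 1)"
    by (simp add: prod.cartesian_product case_prod_unfold)
  also have "\<dots> = (\<Prod>p\<in>{p \<in> A \<times> B. snd p \<le> fst p}. -1)"
    using fin by (subst prod.inter_filter) auto
  also have "\<dots> = (-1) ^ card {p \<in> A \<times> B. snd p \<le> fst p}" by simp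
  also have "{p \<in> A \<times> B. snd p \<le> fst p} = {(a, b) \<in> A \<times> B. b \<le> a}" by auto
  finally show ?thesis by (simp add: cl_sign_def)
qed

lemma prod_sym_diff:
  fixes f :: "'b \<Rightarrow> complex"
  assumes "finite A" "finite B" "\<And>x. f x * f x = 1"
  shows "prod f (sym_diff A B) = prod f A * prod f B"
proof -
  have "prod f A = prod f (A - B) * prod f (A \<inter> B)"
    using assms(1) by (metis prod.Int_Diff mult.commute)
  moreover have "prod f B = prod f (B - A) * prod f (A \<inter> B)"
    using assms(2) by (metis prod.Int_Diff mult.commute Int_commute)
  moreover have "prod f (A \<inter> B) * prod f (A \<inter> B) = 1"
    by (simp add: prod.distrib[symmetric] assms(3))
  moreover have "prod f (sym_diff A B) = prod f (A - B) * prod f (B - A)"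
    using assms by (intro prod.union_disjoint) auto
  ultimately show ?thesis
    by (metis (no_types, lifting) mult.assoc mult.commute mult.right_neutral)
qed

lemma cl_mult_single_assoc:
  assumes "finite A" "finite B" "finite C"
  shows "cl_mult (cl_mult (Poly_Mapping.single A x) (Poly_Mapping.single B y)) (Poly_Mapping.single C z)
       = cl_mult (Poly_Mapping.single A x) (cl_mult (Poly_Mapping.single B y) (Poly_Mapping.single C z))"
proof -
  have "cl_sign (sym_diff A B) C = cl_sign A C * cl_sign B C"
    using assms by (subst (1 2 3) cl_sign_prod)
      (auto intro!: prod_sym_diff prod.neutral simp: prod.distrib[symmetric])
  moreover have "cl_sign A (sym_diff B C) = cl_sign A B * cl_sign A C"
  proof -
    have "cl_sign A (sym_diff B C)
        = (\<Prod>a\<in>A. \<Prod>b\<in>sym_diff B C. if b \<le> a then -1 else 1)"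
      using assms by (intro cl_sign_prod) auto
    also have "\<dots> = (\<Prod>a\<in>A. (\<Prod>b\<in>B. if b \<le> a then -1 else 1) * (\<Prod>b\<in>C. if b \<le> a then -1 else 1))"
      using assms by (intro prod.cong refl prod_sym_diff) auto
    finally show ?thesis using assms by (simp add: prod.distrib cl_sign_prod)
  qed
  moreover have "sym_diff (sym_diff A B) C = sym_diff A (sym_diff B C)" by auto
  ultimately show ?thesis by (simp only: cl_mult_single mult_ac)
qed

lemma cl_basis_eq_prod_gen:
  assumes "finite A"
  shows "foldr cl_mult (map cl_gen (sorted_list_of_set A)) cl_one = Poly_Mapping.single A 1"
proof -
  have "foldr cl_mult (map cl_gen xs) cl_one = Poly_Mapping.single (set xs) 1"
    if "sorted_wrt (<) xs" for xs
    using that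
  proof (induction xs)
    case Nil
    then show ?case by (simp add: cl_one_def)
  next
    case (Cons x xs)
    have "{(a, b) \<in> {x} \<times> set xs. b \<le> a} = {}" using Cons.prems by auto
    then have "cl_sign {x} (set xs) = 1" unfolding cl_sign_def by (simp only: card.empty power_0)
    moreover have "sym_diff {x} (set xs) = insert x (set xs)" using Cons.prems by auto
    ultimately show ?case using Cons by (simp add: cl_gen_def cl_mult_single)
  qed
  then show ?thesis using assms by (metis strict_sorted_list_of_set set_sorted_list_of_set)
qed


section \<open>The spinor module\<close>

definition irreducible_module ::
  "(complex \<Rightarrow> 's \<Rightarrow> 's::ab_group_add) \<Rightarrow> (cliff \<Rightarrow> 's \<Rightarrow> 's) \<Rightarrow> cliff set \<Rightarrow> bool" where
  "irreducible_module scale act \<A> \<longleftrightarrow>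
     (\<exists>s::'s. s \<noteq> 0) \<and>
     (\<forall>N. module.subspace scale N \<and> (\<forall>a\<in>\<A>. \<forall>s\<in>N. act a s \<in> N) \<longrightarrow> N = {0} \<or> N = UNIV)"

text \<open>
  The complex vector space \<open>'s\<close> (with scalar multiplication \<open>scale\<close>) is a model of the spinor
  space: a module over the Clifford algebra that is irreducible if \<open>m\<close> is even and whose
  restriction to the even part is irreducible if \<open>m\<close> is odd.  In the odd case the given action of
  the full algebra is the chosen extension.
\<close>

locale spinor_module = vector_space scale
  for m :: nat
    and scale :: "complex \<Rightarrow> 's::ab_group_add \<Rightarrow> 's"
    and act :: "cliff \<Rightarrow> 's \<Rightarrow> 's" +
  assumes act_linear: "a \<in> clifford m \<Longrightarrow> Vector_Spaces.linear scale scale (act a)"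
    and act_add: "a \<in> clifford m \<Longrightarrow> b \<in> clifford m \<Longrightarrow> act (a + b) s = act a s + act b s"
    and act_scale: "a \<in> clifford m \<Longrightarrow> act (cl_scale c a) s = scale c (act a s)"
    and act_mult: "a \<in> clifford m \<Longrightarrow> b \<in> clifford m \<Longrightarrow> act (cl_mult a b) s = act a (act b s)"
    and act_one: "act cl_one s = s"
    and irreducible_even: "even m \<Longrightarrow> irreducible_module scale act (clifford m)"
    and irreducible_odd: "odd m \<Longrightarrow> irreducible_module scale act (clifford_even m)"


section \<open>Spinor valued polynomials\<close>

text \<open>
  Polynomials in the real variables \<open>x\<^sub>i\<^sub>j\<close>, indexed by pairs \<open>(i, j)\<close>, are represented by their
  coefficients: a polynomial maps a multi-index (an exponent for every variable) to a coefficient,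
  which is complex for \<open>cpoly\<close> (the library's polynomial ring) and a spinor for
  \<open>'s spoly\<close>, the tensor product of the polynomials with the spinors.  As the real numbers
  are infinite, these are the same as polynomial functions.
\<close>

type_synonym cpoly = "((nat \<times> nat) \<Rightarrow>\<^sub>0 nat) \<Rightarrow>\<^sub>0 complex"
type_synonym 's spoly = "((nat \<times> nat) \<Rightarrow>\<^sub>0 nat) \<Rightarrow>\<^sub>0 's"

definition spinor_polys :: "nat \<Rightarrow> nat \<Rightarrow> 's::ab_group_add spoly set" where
  "spinor_polys m k =
     {f. \<forall>\<alpha>\<in>Poly_Mapping.keys f. Poly_Mapping.keys \<alpha> \<subseteq> {1..m} \<times> {1..k}}"

definition sp_scale :: "(complex \<Rightarrow> 's \<Rightarrow> 's) \<Rightarrow> complex \<Rightarrow> 's spoly \<Rightarrow> 's::ab_group_add spoly" where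
  "sp_scale scale c f = Poly_Mapping.map (scale c) f"

text \<open>\<open>p \<cdot> (q \<otimes> s) = (p q) \<otimes> s\<close>\<close>

definition poly_act ::
  "(complex \<Rightarrow> 's \<Rightarrow> 's) \<Rightarrow> cpoly \<Rightarrow> 's spoly \<Rightarrow> 's::ab_group_add spoly" where
  "poly_act scale p f = (\<Sum>\<alpha>\<in>Poly_Mapping.keys p. \<Sum>\<beta>\<in>Poly_Mapping.keys f.
     Poly_Mapping.single (\<alpha> + \<beta>) (scale (Poly_Mapping.lookup p \<alpha>) (Poly_Mapping.lookup f \<beta>)))"

text \<open>\<open>a \<cdot> (q \<otimes> s) = q \<otimes> (a s)\<close>\<close>

definition cliff_act :: "(cliff \<Rightarrow> 's \<Rightarrow> 's) \<Rightarrow> cliff \<Rightarrow> 's spoly \<Rightarrow> 's::ab_group_add spoly" where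
  "cliff_act act a f = Poly_Mapping.map (act a) f"

definition coord :: "nat \<Rightarrow> nat \<Rightarrow> cpoly" where
  "coord i j = Poly_Mapping.single (Poly_Mapping.single (i, j) 1) 1"

text \<open>
  The partial derivative with respect to \<open>x\<^sub>v\<close>.  The truncated subtraction is harmless, because the
  coefficient vanishes if \<open>x\<^sub>v\<close> does not occur in the monomial.
\<close>

definition partial_deriv ::
  "(complex \<Rightarrow> 's \<Rightarrow> 's) \<Rightarrow> nat \<times> nat \<Rightarrow> 's spoly \<Rightarrow> 's::ab_group_add spoly" where
  "partial_deriv scale v f = (\<Sum>\<beta>\<in>Poly_Mapping.keys f.
     Poly_Mapping.single (\<beta> - Poly_Mapping.single v 1)
       (scale (of_nat (Poly_Mapping.lookup \<beta> v)) (Poly_Mapping.lookup f \<beta>)))"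

definition vector_var ::
  "nat \<Rightarrow> (complex \<Rightarrow> 's \<Rightarrow> 's) \<Rightarrow> (cliff \<Rightarrow> 's \<Rightarrow> 's) \<Rightarrow> nat \<Rightarrow> 's spoly \<Rightarrow> 's::ab_group_add spoly" where
  "vector_var m scale act j f =
     (\<Sum>i = 1..m. cliff_act act (cl_gen i) (poly_act scale (coord i j) f))"

definition dirac ::
  "nat \<Rightarrow> (complex \<Rightarrow> 's \<Rightarrow> 's) \<Rightarrow> (cliff \<Rightarrow> 's \<Rightarrow> 's) \<Rightarrow> nat \<Rightarrow> 's spoly \<Rightarrow> 's::ab_group_add spoly" where
  "dirac m scale act j f =
     (\<Sum>i = 1..m. cliff_act act (cl_gen i) (partial_deriv scale (i, j) f))"

definition monogenics ::
  "nat \<Rightarrow> nat \<Rightarrow> (complex \<Rightarrow> 's \<Rightarrow> 's) \<Rightarrow> (cliff \<Rightarrow> 's \<Rightarrow> 's) \<Rightarrow> 's::ab_group_add spoly set" where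
  "monogenics m k scale act = {f \<in> spinor_polys m k. \<forall>j\<in>{1..k}. dirac m scale act j f = 0}"

text \<open>\<open>x\<^sub>J = x\<^sub>j\<^sub>1 \<dots> x\<^sub>j\<^sub>r\<close> for \<open>j\<^sub>1 < \<dots> < j\<^sub>r\<close>, so \<open>x\<^sub>j\<^sub>r\<close> is applied first.\<close>

definition vector_var_set ::
  "nat \<Rightarrow> (complex \<Rightarrow> 's \<Rightarrow> 's) \<Rightarrow> (cliff \<Rightarrow> 's \<Rightarrow> 's) \<Rightarrow> nat set \<Rightarrow> 's spoly \<Rightarrow> 's::ab_group_add spoly" where
  "vector_var_set m scale act J f = foldr (vector_var m scale act) (sorted_list_of_set J) f"

definition r_sq :: "nat \<Rightarrow> nat \<Rightarrow> nat \<Rightarrow> cpoly" where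
  "r_sq m i j = (\<Sum>l = 1..m. coord l i * coord l j)"

definition index_pairs :: "nat \<Rightarrow> (nat \<times> nat) set" where
  "index_pairs k = {(i, j). 1 \<le> i \<and> i \<le> j \<and> j \<le> k}"

lemma vector_space_sp_scale:
  assumes "vector_space scale"
  shows "vector_space (sp_scale scale :: complex \<Rightarrow> 's spoly \<Rightarrow> 's::ab_group_add spoly)"
proof -
  interpret vector_space scale by fact
  have lk: "Poly_Mapping.lookup (sp_scale scale c f) \<alpha> = scale c (Poly_Mapping.lookup f \<alpha>)"
    for c \<alpha> and f :: "'s spoly"
    by (simp add: sp_scale_def map.rep_eq when_def)
  show ?thesis
    by unfold_locales
       (auto intro!: poly_mapping_eqI simp: lk lookup_add scale_right_distrib scale_left_distrib)
qed


section \<open>Internal direct sums\<close>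

definition internal_direct_sum ::
  "('a::comm_ring_1 \<Rightarrow> 'b \<Rightarrow> 'b) \<Rightarrow> 'b::ab_group_add set \<Rightarrow> 'i set \<Rightarrow> ('i \<Rightarrow> 'b set) \<Rightarrow> bool" where
  "internal_direct_sum scale W I V \<longleftrightarrow>
     module.subspace scale W \<and>
     (\<forall>i\<in>I. module.subspace scale (V i) \<and> V i \<subseteq> W) \<and>
     (\<forall>w\<in>W. \<exists>!v. (\<forall>i\<in>I. v i \<in> V i) \<and> (\<forall>i. i \<notin> I \<longrightarrow> v i = 0) \<and>
        finite {i. v i \<noteq> 0} \<and> w = (\<Sum>i | v i \<noteq> 0. v i))"

end

theory Submission
  imports Defs
begin

text \<open>
  Spanning: with respect to a positive definite (Fischer) form for which the generators of the
  Clifford algebra are skew, \<open>x\<^sub>j\<close> is adjoint to \<open>- \<partial>\<^sub>j\<close>.  Hence every spinor valued polynomial is the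
  sum of a monogenic one and of elements \<open>x\<^sub>j g\<close> with \<open>g\<close> of lower degree, and the relations
  \<open>x\<^sub>i x\<^sub>j + x\<^sub>j x\<^sub>i = - 2 r\<^sub>i\<^sub>j\<^sup>2\<close> bring products of vector variables into normal form.

  Directness: the leading monomials of the \<open>r\<^sub>i\<^sub>j\<^sup>2\<close> for a suitable weight are pairwise coprime if
  \<open>m \<ge> 2k\<close>, so the \<open>r\<^sub>i\<^sub>j\<^sup>2\<close> form a regular sequence on the spinor valued polynomials.  It remains
  regular if \<open>r\<^sub>i\<^sub>i\<^sup>2 = - x\<^sub>i\<^sup>2\<close> is replaced by its root \<open>x\<^sub>i\<close>, that is, for the sequence
  \<open>x\<^sub>1, r\<^sub>1\<^sub>2\<^sup>2, \<dots>, r\<^sub>1\<^sub>k\<^sup>2, x\<^sub>2, r\<^sub>2\<^sub>3\<^sup>2, \<dots>, x\<^sub>k\<close>.  Monomials in a regular sequence are independent over any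
  space that meets the sum of the images trivially, and the monogenic polynomials form such a space,
  being orthogonal to the images of the \<open>x\<^sub>j\<close>.
\<close>

text \<open>The obstacle is that the x_j do not commute, so the commutative theory of regular
  sequences does not apply to them directly. The order of the mixed sequence removes it: x_j x_a = -
  x_a x_j - 2 r_aj^2, and for a < j both x_a and r_aj^2 stand before x_j. Hence x_j preserves the
  sum of the images of its predecessors, and this invariance is what allows a square to be replaced
  by its root.

  The second point is bookkeeping. Every exponent of x_i is 2 n + e with e = 0 or e = 1; here n is
  the exponent of r_ii^2, and e tells whether i lies in J. So, up to sign, the monomials in the
  mixed sequence are exactly the operators of the theorem, each occurring once.

  Regularity holds on polynomials in all variables x_ij with natural indices. The Fischer form lives
  on the same space, so the orthogonality argument covers images of arbitrary polynomials.\<close>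

lemma additive_single_eqI:
  fixes F G :: "('a \<Rightarrow>\<^sub>0 'b::ab_group_add) \<Rightarrow> 'c::ab_group_add"
  assumes "additive F" "additive G"
    and "\<And>\<beta> s. F (Poly_Mapping.single \<beta> s) = G (Poly_Mapping.single \<beta> s)"
  shows "F f = G f"
proof -
  interpret F: additive F by fact
  interpret G: additive G by fact
  show ?thesis
  proof (induction f rule: update_induct)
    case const
    show ?case by (simp add: F.zero G.zero)
  next
    case (update f a b)
    have "Poly_Mapping.update a b f = Poly_Mapping.single a b + f"
      using update(1)
      by (intro poly_mapping_eqI)
         (auto simp: lookup_update lookup_add lookup_single in_keys_iff when_def)
    with update show ?case by (simp add: F.add G.add assms(3))
  qed
qed

lemma sum_single_lookup:
  fixes f :: "'a \<Rightarrow>\<^sub>0 'b::comm_monoid_add"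
  shows "(\<Sum>\<beta>\<in>Poly_Mapping.keys f. Poly_Mapping.single \<beta> (Poly_Mapping.lookup f \<beta>)) = f"
  by (intro poly_mapping_eqI)
     (auto simp: lookup_sum lookup_single when_def in_keys_iff)

lemma additive_compose:
  "additive F \<Longrightarrow> additive G \<Longrightarrow> additive (\<lambda>x. F (G x))"
  by (simp add: additive_def)

lemma additive_sum:
  assumes "\<And>i. i \<in> I \<Longrightarrow> additive (F i)"
  shows "additive (\<lambda>x. \<Sum>i\<in>I. F i x)"
  using assms by (simp add: additive_def sum.distrib)

lemma additive_funpow:
  fixes F :: "'a::ab_group_add \<Rightarrow> 'a"
  assumes "additive F"
  shows "additive (F ^^ n)"
  using assms by (induction n) (simp_all add: additive_def)

lemma lookup_map_additive:
  assumes "f 0 = 0"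
  shows "Poly_Mapping.lookup (Poly_Mapping.map f p) \<alpha> = f (Poly_Mapping.lookup p \<alpha>)"
  using assms by (simp add: map.rep_eq when_def)

section \<open>The action of scalar polynomials on spinor valued polynomials\<close>

context spinor_module
begin

lemma poly_act_superset:
  assumes "finite A" "finite B" "Poly_Mapping.keys p \<subseteq> A" "Poly_Mapping.keys f \<subseteq> B"
  shows "poly_act scale p f = (\<Sum>\<alpha>\<in>A. \<Sum>\<beta>\<in>B.
     Poly_Mapping.single (\<alpha> + \<beta>) (scale (Poly_Mapping.lookup p \<alpha>) (Poly_Mapping.lookup f \<beta>)))"
proof -
  have "poly_act scale p f = (\<Sum>\<alpha>\<in>A. \<Sum>\<beta>\<in>Poly_Mapping.keys f.
     Poly_Mapping.single (\<alpha> + \<beta>) (scale (Poly_Mapping.lookup p \<alpha>) (Poly_Mapping.lookup f \<beta>)))"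
    unfolding poly_act_def
    using assms by (intro sum.mono_neutral_left) (auto simp: in_keys_iff)
  also have "\<dots> = (\<Sum>\<alpha>\<in>A. \<Sum>\<beta>\<in>B.
     Poly_Mapping.single (\<alpha> + \<beta>) (scale (Poly_Mapping.lookup p \<alpha>) (Poly_Mapping.lookup f \<beta>)))"
    using assms by (intro sum.cong refl sum.mono_neutral_left) (auto simp: in_keys_iff)
  finally show ?thesis .
qed

lemma poly_act_add_right: "poly_act scale p (f + g) = poly_act scale p f + poly_act scale p g"
proof -
  define B where "B = Poly_Mapping.keys f \<union> Poly_Mapping.keys g"
  have "finite B" "Poly_Mapping.keys f \<subseteq> B" "Poly_Mapping.keys g \<subseteq> B"
    "Poly_Mapping.keys (f + g) \<subseteq> B"
    using keys_add[of f g] by (auto simp: B_def)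
  then show ?thesis
    by (simp add: poly_act_superset[where A = "Poly_Mapping.keys p" and B = B]
        lookup_add scale_right_distrib single_add sum.distrib)
qed

lemma poly_act_add_left: "poly_act scale (p + q) f = poly_act scale p f + poly_act scale q f"
proof -
  define A where "A = Poly_Mapping.keys p \<union> Poly_Mapping.keys q"
  have "finite A" "Poly_Mapping.keys p \<subseteq> A" "Poly_Mapping.keys q \<subseteq> A"
    "Poly_Mapping.keys (p + q) \<subseteq> A"
    using keys_add[of p q] by (auto simp: A_def)
  then show ?thesis
    by (simp add: poly_act_superset[where A = A and B = "Poly_Mapping.keys f"]
        lookup_add scale_left_distrib single_add sum.distrib)
qed

lemma additive_poly_act: "additive (poly_act scale p)"
  by unfold_locales (rule poly_act_add_right)

lemma additive_poly_act_left: "additive (\<lambda>p. poly_act scale p f)"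
  by unfold_locales (rule poly_act_add_left)

lemmas poly_act_zero_right = additive.zero[OF additive_poly_act]
lemmas poly_act_sum_left = additive.sum[OF additive_poly_act_left]

lemma poly_act_single_single:
  "poly_act scale (Poly_Mapping.single \<alpha> c) (Poly_Mapping.single \<beta> s)
     = Poly_Mapping.single (\<alpha> + \<beta>) (scale c s)"
  by (simp add: poly_act_superset[where A = "{\<alpha>}" and B = "{\<beta>}"])

lemma poly_act_one: "poly_act scale 1 f = f"
proof (rule additive_single_eqI[where F = "poly_act scale 1" and G = "\<lambda>f. f"])
  show "poly_act scale 1 (Poly_Mapping.single \<beta> s) = Poly_Mapping.single \<beta> s" for \<beta> s
    using poly_act_single_single[of 0 1 \<beta> s] by simp
qed (rule additive_poly_act, simp add: additive_def)

lemma poly_act_mult: "poly_act scale (p * q) f = poly_act scale p (poly_act scale q f)"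
proof (rule additive_single_eqI[where F = "poly_act scale (p * q)"])
  fix \<beta> :: "nat \<times> nat \<Rightarrow>\<^sub>0 nat" and s
  show "poly_act scale (p * q) (Poly_Mapping.single \<beta> s)
      = poly_act scale p (poly_act scale q (Poly_Mapping.single \<beta> s))"
  proof (rule additive_single_eqI[where f = p])
    show "additive (\<lambda>p. poly_act scale (p * q) (Poly_Mapping.single \<beta> s))"
      by (simp add: additive_def distrib_right poly_act_add_left)
    fix \<alpha> c
    show "poly_act scale (Poly_Mapping.single \<alpha> c * q) (Poly_Mapping.single \<beta> s)
      = poly_act scale (Poly_Mapping.single \<alpha> c) (poly_act scale q (Poly_Mapping.single \<beta> s))"
    proof (rule additive_single_eqI[where f = q])
      show "additive (\<lambda>q. poly_act scale (Poly_Mapping.single \<alpha> c * q) (Poly_Mapping.single \<beta> s))"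
        by (simp add: additive_def distrib_left poly_act_add_left)
      show "additive (\<lambda>q. poly_act scale (Poly_Mapping.single \<alpha> c)
              (poly_act scale q (Poly_Mapping.single \<beta> s)))"
        by (simp add: additive_def poly_act_add_left poly_act_add_right)
    qed (simp add: mult_single poly_act_single_single add.assoc)
  qed (rule additive_poly_act_left)
qed (rule additive_poly_act additive_compose[OF additive_poly_act additive_poly_act])+

lemma poly_act_commute: "poly_act scale p (poly_act scale q f) = poly_act scale q (poly_act scale p f)"
  by (metis poly_act_mult mult.commute)

text \<open>A scalar acts as a constant polynomial, so whatever commutes with
  \<open>poly_act\<close> also commutes with complex scalars.\<close>

lemma sp_scale_eq_poly_act: "sp_scale scale c f = poly_act scale (Poly_Mapping.single 0 c) f"
proof (rule additive_single_eqI[where F = "sp_scale scale c"])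
  show "additive (sp_scale scale c)"
    using vector_space.vector_space_assms(1)[OF vector_space_sp_scale[OF vector_space_axioms]]
    by (auto simp: additive_def)
qed (simp_all add: additive_poly_act sp_scale_def poly_act_single_single)

lemma keys_poly_act:
  "Poly_Mapping.keys (poly_act scale p f)
     \<subseteq> {\<alpha> + \<beta> | \<alpha> \<beta>. \<alpha> \<in> Poly_Mapping.keys p \<and> \<beta> \<in> Poly_Mapping.keys f}"
proof
  fix \<gamma> assume "\<gamma> \<in> Poly_Mapping.keys (poly_act scale p f)"
  then have "(\<Sum>\<alpha>\<in>Poly_Mapping.keys p. \<Sum>\<beta>\<in>Poly_Mapping.keys f.
      (if \<alpha> + \<beta> = \<gamma> then scale (Poly_Mapping.lookup p \<alpha>) (Poly_Mapping.lookup f \<beta>) else 0)) \<noteq> 0"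
    by (simp add: poly_act_def in_keys_iff lookup_sum lookup_single when_def)
  then obtain \<alpha> where \<alpha>: "\<alpha> \<in> Poly_Mapping.keys p" and *: "(\<Sum>\<beta>\<in>Poly_Mapping.keys f.
      (if \<alpha> + \<beta> = \<gamma> then scale (Poly_Mapping.lookup p \<alpha>) (Poly_Mapping.lookup f \<beta>) else 0)) \<noteq> 0"
    by (rule sum.not_neutral_contains_not_neutral)
  from * obtain \<beta> where "\<beta> \<in> Poly_Mapping.keys f" and "(if \<alpha> + \<beta> = \<gamma>
      then scale (Poly_Mapping.lookup p \<alpha>) (Poly_Mapping.lookup f \<beta>) else 0) \<noteq> 0"
    by (rule sum.not_neutral_contains_not_neutral)
  with \<alpha> have "\<beta> \<in> Poly_Mapping.keys f" "\<alpha> + \<beta> = \<gamma>" by (auto split: if_splits)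
  with \<alpha> show "\<gamma> \<in> {\<alpha> + \<beta> | \<alpha> \<beta>. \<alpha> \<in> Poly_Mapping.keys p \<and> \<beta> \<in> Poly_Mapping.keys f}"
    by blast
qed

lemma lookup_poly_act_single:
  "Poly_Mapping.lookup (poly_act scale (Poly_Mapping.single \<alpha> c) f) (\<alpha> + \<beta>)
     = scale c (Poly_Mapping.lookup f \<beta>)"
proof (rule additive_single_eqI[where f = f])
  show "additive (\<lambda>f. Poly_Mapping.lookup (poly_act scale (Poly_Mapping.single \<alpha> c) f) (\<alpha> + \<beta>))"
    by (simp add: additive_def poly_act_add_right lookup_add)
qed (simp_all add: additive_def lookup_add scale_right_distrib poly_act_single_single
    lookup_single when_def)


section \<open>Vector variables and Dirac operators\<close>

lemma cl_gen_in_clifford: "i \<in> {1..m} \<Longrightarrow> cl_gen i \<in> clifford m"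
  by (auto simp: cl_gen_def clifford_def)

lemma act_hom:
  assumes "a \<in> clifford m"
  shows "act a (s + t) = act a s + act a t" "act a (scale c s) = scale c (act a s)" "act a 0 = 0"
proof -
  interpret Vector_Spaces.linear scale scale "act a" by (rule act_linear[OF assms])
  show "act a (s + t) = act a s + act a t" "act a (scale c s) = scale c (act a s)" "act a 0 = 0"
    by (auto simp: add scale)
qed

lemma act_gen_anticommute:
  assumes "i \<in> {1..m}" "j \<in> {1..m}"
  shows "act (cl_gen i) (act (cl_gen j) s) + act (cl_gen j) (act (cl_gen i) s)
    = scale (if i = j then -2 else 0) s"
proof -
  have one: "cl_one \<in> clifford m" by (auto simp: cl_one_def clifford_def)
  have mult: "cl_mult (cl_gen a) (cl_gen b) \<in> clifford m" if "a \<in> {1..m}" "b \<in> {1..m}" for a b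
    using that by (auto simp: cl_gen_def cl_mult_single clifford_def)
  have "act (cl_gen i) (act (cl_gen j) s) + act (cl_gen j) (act (cl_gen i) s)
      = act (cl_mult (cl_gen i) (cl_gen j) + cl_mult (cl_gen j) (cl_gen i)) s"
    using assms by (simp add: act_add mult act_mult cl_gen_in_clifford)
  also have "\<dots> = scale (if i = j then -2 else 0) s"
    unfolding cl_gen_relations by (simp only: act_scale[OF one] act_one)
  finally show ?thesis .
qed

lemma act_gen_square: "i \<in> {1..m} \<Longrightarrow> act (cl_gen i) (act (cl_gen i) s) = - s"
proof -
  assume "i \<in> {1..m}"
  from act_gen_anticommute[OF this this, of s]
  have "scale 2 (act (cl_gen i) (act (cl_gen i) s)) = scale 2 (- s)"
    by (simp flip: scale_left_distrib add: scale_left_distrib[of 1 1, simplified] )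
  then show ?thesis by (subst (asm) scale_cancel_left) simp
qed

lemma additive_cliff_act:
  assumes "a \<in> clifford m"
  shows "additive (cliff_act act a)"
  unfolding additive_def cliff_act_def
  by (auto intro!: poly_mapping_eqI simp: lookup_map_additive act_hom[OF assms] lookup_add)

lemma cliff_act_single:
  "a \<in> clifford m \<Longrightarrow> cliff_act act a (Poly_Mapping.single \<beta> s) = Poly_Mapping.single \<beta> (act a s)"
  by (simp add: cliff_act_def act_hom)

lemma lookup_cliff_act:
  "a \<in> clifford m \<Longrightarrow>
    Poly_Mapping.lookup (cliff_act act a f) \<beta> = act a (Poly_Mapping.lookup f \<beta>)"
  by (simp add: cliff_act_def lookup_map_additive act_hom)

lemma cliff_act_poly_act:
  assumes "a \<in> clifford m"
  shows "cliff_act act a (poly_act scale p f) = poly_act scale p (cliff_act act a f)"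
proof (rule additive_single_eqI[where f = f])
  fix \<beta> s
  show "cliff_act act a (poly_act scale p (Poly_Mapping.single \<beta> s))
      = poly_act scale p (cliff_act act a (Poly_Mapping.single \<beta> s))"
  proof (rule additive_single_eqI[where f = p])
    show "additive (\<lambda>p. cliff_act act a (poly_act scale p (Poly_Mapping.single \<beta> s)))"
      by (intro additive_compose[OF additive_cliff_act additive_poly_act_left] assms)
  qed (simp_all add: additive_poly_act_left cliff_act_single assms poly_act_single_single act_hom)
qed (intro additive_compose[OF additive_cliff_act additive_poly_act]
    additive_compose[OF additive_poly_act additive_cliff_act] assms)+

abbreviation "vv \<equiv> vector_var m scale act"

lemma additive_vector_var: "additive (vv j)"
  unfolding vector_var_def
  by (intro additive_sum additive_compose[OF additive_cliff_act additive_poly_act]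
      cl_gen_in_clifford)

lemma vector_var_poly_act: "vv j (poly_act scale p f) = poly_act scale p (vv j f)"
proof -
  interpret additive "poly_act scale p" by (rule additive_poly_act)
  show ?thesis
    unfolding vector_var_def sum
  proof (rule sum.cong)
    fix i assume "i \<in> {1..m}"
    then show "cliff_act act (cl_gen i) (poly_act scale (coord i j) (poly_act scale p f))
        = poly_act scale p (cliff_act act (cl_gen i) (poly_act scale (coord i j) f))"
      by (subst poly_act_commute) (simp add: cliff_act_poly_act cl_gen_in_clifford)
  qed simp
qed

text \<open>The coordinates commute, so only the generators matter: by the Clifford relations the
  terms with different rows a and b cancel, and each row a leaves -2 x_ai x_aj.\<close>

lemma vector_var_anticommute:
  "vv i (vv j f) + vv j (vv i f) = poly_act scale (- 2 * r_sq m i j) f"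
proof -
  have sq: "vv i (vv j f) = (\<Sum>a=1..m. \<Sum>b=1..m. cliff_act act (cl_gen a)
      (cliff_act act (cl_gen b) (poly_act scale (coord a i * coord b j) f)))" for i j
  proof -
    have "vv i (vv j f) = (\<Sum>a=1..m. \<Sum>b=1..m. cliff_act act (cl_gen a)
        (poly_act scale (coord a i) (cliff_act act (cl_gen b) (poly_act scale (coord b j) f))))"
      unfolding vector_var_def additive.sum[OF additive_poly_act]
      by (rule sum.cong[OF refl]) (rule additive.sum[OF additive_cliff_act[OF cl_gen_in_clifford]])
    also have "\<dots> = (\<Sum>a=1..m. \<Sum>b=1..m. cliff_act act (cl_gen a)
        (cliff_act act (cl_gen b) (poly_act scale (coord a i * coord b j) f)))"
      by (intro sum.cong refl) (simp only: poly_act_mult cliff_act_poly_act cl_gen_in_clifford)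
    finally show ?thesis .
  qed
  \<comment> \<open>The second double sum is transposed, so that the two orders of a pair of
    generators meet in one term.\<close>
  have "vv i (vv j f) + vv j (vv i f) = (\<Sum>a=1..m. \<Sum>b=1..m.
      cliff_act act (cl_gen a) (cliff_act act (cl_gen b) (poly_act scale (coord a i * coord b j) f))
    + cliff_act act (cl_gen b) (cliff_act act (cl_gen a) (poly_act scale (coord b j * coord a i) f)))"
    unfolding sq by (subst (2) sum.swap) (simp add: sum.distrib)
  also have "\<dots> = (\<Sum>a=1..m. \<Sum>b=1..m. if a = b then
      sp_scale scale (-2) (poly_act scale (coord a i * coord a j) f) else 0)"
  proof (intro sum.cong refl)
    fix a b assume ab: "a \<in> {1..m}" "b \<in> {1..m}"
    let ?g = "poly_act scale (coord a i * coord b j) f"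
    have "cliff_act act (cl_gen a) (cliff_act act (cl_gen b) ?g)
        + cliff_act act (cl_gen b) (cliff_act act (cl_gen a) ?g)
        = (if a = b then sp_scale scale (-2) ?g else 0)"
      using act_gen_anticommute[OF ab] ab
      by (intro poly_mapping_eqI)
         (simp add: lookup_add lookup_cliff_act cl_gen_in_clifford sp_scale_def
           lookup_map_additive del: atLeastAtMost_iff)
    then show "cliff_act act (cl_gen a) (cliff_act act (cl_gen b) ?g)
        + cliff_act act (cl_gen b) (cliff_act act (cl_gen a) (poly_act scale (coord b j * coord a i) f))
        = (if a = b then sp_scale scale (-2) (poly_act scale (coord a i * coord a j) f) else 0)"
      by (auto simp: mult.commute)
  qed
  also have "\<dots> = (\<Sum>a=1..m. sp_scale scale (-2) (poly_act scale (coord a i * coord a j) f))"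
    by simp
  also have "\<dots> = poly_act scale (- 2 * r_sq m i j) f"
  proof -
    have "Poly_Mapping.single 0 (-2 :: complex) = (-2 :: cpoly)"
      by (simp add: single_uminus)
    then have "sp_scale scale (-2) g = poly_act scale (-2) g" for g
      by (simp only: sp_scale_eq_poly_act)
    then show ?thesis
      by (simp only: r_sq_def sum_distrib_left poly_act_sum_left poly_act_mult)
  qed
  finally show ?thesis .
qed

end

section \<open>Regular sequences of operators\<close>

text \<open>The vector variables do not commute, so sums of their images are treated as subgroups
  rather than as submodules over a ring of operators.\<close>

definition add_subgroup :: "'a::ab_group_add set \<Rightarrow> bool" where
  "add_subgroup W \<longleftrightarrow> 0 \<in> W \<and> (\<forall>x\<in>W. \<forall>y\<in>W. x + y \<in> W) \<and> (\<forall>x\<in>W. - x \<in> W)"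

lemma add_subgroupD:
  assumes "add_subgroup W"
  shows "0 \<in> W" "x \<in> W \<Longrightarrow> y \<in> W \<Longrightarrow> x + y \<in> W" "x \<in> W \<Longrightarrow> - x \<in> W"
    "x \<in> W \<Longrightarrow> y \<in> W \<Longrightarrow> x - y \<in> W"
  using assms unfolding add_subgroup_def by (auto simp: diff_conv_add_uminus simp del: add_uminus_conv_diff)

lemma add_subgroup_sum:
  "add_subgroup W \<Longrightarrow> (\<And>i. i \<in> I \<Longrightarrow> f i \<in> W) \<Longrightarrow> sum f I \<in> W"
  by (induction I rule: infinite_finite_induct) (auto intro: add_subgroupD)

definition adjoin_image :: "('a::ab_group_add \<Rightarrow> 'a) \<Rightarrow> 'a set \<Rightarrow> 'a set" where
  "adjoin_image a W = {w + a f | w f. w \<in> W}"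

lemma adjoin_imageI: "w \<in> W \<Longrightarrow> w + a f \<in> adjoin_image a W"
  by (auto simp: adjoin_image_def)

lemma adjoin_image_image: "add_subgroup W \<Longrightarrow> a f \<in> adjoin_image a W"
  using adjoin_imageI[of 0 W a f] by (simp add: add_subgroupD)

lemma adjoin_image_base: "additive a \<Longrightarrow> w \<in> W \<Longrightarrow> w \<in> adjoin_image a W"
  using adjoin_imageI[of w W a 0] by (simp add: additive.zero)

lemma add_subgroup_adjoin_image:
  assumes "add_subgroup W" "additive a"
  shows "add_subgroup (adjoin_image a W)"
proof -
  interpret additive a by fact
  show ?thesis
    unfolding add_subgroup_def
  proof (intro conjI ballI)
    show "0 \<in> adjoin_image a W" using assms by (simp add: adjoin_image_base add_subgroupD)
  next
    fix x y assume "x \<in> adjoin_image a W" "y \<in> adjoin_image a W"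
    then obtain w f v g where "x = w + a f" "y = v + a g" "w \<in> W" "v \<in> W"
      by (auto simp: adjoin_image_def)
    then have "x + y = (w + v) + a (f + g)" "w + v \<in> W"
      using assms by (auto simp: add algebra_simps intro: add_subgroupD)
    then show "x + y \<in> adjoin_image a W" by (simp add: adjoin_imageI)
  next
    fix x assume "x \<in> adjoin_image a W"
    then obtain w f where "x = w + a f" "w \<in> W" by (auto simp: adjoin_image_def)
    then have "- x = (- w) + a (- f)" "- w \<in> W"
      using assms by (auto simp: minus algebra_simps intro: add_subgroupD)
    then show "- x \<in> adjoin_image a W" by (metis adjoin_imageI)
  qed
qed

text \<open>For commuting operators and a submodule \<open>W\<close> this is regularity modulo
  \<open>W\<close>, except that the last quotient may be zero. Invariance of \<open>W\<close> under
  the operators is not part of the notion; where it matters, it is a separate hypothesis.\<close>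

fun regular_seq :: "'a::ab_group_add set \<Rightarrow> ('a \<Rightarrow> 'a) list \<Rightarrow> bool" where
  "regular_seq W [] \<longleftrightarrow> True"
| "regular_seq W (a # as) \<longleftrightarrow> (\<forall>f. a f \<in> W \<longrightarrow> f \<in> W) \<and> regular_seq (adjoin_image a W) as"


section \<open>Polynomials with coprime leading monomials\<close>

text \<open>Leading with respect to a weight, not to a monomial order: several of the lighter
  monomials may share a weight. A unique heaviest monomial with coefficient 1 is enough for
  triangularity.\<close>

definition has_leading_monomial ::
  "('a::monoid_add \<Rightarrow> nat) \<Rightarrow> ('a \<Rightarrow>\<^sub>0 complex) \<Rightarrow> 'a \<Rightarrow> bool" where
  "has_leading_monomial wt p \<alpha> \<longleftrightarrow>
     (\<exists>q. p = Poly_Mapping.single \<alpha> 1 + q \<and> (\<forall>\<beta>\<in>Poly_Mapping.keys q. wt \<beta> < wt \<alpha>))"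

lemma has_leading_monomial_one: "has_leading_monomial wt 1 0"
  unfolding has_leading_monomial_def by (rule exI[of _ 0]) simp

lemma has_leading_monomial_mult:
  fixes wt :: "'a::comm_monoid_add \<Rightarrow> nat"
  assumes wt: "\<And>\<alpha> \<beta>. wt (\<alpha> + \<beta>) = wt \<alpha> + wt \<beta>"
    and "has_leading_monomial wt p \<alpha>" "has_leading_monomial wt q \<beta>"
  shows "has_leading_monomial wt (p * q) (\<alpha> + \<beta>)"
proof -
  obtain p' q' where p: "p = Poly_Mapping.single \<alpha> 1 + p'" "\<And>\<gamma>. \<gamma> \<in> Poly_Mapping.keys p' \<Longrightarrow> wt \<gamma> < wt \<alpha>"
    and q: "q = Poly_Mapping.single \<beta> 1 + q'" "\<And>\<gamma>. \<gamma> \<in> Poly_Mapping.keys q' \<Longrightarrow> wt \<gamma> < wt \<beta>"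
    using assms(2,3) by (auto simp: has_leading_monomial_def)
  define r where "r = Poly_Mapping.single \<alpha> 1 * q' + p' * q"
  have eq: "p * q = Poly_Mapping.single (\<alpha> + \<beta>) 1 + r"
    by (simp add: r_def p(1) q(1) mult_single algebra_simps)
  have q_le: "wt \<gamma> \<le> wt \<beta>" if "\<gamma> \<in> Poly_Mapping.keys q" for \<gamma>
    using that keys_add[of "Poly_Mapping.single \<beta> 1" q'] q by (fastforce dest: less_imp_le split: if_splits)
  have "wt \<gamma> < wt (\<alpha> + \<beta>)" if "\<gamma> \<in> Poly_Mapping.keys r" for \<gamma>
  proof -
    from that consider "\<gamma> \<in> Poly_Mapping.keys (Poly_Mapping.single \<alpha> 1 * q')"
      | "\<gamma> \<in> Poly_Mapping.keys (p' * q)"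
      using keys_add[of "Poly_Mapping.single \<alpha> 1 * q'" "p' * q"] unfolding r_def by blast
    then show ?thesis
    proof cases
      case 1
      then obtain \<delta> where "\<delta> \<in> Poly_Mapping.keys q'" "\<gamma> = \<alpha> + \<delta>"
        using keys_mult[of "Poly_Mapping.single \<alpha> 1" q'] by (auto split: if_splits)
      then show ?thesis using q(2) by (simp add: wt)
    next
      case 2
      then obtain \<delta> \<epsilon> where "\<delta> \<in> Poly_Mapping.keys p'" "\<epsilon> \<in> Poly_Mapping.keys q" "\<gamma> = \<delta> + \<epsilon>"
        using keys_mult[of p' q] by auto
      then show ?thesis using p(2) q_le by (simp add: wt add_less_le_mono)
    qed
  qed
  with eq show ?thesis unfolding has_leading_monomial_def by blast
qed

lemma has_leading_monomial_power:
  fixes wt :: "'a::comm_monoid_add \<Rightarrow> nat"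
  assumes wt: "\<And>\<alpha> \<beta>. wt (\<alpha> + \<beta>) = wt \<alpha> + wt \<beta>" and "has_leading_monomial wt p \<alpha>"
  shows "has_leading_monomial wt (p ^ n) (\<Sum>t<n. \<alpha>)"
proof (induction n)
  case (Suc n)
  from has_leading_monomial_mult[of wt, OF wt assms(2) Suc] show ?case by (simp add: add.commute)
qed (simp add: has_leading_monomial_one)

lemma has_leading_monomial_prod:
  fixes wt :: "'a::comm_monoid_add \<Rightarrow> nat"
  assumes wt: "\<And>\<alpha> \<beta>. wt (\<alpha> + \<beta>) = wt \<alpha> + wt \<beta>"
    and "finite I" "\<And>i. i \<in> I \<Longrightarrow> has_leading_monomial wt (p i) (\<alpha> i)"
  shows "has_leading_monomial wt (\<Prod>i\<in>I. p i) (\<Sum>i\<in>I. \<alpha> i)"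
  using assms(2,3)
  by (induction I rule: finite_induct)
     (simp_all add: has_leading_monomial_one has_leading_monomial_mult[of wt, OF wt])

section \<open>Substituting polynomials for pairwise coprime monomials\<close>

definition linear_ext :: "('a \<Rightarrow> 'b \<Rightarrow> 'c) \<Rightarrow> ('a \<Rightarrow>\<^sub>0 'b::zero) \<Rightarrow> 'c::comm_monoid_add" where
  "linear_ext \<phi> f = (\<Sum>\<gamma>\<in>Poly_Mapping.keys f. \<phi> \<gamma> (Poly_Mapping.lookup f \<gamma>))"

lemma additive_linear_ext:
  fixes \<phi> :: "'a \<Rightarrow> 'b::ab_group_add \<Rightarrow> 'c::ab_group_add"
  assumes "\<And>\<gamma>. additive (\<phi> \<gamma>)"
  shows "additive (linear_ext \<phi>)"
proof
  fix f g :: "'a \<Rightarrow>\<^sub>0 'b"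
  define A where "A = Poly_Mapping.keys f \<union> Poly_Mapping.keys g"
  have ext: "linear_ext \<phi> h = (\<Sum>\<gamma>\<in>A. \<phi> \<gamma> (Poly_Mapping.lookup h \<gamma>))"
    if "Poly_Mapping.keys h \<subseteq> A" for h
    unfolding linear_ext_def using that
    by (intro sum.mono_neutral_left) (auto simp: A_def in_keys_iff additive.zero[OF assms])
  have "Poly_Mapping.keys (f + g) \<subseteq> A" using keys_add[of f g] by (auto simp: A_def)
  then show "linear_ext \<phi> (f + g) = linear_ext \<phi> f + linear_ext \<phi> g"
    by (simp add: ext lookup_add additive.add[OF assms] sum.distrib A_def)
qed

lemma linear_ext_single: "\<phi> \<gamma> 0 = 0 \<Longrightarrow> linear_ext \<phi> (Poly_Mapping.single \<gamma> s) = \<phi> \<gamma> s"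
  by (simp add: linear_ext_def)

text \<open>
  \<open>mult_of i \<gamma>\<close> is the largest \<open>n\<close> such that \<open>\<mu>\<^sub>i\<^sup>n\<close> divides \<open>x\<^sup>\<gamma>\<close>; pairwise coprimality of the
  \<open>\<mu>\<^sub>i\<close> is expressed by the assumption \<open>mult_of_add\<close>.
\<close>

locale coprime_leading_monomials = spinor_module m scale act
  for m :: nat and scale :: "complex \<Rightarrow> 's::ab_group_add \<Rightarrow> 's" and act +
  fixes I :: "'i set" and p :: "'i \<Rightarrow> cpoly" and \<mu> :: "'i \<Rightarrow> (nat \<times> nat) \<Rightarrow>\<^sub>0 nat"
    and wt :: "((nat \<times> nat) \<Rightarrow>\<^sub>0 nat) \<Rightarrow> nat"
    and mult_of :: "'i \<Rightarrow> ((nat \<times> nat) \<Rightarrow>\<^sub>0 nat) \<Rightarrow> nat"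
  assumes finite_I: "finite I"
    and wt_add: "wt (\<alpha> + \<beta>) = wt \<alpha> + wt \<beta>"
    and leading: "i \<in> I \<Longrightarrow> has_leading_monomial wt (p i) (\<mu> i)"
    and mult_of_add: "i \<in> I \<Longrightarrow> j \<in> I \<Longrightarrow> mult_of i (\<mu> j + \<alpha>) = mult_of i \<alpha> + (if i = j then 1 else 0)"
    and mult_of_pos: "i \<in> I \<Longrightarrow> mult_of i \<alpha> > 0 \<Longrightarrow> \<exists>\<beta>. \<alpha> = \<mu> i + \<beta>"
begin

text \<open>Exponents are written additively, so the inner sum stands for a power of the i-th
  monomial. The whole is the exponent of the largest product of powers of the \<mu> that divides the
  monomial.\<close>

definition monomial_part where
  "monomial_part \<gamma> = (\<Sum>i\<in>I. \<Sum>t<mult_of i \<gamma>. \<mu> i)"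

definition remainder where
  "remainder \<gamma> = \<gamma> - monomial_part \<gamma>"

lemma monomial_part_add:
  assumes "i \<in> I"
  shows "monomial_part (\<mu> i + \<gamma>) = \<mu> i + monomial_part \<gamma>"
proof -
  have "monomial_part (\<mu> i + \<gamma>)
      = (\<Sum>j\<in>I. (if i = j then \<mu> i else 0) + (\<Sum>t<mult_of j \<gamma>. \<mu> j))"
    unfolding monomial_part_def
  proof (intro sum.cong refl)
    fix j assume "j \<in> I"
    then show "(\<Sum>t<mult_of j (\<mu> i + \<gamma>). \<mu> j)
        = (if i = j then \<mu> i else 0) + (\<Sum>t<mult_of j \<gamma>. \<mu> j)"
      using assms mult_of_add[of j i \<gamma>] by (auto simp: add.commute[of _ "\<mu> j"])
  qed
  then show ?thesis using assms finite_I by (simp add: sum.distrib monomial_part_def)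
qed

text \<open>The subtraction in \<open>remainder\<close> is truncated, so divisibility by
  \<open>monomial_part \<gamma>\<close> needs proof. One factor \<open>\<mu> i\<close> is stripped
  off at a time, and coprimality leaves the other multiplicities unchanged.\<close>

lemma remainder: "\<gamma> = monomial_part \<gamma> + remainder \<gamma>"
proof (induction "\<Sum>i\<in>I. mult_of i \<gamma>" arbitrary: \<gamma> rule: less_induct)
  case less
  show ?case
  proof (cases "\<forall>i\<in>I. mult_of i \<gamma> = 0")
    case True
    then show ?thesis by (simp add: monomial_part_def remainder_def)
  next
    case False
    then obtain i \<beta> where i: "i \<in> I" "\<gamma> = \<mu> i + \<beta>" using mult_of_pos by blast
    then have "(\<Sum>j\<in>I. mult_of j \<gamma>) = (\<Sum>j\<in>I. mult_of j \<beta>) + 1"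
      using finite_I by (simp add: mult_of_add sum.distrib cong: sum.cong)
    then have "\<beta> = monomial_part \<beta> + remainder \<beta>" using less by simp
    then have "\<gamma> = monomial_part \<gamma> + remainder \<beta>"
      using i monomial_part_add[of i \<beta>] by (simp add: add.assoc)
    then show ?thesis unfolding remainder_def by (metis add_diff_cancel_left')
  qed
qed

lemma remainder_add: "i \<in> I \<Longrightarrow> remainder (\<mu> i + \<gamma>) = remainder \<gamma>"
  using remainder[of \<gamma>] remainder[of "\<mu> i + \<gamma>"] monomial_part_add[of i \<gamma>]
  by (metis add.assoc add_left_cancel)

text \<open>Replacing \<open>\<mu>\<^sub>i\<close> by \<open>p\<^sub>i\<close>: a unitriangular bijection that turns multiplication by the monomials
  into multiplication by the polynomials.\<close>

definition substitute :: "'s spoly \<Rightarrow> 's spoly" where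
  "substitute = linear_ext (\<lambda>\<gamma> s. poly_act scale (\<Prod>i\<in>I. p i ^ mult_of i \<gamma>)
     (Poly_Mapping.single (remainder \<gamma>) s))"

lemma additive_substitute: "additive substitute"
  unfolding substitute_def
  by (rule additive_linear_ext) (simp add: additive_def single_add poly_act_add_right)

lemma substitute_single:
  "substitute (Poly_Mapping.single \<gamma> s) = poly_act scale (\<Prod>i\<in>I. p i ^ mult_of i \<gamma>)
     (Poly_Mapping.single (remainder \<gamma>) s)"
  unfolding substitute_def by (rule linear_ext_single) (simp add: poly_act_zero_right)

text \<open>Multiplication by \<open>\<mu> i\<close> raises the i-th multiplicity by one and changes
  neither the other multiplicities nor the remainder, so exactly one more factor \<open>p i\<close>
  appears.\<close>

lemma substitute_mult:
  assumes "i \<in> I"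
  shows "substitute (poly_act scale (Poly_Mapping.single (\<mu> i) 1) f) = poly_act scale (p i) (substitute f)"
proof (rule additive_single_eqI[where f = f])
  fix \<beta> s
  have "(\<Prod>j\<in>I. p j ^ mult_of j (\<mu> i + \<beta>))
      = (\<Prod>j\<in>I. (if i = j then p i else 1) * p j ^ mult_of j \<beta>)"
    using assms by (intro prod.cong) (auto simp: mult_of_add)
  also have "\<dots> = p i * (\<Prod>j\<in>I. p j ^ mult_of j \<beta>)"
    using assms finite_I by (simp add: prod.distrib)
  finally show "substitute (poly_act scale (Poly_Mapping.single (\<mu> i) 1) (Poly_Mapping.single \<beta> s))
      = poly_act scale (p i) (substitute (Poly_Mapping.single \<beta> s))"
    using assms by (simp add: poly_act_single_single substitute_single remainder_add poly_act_mult)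
qed (intro additive_compose[OF additive_substitute additive_poly_act]
       additive_compose[OF additive_poly_act additive_substitute])+

text \<open>The substituted product has leading monomial \<open>monomial_part \<gamma>\<close>;
  multiplying by the remainder restores \<gamma> and shifts all weights equally.\<close>

lemma substitute_unitriangular:
  "\<exists>h. substitute (Poly_Mapping.single \<gamma> s) = Poly_Mapping.single \<gamma> s + h
     \<and> (\<forall>\<beta>\<in>Poly_Mapping.keys h. wt \<beta> < wt \<gamma>)"
proof -
  have "has_leading_monomial wt (\<Prod>i\<in>I. p i ^ mult_of i \<gamma>) (monomial_part \<gamma>)"
    unfolding monomial_part_def using finite_I
    by (intro has_leading_monomial_prod has_leading_monomial_power wt_add leading)
  then obtain q where q: "(\<Prod>i\<in>I. p i ^ mult_of i \<gamma>) = Poly_Mapping.single (monomial_part \<gamma>) 1 + q"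
    "\<And>\<beta>. \<beta> \<in> Poly_Mapping.keys q \<Longrightarrow> wt \<beta> < wt (monomial_part \<gamma>)"
    by (auto simp: has_leading_monomial_def)
  have wt: "wt \<gamma> = wt (monomial_part \<gamma>) + wt (remainder \<gamma>)"
    using remainder[of \<gamma>] wt_add by metis
  show ?thesis
  proof (intro exI conjI ballI)
    show "substitute (Poly_Mapping.single \<gamma> s) = Poly_Mapping.single \<gamma> s
        + poly_act scale q (Poly_Mapping.single (remainder \<gamma>) s)"
      using remainder[of \<gamma>]
      by (simp add: substitute_single q(1) poly_act_add_left poly_act_single_single)
    fix \<beta> assume "\<beta> \<in> Poly_Mapping.keys (poly_act scale q (Poly_Mapping.single (remainder \<gamma>) s))"
    then obtain \<alpha> where "\<alpha> \<in> Poly_Mapping.keys q" "\<beta> = \<alpha> + remainder \<gamma>"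
      using keys_poly_act[of q "Poly_Mapping.single (remainder \<gamma>) s"] by (auto split: if_splits)
    then show "wt \<beta> < wt \<gamma>" using q(2) by (simp add: wt wt_add)
  qed
qed

text \<open>Back substitution: the error in hitting a single term consists of lighter terms, and
  weights are natural numbers.\<close>

lemma substitute_surj: "\<exists>g. substitute g = f"
proof -
  have sub: "add_subgroup (range substitute)"
    using additive.zero[OF additive_substitute]
    by (auto simp: add_subgroup_def image_iff intro: exI[of _ 0]
        simp flip: additive.minus[OF additive_substitute] additive.add[OF additive_substitute])
  have "Poly_Mapping.single \<gamma> s \<in> range substitute" for \<gamma> s
  proof (induction "wt \<gamma>" arbitrary: \<gamma> s rule: less_induct)
    case less
    obtain h where h: "substitute (Poly_Mapping.single \<gamma> s) = Poly_Mapping.single \<gamma> s + h"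
      "\<And>\<beta>. \<beta> \<in> Poly_Mapping.keys h \<Longrightarrow> wt \<beta> < wt \<gamma>"
      using substitute_unitriangular[of \<gamma> s] by blast
    have "h \<in> range substitute"
      by (subst sum_single_lookup[symmetric]) (intro add_subgroup_sum[OF sub] less h(2))
    then have "substitute (Poly_Mapping.single \<gamma> s) - h \<in> range substitute"
      using sub by (auto intro: add_subgroupD)
    then show ?case by (simp add: h(1))
  qed
  then have "f \<in> range substitute"
    by (subst sum_single_lookup[symmetric]) (intro add_subgroup_sum[OF sub])
  then show ?thesis by auto
qed

text \<open>A heaviest monomial of \<open>f\<close> keeps its coefficient, because the image of any
  other term adds only monomials lighter than that term.\<close>

lemma substitute_eq_0:
  assumes "substitute f = 0"
  shows "f = 0"
proof (rule ccontr)
  assume "f \<noteq> 0"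
  then have ne: "Poly_Mapping.keys f \<noteq> {}" by simp
  have "Max (wt ` Poly_Mapping.keys f) \<in> wt ` Poly_Mapping.keys f" using ne by (intro Max_in) auto
  then obtain \<gamma> where \<gamma>: "\<gamma> \<in> Poly_Mapping.keys f" "wt \<gamma> = Max (wt ` Poly_Mapping.keys f)" by auto
  have max: "wt \<beta> \<le> wt \<gamma>" if "\<beta> \<in> Poly_Mapping.keys f" for \<beta>
    using that \<gamma>(2) by simp
  have lk: "Poly_Mapping.lookup (substitute (Poly_Mapping.single \<beta> s)) \<gamma> = (if \<beta> = \<gamma> then s else 0)"
    if "\<beta> \<in> Poly_Mapping.keys f" for \<beta> s
  proof -
    obtain h where h: "substitute (Poly_Mapping.single \<beta> s) = Poly_Mapping.single \<beta> s + h"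
      "\<And>\<alpha>. \<alpha> \<in> Poly_Mapping.keys h \<Longrightarrow> wt \<alpha> < wt \<beta>"
      using substitute_unitriangular[of \<beta> s] by blast
    have "\<gamma> \<notin> Poly_Mapping.keys h" using h(2)[of \<gamma>] max[OF that] by auto
    then show ?thesis by (simp add: h(1) lookup_add lookup_single in_keys_iff when_def)
  qed
  have "substitute f = (\<Sum>\<beta>\<in>Poly_Mapping.keys f.
      substitute (Poly_Mapping.single \<beta> (Poly_Mapping.lookup f \<beta>)))"
    by (metis additive.sum[OF additive_substitute] sum_single_lookup)
  then have "Poly_Mapping.lookup (substitute f) \<gamma>
      = (\<Sum>\<beta>\<in>Poly_Mapping.keys f. if \<beta> = \<gamma> then Poly_Mapping.lookup f \<beta> else 0)"
    by (simp add: lookup_sum lk)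
  also have "\<dots> = Poly_Mapping.lookup f \<gamma>" using \<gamma>(1) by simp
  finally show False using \<gamma>(1) assms by (simp add: in_keys_iff)
qed

section \<open>Regularity by comparison with monomial ideals\<close>

definition ideal_of :: "'i set \<Rightarrow> 's spoly set" where
  "ideal_of Q = {\<Sum>j\<in>Q. poly_act scale (p j) (h j) | h. True}"

lemma ideal_of_insert:
  assumes "i \<notin> Q" "finite Q"
  shows "ideal_of (insert i Q) = adjoin_image (poly_act scale (p i)) (ideal_of Q)"
proof (intro equalityI subsetI)
  fix x assume "x \<in> ideal_of (insert i Q)"
  then obtain h where "x = (\<Sum>j\<in>insert i Q. poly_act scale (p j) (h j))" by (auto simp: ideal_of_def)
  then have "x = (\<Sum>j\<in>Q. poly_act scale (p j) (h j)) + poly_act scale (p i) (h i)"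
    using assms by (simp add: add.commute)
  then show "x \<in> adjoin_image (poly_act scale (p i)) (ideal_of Q)"
    by (auto simp: adjoin_image_def ideal_of_def)
next
  fix x assume "x \<in> adjoin_image (poly_act scale (p i)) (ideal_of Q)"
  then obtain h f where x: "x = (\<Sum>j\<in>Q. poly_act scale (p j) (h j)) + poly_act scale (p i) f"
    by (auto simp: adjoin_image_def ideal_of_def)
  have "(\<Sum>j\<in>Q. poly_act scale (p j) ((h(i := f)) j)) = (\<Sum>j\<in>Q. poly_act scale (p j) (h j))"
    using assms by (intro sum.cong) auto
  then have "x = (\<Sum>j\<in>insert i Q. poly_act scale (p j) ((h(i := f)) j))"
    using assms x by (simp add: add.commute)
  then show "x \<in> ideal_of (insert i Q)" unfolding ideal_of_def by blast
qed

lemma add_subgroup_ideal_of: "finite Q \<Longrightarrow> add_subgroup (ideal_of Q)"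
proof (induction Q rule: finite_induct)
  case empty
  show ?case by (simp add: ideal_of_def add_subgroup_def)
qed (simp add: ideal_of_insert add_subgroup_adjoin_image additive_poly_act)

lemma poly_act_in_ideal_of: "finite Q \<Longrightarrow> j \<in> Q \<Longrightarrow> poly_act scale (p j) f \<in> ideal_of Q"
  by (metis adjoin_image_image add_subgroup_ideal_of finite_insert
      ideal_of_insert mk_disjoint_insert)

text \<open>\<open>substitute\<close> carries the submodule generated by the monomials
  \<open>\<mu> j\<close> onto the one generated by the \<open>p j\<close>, and membership in a
  monomial submodule is decided term by term.\<close>

lemma substitute_in_ideal_of_iff:
  assumes "Q \<subseteq> I"
  shows "substitute f \<in> ideal_of Q \<longleftrightarrow> (\<forall>\<gamma>\<in>Poly_Mapping.keys f. \<exists>j\<in>Q. mult_of j \<gamma> > 0)"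
proof
  assume "substitute f \<in> ideal_of Q"
  then obtain h where "substitute f = (\<Sum>j\<in>Q. poly_act scale (p j) (h j))" by (auto simp: ideal_of_def)
  moreover have "\<forall>j. \<exists>g. substitute g = h j" by (simp add: substitute_surj)
  then obtain h' where "\<And>j. substitute (h' j) = h j" by metis
  ultimately have "substitute f
      = substitute (\<Sum>j\<in>Q. poly_act scale (Poly_Mapping.single (\<mu> j) 1) (h' j))"
    using assms by (auto simp: additive.sum[OF additive_substitute] substitute_mult intro!: sum.cong)
  then have f: "f = (\<Sum>j\<in>Q. poly_act scale (Poly_Mapping.single (\<mu> j) 1) (h' j))"
    using substitute_eq_0[of "f - (\<Sum>j\<in>Q. poly_act scale (Poly_Mapping.single (\<mu> j) 1) (h' j))"]
    by (simp add: additive.diff[OF additive_substitute])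
  show "\<forall>\<gamma>\<in>Poly_Mapping.keys f. \<exists>j\<in>Q. mult_of j \<gamma> > 0"
  proof
    fix \<gamma> assume "\<gamma> \<in> Poly_Mapping.keys f"
    then have "(\<Sum>j\<in>Q. Poly_Mapping.lookup (poly_act scale (Poly_Mapping.single (\<mu> j) 1) (h' j)) \<gamma>) \<noteq> 0"
      by (simp add: f in_keys_iff lookup_sum)
    then obtain j where j: "j \<in> Q" "\<gamma> \<in> Poly_Mapping.keys (poly_act scale (Poly_Mapping.single (\<mu> j) 1) (h' j))"
      unfolding in_keys_iff by (rule sum.not_neutral_contains_not_neutral)
    then obtain \<beta> where "\<gamma> = \<mu> j + \<beta>"
      using keys_poly_act[of "Poly_Mapping.single (\<mu> j) 1" "h' j"] by auto
    then have "mult_of j \<gamma> > 0" using j(1) assms mult_of_add[of j j \<beta>] by auto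
    with j(1) show "\<exists>j\<in>Q. mult_of j \<gamma> > 0" ..
  qed
next
  assume *: "\<forall>\<gamma>\<in>Poly_Mapping.keys f. \<exists>j\<in>Q. mult_of j \<gamma> > 0"
  have fin: "finite Q" using assms finite_I by (rule finite_subset)
  have "substitute (Poly_Mapping.single \<gamma> s) \<in> ideal_of Q" if \<gamma>: "\<gamma> \<in> Poly_Mapping.keys f" for \<gamma> s
  proof -
    obtain j \<beta> where j: "j \<in> Q" "\<gamma> = \<mu> j + \<beta>" using * \<gamma> assms mult_of_pos by (meson subsetD)
    have "substitute (Poly_Mapping.single \<gamma> s)
        = poly_act scale (p j) (substitute (Poly_Mapping.single \<beta> s))"
      using substitute_mult[of j "Poly_Mapping.single \<beta> s"] j assms
      by (auto simp: poly_act_single_single)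
    then show ?thesis using poly_act_in_ideal_of[OF fin j(1)] by simp
  qed
  moreover have "substitute f = (\<Sum>\<beta>\<in>Poly_Mapping.keys f.
      substitute (Poly_Mapping.single \<beta> (Poly_Mapping.lookup f \<beta>)))"
    by (metis additive.sum[OF additive_substitute] sum_single_lookup)
  ultimately show "substitute f \<in> ideal_of Q"
    by (auto intro!: add_subgroup_sum add_subgroup_ideal_of fin)
qed

text \<open>Pulled back along \<open>substitute\<close>, the claim concerns monomials. There it
  holds because multiplication by \<open>\<mu> i\<close> does not change the multiplicity of
  \<open>\<mu> j\<close> for j \<noteq> i.\<close>

lemma regular_mod_ideal_of:
  assumes "Q \<subseteq> I" "i \<in> I" "i \<notin> Q" "poly_act scale (p i) f \<in> ideal_of Q"
  shows "f \<in> ideal_of Q"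
proof -
  obtain g where g: "f = substitute g" using substitute_surj by metis
  have "substitute (poly_act scale (Poly_Mapping.single (\<mu> i) 1) g) \<in> ideal_of Q"
    using assms by (simp add: substitute_mult flip: g)
  then have *: "\<forall>\<gamma>\<in>Poly_Mapping.keys (poly_act scale (Poly_Mapping.single (\<mu> i) 1) g).
      \<exists>j\<in>Q. mult_of j \<gamma> > 0"
    using substitute_in_ideal_of_iff[OF assms(1)] by blast
  have "\<exists>j\<in>Q. mult_of j \<gamma> > 0" if "\<gamma> \<in> Poly_Mapping.keys g" for \<gamma>
  proof -
    have "\<mu> i + \<gamma> \<in> Poly_Mapping.keys (poly_act scale (Poly_Mapping.single (\<mu> i) 1) g)"
      using that by (simp add: in_keys_iff lookup_poly_act_single)
    then obtain j where "j \<in> Q" "mult_of j (\<mu> i + \<gamma>) > 0" using * by blast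
    moreover from this have "j \<in> I" "j \<noteq> i" using assms by auto
    ultimately show ?thesis using assms mult_of_add[of j i \<gamma>] by auto
  qed
  then show ?thesis unfolding g substitute_in_ideal_of_iff[OF assms(1)] by blast
qed

lemma regular_seq_ideal_of:
  assumes "Q \<subseteq> I" "set is \<subseteq> I - Q" "distinct is"
  shows "regular_seq (ideal_of Q) (map (\<lambda>i. poly_act scale (p i)) is)"
  using assms
proof (induction "is" arbitrary: Q)
  case (Cons i "is")
  have "finite Q" using Cons.prems finite_I by (meson finite_subset)
  then have "regular_seq (adjoin_image (poly_act scale (p i)) (ideal_of Q))
      (map (\<lambda>i. poly_act scale (p i)) is)"
    using Cons.IH[of "insert i Q"] Cons.prems by (auto simp: ideal_of_insert)
  then show ?case using Cons.prems regular_mod_ideal_of[of Q i] by auto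
qed simp

end

section \<open>Replacing squares by their roots in a regular sequence\<close>

lemma adjoin_image_commute:
  "adjoin_image a (adjoin_image b W) = adjoin_image b (adjoin_image a W)"
proof -
  have "adjoin_image a (adjoin_image b W) \<subseteq> adjoin_image b (adjoin_image a W)" for a b
  proof
    fix y assume "y \<in> adjoin_image a (adjoin_image b W)"
    then obtain w f g where "y = (w + b g) + a f" "w \<in> W" by (auto simp: adjoin_image_def)
    then have "y = (w + a f) + b g" "w + a f \<in> adjoin_image a W"
      by (auto simp: adjoin_imageI algebra_simps)
    then show "y \<in> adjoin_image b (adjoin_image a W)" by (simp add: adjoin_imageI)
  qed
  then show ?thesis by blast
qed

lemma adjoin_image_closed:
  assumes "add_subgroup V" "additive T" "\<And>w. w \<in> W \<Longrightarrow> T w \<in> V" "\<And>f. T (a f) \<in> V"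
    and "y \<in> adjoin_image a W"
  shows "T y \<in> V"
proof -
  obtain w f where "y = w + a f" "w \<in> W" using assms(5) by (auto simp: adjoin_image_def)
  then show ?thesis
    using assms(3,4) by (simp add: additive.add[OF assms(2)] add_subgroupD(2)[OF assms(1)])
qed

text \<open>The hypothesis on \<open>x f\<close> follows from \<open>f \<in> U\<close> if \<open>x\<close> is injective modulo \<open>U\<close>, and unlike
  injectivity it is inherited when \<open>U\<close> is enlarged by the images of further members of the sequence.\<close>

lemma regular_seq_root_aux:
  assumes "add_subgroup U" "additive x" "\<And>u. u \<in> U \<Longrightarrow> x u \<in> U"
    and "\<And>f. x f \<in> adjoin_image (\<lambda>f. x (x f)) U \<Longrightarrow> f \<in> adjoin_image x U"
    and "\<And>b. b \<in> set bs \<Longrightarrow> additive b" "\<And>b f. b \<in> set bs \<Longrightarrow> x (b f) = b (x f)"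
    and "\<And>b u. b \<in> set bs \<Longrightarrow> u \<in> U \<Longrightarrow> b u \<in> U"
    and "\<And>b c f. b \<in> set bs \<Longrightarrow> c \<in> set bs \<Longrightarrow> b (c f) = c (b f)"
    and "regular_seq (adjoin_image (\<lambda>f. x (x f)) U) bs"
  shows "regular_seq (adjoin_image x U) bs"
  using assms
proof (induction bs arbitrary: U)
  case (Cons b bs)
  note U = Cons.prems(1) and x = Cons.prems(2) and xU = Cons.prems(3) and root = Cons.prems(4)
  have b: "additive b" and xb: "\<And>f. x (b f) = b (x f)" and bU: "\<And>u. u \<in> U \<Longrightarrow> b u \<in> U"
    using Cons.prems(5-7) by auto
  interpret x: additive x by fact
  interpret b: additive b by fact
  have bU_add: "add_subgroup (adjoin_image b U)" by (rule add_subgroup_adjoin_image[OF U b])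
  have xx: "additive (\<lambda>f. x (x f))" by (rule additive_compose[OF x x])
  have reg: "f \<in> adjoin_image x U" if "b f \<in> adjoin_image x U" for f
  proof -
    \<comment> \<open>Applying x once more leads to the image of x^2, modulo which \<open>b\<close>
      is injective; \<open>root\<close> then removes the extra x.\<close>
    have "x (b f) \<in> adjoin_image (\<lambda>f. x (x f)) U"
      using adjoin_image_closed[OF add_subgroup_adjoin_image[OF U xx] x _ _ that]
      by (simp add: adjoin_image_base[OF xx] adjoin_image_image[OF U, of "\<lambda>f. x (x f)"] xU)
    then have "x f \<in> adjoin_image (\<lambda>f. x (x f)) U" using Cons.prems(9) by (simp add: xb)
    then show ?thesis by (rule root)
  qed
  have "regular_seq (adjoin_image x (adjoin_image b U)) bs"
  proof (rule Cons.IH[OF bU_add x])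
    fix u assume "u \<in> adjoin_image b U"
    then show "x u \<in> adjoin_image b U"
      by (rule adjoin_image_closed[OF bU_add x, rotated 2])
         (auto simp: xb adjoin_image_image U intro: adjoin_image_base b xU)
  next
    fix f assume "x f \<in> adjoin_image (\<lambda>f. x (x f)) (adjoin_image b U)"
    then obtain u h g where eq: "x f = u + b h + x (x g)" and u: "u \<in> U"
      by (auto simp: adjoin_image_def)
    \<comment> \<open>So \<open>b h\<close> is in U + im x, and \<open>reg\<close> gives h = u' + x
      h'. After subtracting \<open>b h'\<close> from \<open>f\<close> the term b h is gone, and
      \<open>root\<close> for the old \<open>U\<close> applies.\<close>
    have "b h = (- u) + x (f - x g)" using eq by (simp add: x.diff algebra_simps)
    with adjoin_imageI[OF add_subgroupD(3)[OF U u], of x "f - x g"]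
    have "b h \<in> adjoin_image x U" by (simp only:)
    then obtain u' h' where h: "h = u' + x h'" and u': "u' \<in> U"
      using reg[of h] by (auto simp: adjoin_image_def)
    have "x (f - b h') = (u + b u') + x (x g)"
      using eq h by (simp add: b.add x.diff xb)
    then have "x (f - b h') \<in> adjoin_image (\<lambda>f. x (x f)) U"
      using u u' bU add_subgroupD(2)[OF U] by (auto simp: adjoin_image_def)
    then have "f - b h' \<in> adjoin_image x U" by (rule root)
    then have "(f - b h') + b h' \<in> adjoin_image b (adjoin_image x U)" by (rule adjoin_imageI)
    then show "f \<in> adjoin_image x (adjoin_image b U)" by (simp add: adjoin_image_commute)
  next
    fix c u assume c: "c \<in> set bs" and "u \<in> adjoin_image b U"
    then obtain w f where "u = w + b f" "w \<in> U" by (auto simp: adjoin_image_def)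
    moreover from this have "c w \<in> U" using c Cons.prems(7) by simp
    moreover have "c (b f) = b (c f)" using c Cons.prems(8) by simp
    moreover have "additive c" using c Cons.prems(5) by simp
    ultimately show "c u \<in> adjoin_image b U" by (simp add: additive.add adjoin_imageI)
  qed (use Cons.prems in \<open>auto simp: adjoin_image_commute\<close>)
  with reg show ?case by (simp add: adjoin_image_commute)
qed simp

text \<open>As \<open>U\<close> is invariant under x, injectivity of x^2 modulo \<open>U\<close>
  implies that of x. Cancelling x in x f = u + x (x g) then gives the hypothesis that propagates
  along the sequence.\<close>

lemma regular_seq_root:
  assumes "add_subgroup U" "additive x" "\<And>u. u \<in> U \<Longrightarrow> x u \<in> U"
    and "\<And>b. b \<in> set bs \<Longrightarrow> additive b" "\<And>b f. b \<in> set bs \<Longrightarrow> x (b f) = b (x f)"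
    and "\<And>b u. b \<in> set bs \<Longrightarrow> u \<in> U \<Longrightarrow> b u \<in> U"
    and "\<And>b c f. b \<in> set bs \<Longrightarrow> c \<in> set bs \<Longrightarrow> b (c f) = c (b f)"
    and "regular_seq U ((\<lambda>f. x (x f)) # bs)"
  shows "regular_seq U (x # bs)"
proof -
  interpret x: additive x by fact
  have inj: "f \<in> U" if "x f \<in> U" for f using assms(3)[OF that] assms(8) by simp
  have "f \<in> adjoin_image x U" if "x f \<in> adjoin_image (\<lambda>f. x (x f)) U" for f
  proof -
    obtain u g where "x f = u + x (x g)" "u \<in> U" using \<open>x f \<in> _\<close> by (auto simp: adjoin_image_def)
    then have "x (f - x g) \<in> U" by (simp add: x.diff)
    then have "f - x g \<in> U" by (rule inj)
    from adjoin_imageI[OF this, of x g] show ?thesis by simp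
  qed
  moreover have "regular_seq (adjoin_image (\<lambda>f. x (x f)) U) bs" using assms(8) by simp
  ultimately have "regular_seq (adjoin_image x U) bs"
    using assms(1-7) by (intro regular_seq_root_aux[of U x bs]) blast+
  then show ?thesis using inj by simp
qed

lemma regular_seq_append:
  "regular_seq W (as @ bs) \<longleftrightarrow> regular_seq W as \<and> regular_seq (fold adjoin_image as W) bs"
  by (induction as arbitrary: W) auto

lemma add_subgroup_fold_adjoin_image:
  "add_subgroup W \<Longrightarrow> (\<And>a. a \<in> set as \<Longrightarrow> additive a) \<Longrightarrow> add_subgroup (fold adjoin_image as W)"
  by (induction as arbitrary: W) (auto intro: add_subgroup_adjoin_image)

lemma fold_adjoin_image_base:
  "w \<in> W \<Longrightarrow> (\<And>a. a \<in> set as \<Longrightarrow> additive a) \<Longrightarrow> w \<in> fold adjoin_image as W"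
  by (induction as arbitrary: W) (auto intro: adjoin_image_base)

lemma fold_adjoin_image_image:
  "add_subgroup W \<Longrightarrow> (\<And>a. a \<in> set as \<Longrightarrow> additive a) \<Longrightarrow> a \<in> set as \<Longrightarrow> a f \<in> fold adjoin_image as W"
  by (induction as arbitrary: W)
     (auto intro: fold_adjoin_image_base adjoin_image_image add_subgroup_adjoin_image)

lemma fold_adjoin_image_closed:
  assumes "add_subgroup V" "additive T" "\<And>w. w \<in> W \<Longrightarrow> T w \<in> V"
    and "\<And>a f. a \<in> set as \<Longrightarrow> T (a f) \<in> V" "y \<in> fold adjoin_image as W"
  shows "T y \<in> V"
  using assms(3-5)
proof (induction as arbitrary: W)
  case (Cons a as)
  show ?case
    by (rule Cons.IH[of "adjoin_image a W"])
       (use Cons.prems adjoin_image_closed[OF assms(1,2), of W a] in auto)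
qed simp


section \<open>Monomials in a regular sequence are independent\<close>

text \<open>The head of the list acts last. The order matters because vector variables do not
  commute, and it agrees with that of the factors of x_J.\<close>

fun op_monomial :: "('a \<Rightarrow> 'a) list \<Rightarrow> nat list \<Rightarrow> 'a \<Rightarrow> 'a" where
  "op_monomial (g # gs) (e # es) f = (g ^^ e) (op_monomial gs es f)"
| "op_monomial _ _ f = f"

lemma additive_op_monomial:
  "(\<And>g. g \<in> set gs \<Longrightarrow> additive g) \<Longrightarrow> additive (op_monomial gs es)"
proof (induction gs es arbitrary: rule: list_induct2')
  case (4 g gs e es)
  then show ?case by (simp add: additive_def additive.add[OF additive_funpow[of g e]])
qed (simp_all add: additive_def)

text \<open>Write the sum as S0 + g S1, where S0 collects the terms without the first operator g.
  Modulo W + im g only S0 survives, so its coefficients vanish by induction on the sequence. Then g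
  S1 lies in \<open>W\<close>, hence so does S1, in which every exponent of g is one
  smaller.\<close>

lemma regular_seq_independent:
  fixes F :: "nat list \<Rightarrow> 'a::ab_group_add"
  assumes "add_subgroup W" "\<And>g. g \<in> set gs \<Longrightarrow> additive g" "regular_seq W gs"
    and "\<And>f. f \<in> M \<Longrightarrow> f \<in> fold adjoin_image gs W \<Longrightarrow> f = 0"
    and "finite E" "\<And>es. es \<in> E \<Longrightarrow> length es = length gs" "\<And>es. es \<in> E \<Longrightarrow> F es \<in> M"
    and "(\<Sum>es\<in>E. op_monomial gs es (F es)) \<in> W" "es \<in> E"
  shows "F es = 0"
  using assms
proof (induction gs arbitrary: W E F es)
  case Nil
  then have "E = {[]}" by auto
  then show ?case using Nil by auto
next
  case (Cons g gs)
  note W = Cons.prems(1)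
  have g: "additive g" and reg: "\<And>f. g f \<in> W \<Longrightarrow> f \<in> W" using Cons.prems(2,3) by auto
  interpret g: additive g by fact
  \<comment> \<open>Inner induction on a strict bound for the exponents of \<open>g\<close>, with
    \<open>W\<close> and the sequence fixed.\<close>
  have *: "\<forall>es\<in>E. F es = 0"
    if "finite E" "\<And>es. es \<in> E \<Longrightarrow> length es = length (g # gs)" "\<And>es. es \<in> E \<Longrightarrow> F es \<in> M"
      "(\<Sum>es\<in>E. op_monomial (g # gs) es (F es)) \<in> W" "\<And>es. es \<in> E \<Longrightarrow> hd es < n" for n E F
    using that
  proof (induction n arbitrary: E F)
    case 0
    then show ?case by auto
  next
    case (Suc n)
    define E0 where "E0 = {es. 0 # es \<in> E}"
    define shift where "shift = (\<lambda>es. Suc (hd es) # tl es)"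
    \<comment> \<open>The empty list is excluded because \<open>shift []\<close> involves the
      unspecified \<open>hd []\<close>, which would spoil injectivity.\<close>
    define E1 where "E1 = {es. es \<noteq> [] \<and> shift es \<in> E}"
    have inj0: "inj_on ((#) 0) E0" by simp
    have inj1: "inj_on shift E1"
      by (rule inj_onI) (auto simp: shift_def E1_def intro: list.expand)
    have E: "E = (#) 0 ` E0 \<union> shift ` E1"
    proof (intro equalityI subsetI)
      fix es assume es: "es \<in> E"
      then obtain e es' where es': "es = e # es'" using Suc.prems(2)[OF es] by (cases es) auto
      show "es \<in> (#) 0 ` E0 \<union> shift ` E1"
      proof (cases e)
        case 0
        then show ?thesis using es es' by (auto simp: E0_def)
      next
        case (Suc e')
        then have "es = shift (e' # es')" "e' # es' \<in> E1"
          using es es' by (auto simp: shift_def E1_def)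
        then show ?thesis by blast
      qed
    qed (auto simp: E0_def E1_def)
    have disj: "(#) 0 ` E0 \<inter> shift ` E1 = {}" by (auto simp: shift_def)
    have fin: "finite E0" "finite E1"
      using Suc.prems(1) finite_imageD[OF _ inj0] finite_imageD[OF _ inj1] unfolding E by auto
    define S0 where "S0 = (\<Sum>es\<in>E0. op_monomial gs es (F (0 # es)))"
    define S1 where "S1 = (\<Sum>es\<in>E1. op_monomial (g # gs) es (F (shift es)))"
    have shift: "op_monomial (g # gs) (shift es) f = g (op_monomial (g # gs) es f)"
      if "es \<in> E1" for es f
      using that by (cases es) (auto simp: shift_def E1_def)
    have "(\<Sum>es\<in>E. op_monomial (g # gs) es (F es))
        = S0 + (\<Sum>es\<in>E1. op_monomial (g # gs) (shift es) (F (shift es)))"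
      unfolding E S0_def using fin disj
      by (subst sum.union_disjoint)
         (simp_all add: sum.reindex[OF inj0] sum.reindex[OF inj1] del: op_monomial.simps, simp)
    also have "\<dots> = S0 + g S1"
      unfolding S1_def g.sum by (simp only: shift cong: sum.cong)
    finally have eq: "S0 + g S1 \<in> W" using Suc.prems(4) by simp
    have "(S0 + g S1) + g (- S1) \<in> adjoin_image g W" by (rule adjoin_imageI[OF eq])
    then have "S0 \<in> adjoin_image g W" by (simp add: g.minus)
    have F0: "F (0 # es) = 0" if "es \<in> E0" for es
    proof (rule Cons.IH[of "adjoin_image g W" E0 "\<lambda>es. F (0 # es)"])
      show "(\<Sum>es\<in>E0. op_monomial gs es (F (0 # es))) \<in> adjoin_image g W"
        using \<open>S0 \<in> adjoin_image g W\<close> by (simp add: S0_def)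
      show "length es = length gs" if "es \<in> E0" for es
        using Suc.prems(2)[of "0 # es"] that by (simp add: E0_def)
    qed (use that Cons.prems(2-4) Suc.prems fin W g in \<open>auto simp: E0_def intro: add_subgroup_adjoin_image\<close>)
    then have "S0 = 0"
      unfolding S0_def using additive.zero[OF additive_op_monomial[of gs]] Cons.prems(2) by simp
    then have "S1 \<in> W" using eq reg by simp
    have "\<forall>es\<in>E1. F (shift es) = 0"
    proof (rule Suc.IH[OF fin(2)])
      show "(\<Sum>es\<in>E1. op_monomial (g # gs) es (F (shift es))) \<in> W"
        using \<open>S1 \<in> W\<close> by (simp only: S1_def)
      fix es assume "es \<in> E1"
      then have es: "es \<noteq> []" "shift es \<in> E" by (auto simp: E1_def)
      then show "length es = length (g # gs)" "F (shift es) \<in> M" "hd es < n"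
        using Suc.prems(2)[OF es(2)] Suc.prems(3)[OF es(2)] Suc.prems(5)[OF es(2)]
        by (auto simp: shift_def)
    qed
    with F0 show ?case unfolding E by auto
  qed
  obtain n where n: "\<And>es. es \<in> E \<Longrightarrow> hd es < n"
    using finite_nat_set_iff_bounded[of "hd ` E"] Cons.prems(5) by auto
  show ?case using *[OF Cons.prems(5-8) n] Cons.prems(9) by blast
qed


section \<open>The regular sequence of the vector variables\<close>

lemma r_sq_commute: "r_sq m i j = r_sq m j i"
  by (simp add: r_sq_def mult.commute)

lemma finite_index_pairs: "finite (index_pairs k)"
  by (rule finite_subset[of _ "{1..k} \<times> {1..k}"]) (auto simp: index_pairs_def)

lemma lookup_single_pair:
  "Poly_Mapping.lookup (Poly_Mapping.single v (1::nat)) w = (if v = w then 1 else 0)"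
  by (simp add: lookup_single when_def)

lemma coord_mult_coord:
  "coord a i * coord b j = Poly_Mapping.single (Poly_Mapping.single (a, i) 1 + Poly_Mapping.single (b, j) 1) 1"
  by (simp add: coord_def mult_single)

text \<open>For the weight below, the leading monomial of \<open>r\<^sub>i\<^sub>j\<^sup>2\<close> is \<open>x\<^sub>l\<^sub>i x\<^sub>l\<^sub>j\<close> with \<open>l = i + j - 1\<close>,
  since \<open>(s - 2i)\<^sup>2 + (s - 2j)\<^sup>2\<close> is minimal at \<open>s = i + j\<close>.  In each row \<open>l\<close>, every variable
  occurs in at most one of these monomials; all rows exist because \<open>2k - 1 \<le> m\<close>.\<close>

lemma (in spinor_module) coprime_leading_monomials_r_sq:
  assumes "2 * k \<le> m"
  shows "\<exists>\<mu> wt mult_of. coprime_leading_monomials m scale act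
    (index_pairs k) (\<lambda>(i, j). r_sq m i j) \<mu> wt mult_of"
proof -
  define \<mu> :: "nat \<times> nat \<Rightarrow> (nat \<times> nat) \<Rightarrow>\<^sub>0 nat" where
    "\<mu> = (\<lambda>(i, j). Poly_Mapping.single (i + j - 1, i) 1 + Poly_Mapping.single (i + j - 1, j) 1)"
  \<comment> \<open>The first square dominates the second for rows l \<le> m and columns i \<le> k,
    so \<open>nat\<close> truncates nothing there.\<close>
  define \<kappa> :: "nat \<times> nat \<Rightarrow> nat" where
    "\<kappa> = (\<lambda>(l, i). nat ((int m + 1 + 2 * int k)\<^sup>2 - (int l + 1 - 2 * int i)\<^sup>2))"
  define wt :: "((nat \<times> nat) \<Rightarrow>\<^sub>0 nat) \<Rightarrow> nat" where
    "wt = (\<lambda>\<gamma>. \<Sum>v\<in>Poly_Mapping.keys \<gamma>. \<kappa> v * Poly_Mapping.lookup \<gamma> v)"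
  \<comment> \<open>On the diagonal the leading monomial is the square of a single variable, hence
    the halving.\<close>
  define mult_of :: "nat \<times> nat \<Rightarrow> ((nat \<times> nat) \<Rightarrow>\<^sub>0 nat) \<Rightarrow> nat" where
    "mult_of = (\<lambda>(i, j) \<gamma>. if i = j then Poly_Mapping.lookup \<gamma> (i + j - 1, i) div 2
       else min (Poly_Mapping.lookup \<gamma> (i + j - 1, i)) (Poly_Mapping.lookup \<gamma> (i + j - 1, j)))"
  have wt_add: "wt (\<alpha> + \<beta>) = wt \<alpha> + wt \<beta>" for \<alpha> \<beta>
    unfolding wt_def by (rule setsum_keys_plus_distrib) (auto simp: algebra_simps)
  have wt_single: "wt (Poly_Mapping.single v 1) = \<kappa> v" for v by (simp add: wt_def)
  have \<kappa>: "int (\<kappa> (l, i)) = (int m + 1 + 2 * int k)\<^sup>2 - (int l + 1 - 2 * int i)\<^sup>2"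
    if "l \<le> m" "i \<le> k" for l i
  proof -
    have "\<bar>int l + 1 - 2 * int i\<bar> \<le> \<bar>int m + 1 + 2 * int k\<bar>" using that by auto
    then have "(int l + 1 - 2 * int i)\<^sup>2 \<le> (int m + 1 + 2 * int k)\<^sup>2" by (simp only: abs_le_square_iff)
    then show ?thesis by (simp add: \<kappa>_def)
  qed
  have less: "\<kappa> (l, i) + \<kappa> (l, j) < \<kappa> (i + j - 1, i) + \<kappa> (i + j - 1, j)"
    if "(i, j) \<in> index_pairs k" "l \<in> {1..m}" "l \<noteq> i + j - 1" for i j l
  proof -
    have ij: "1 \<le> i" "i \<le> k" "j \<le> k" "1 \<le> j" using that by (auto simp: index_pairs_def)
    \<comment> \<open>With d the signed distance from the optimal row, the two squares add up to 2
      d^2 + 2 (i - j)^2.\<close>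
    define d where "d = int l + 1 - int i - int j"
    have "d \<noteq> 0" using that ij by (auto simp: d_def)
    then have "d\<^sup>2 > 0" by simp
    moreover have "int l + 1 = d + int i + int j" by (simp add: d_def)
    ultimately have "(int i - int j)\<^sup>2 + (int j - int i)\<^sup>2
        < (int l + 1 - 2 * int i)\<^sup>2 + (int l + 1 - 2 * int j)\<^sup>2"
      by (simp add: power2_eq_square algebra_simps)
    moreover have "int (i + j - 1) + 1 = int i + int j" using ij by auto
    moreover have "l \<le> m" "i + j - 1 \<le> m" using that ij assms by auto
    ultimately have "int (\<kappa> (l, i) + \<kappa> (l, j)) < int (\<kappa> (i + j - 1, i) + \<kappa> (i + j - 1, j))"
      using ij by (simp add: \<kappa>)
    then show ?thesis by simp
  qed
  have "coprime_leading_monomials m scale act (index_pairs k) (\<lambda>(i, j). r_sq m i j) \<mu> wt mult_of"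
  proof (unfold_locales)
    show "finite (index_pairs k)" by (rule finite_index_pairs)
    show "wt (\<alpha> + \<beta>) = wt \<alpha> + wt \<beta>" for \<alpha> \<beta> by (rule wt_add)
    fix q assume q: "q \<in> index_pairs k"
    obtain i j where ij: "q = (i, j)" by (cases q)
    have bounds: "1 \<le> i" "i \<le> j" "j \<le> k" using q ij by (auto simp: index_pairs_def)
    have "i + j - 1 \<in> {1..m}" using bounds assms by auto
    then have "r_sq m i j = Poly_Mapping.single (\<mu> q) 1
        + (\<Sum>l\<in>{1..m} - {i + j - 1}. coord l i * coord l j)"
      unfolding r_sq_def by (subst sum.remove) (auto simp: ij \<mu>_def coord_mult_coord)
    moreover have "wt \<beta> < wt (\<mu> q)"
      if "\<beta> \<in> Poly_Mapping.keys (\<Sum>l\<in>{1..m} - {i + j - 1}. coord l i * coord l j)" for \<beta>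
    proof -
      have "\<beta> \<in> (\<Union>l\<in>{1..m} - {i + j - 1}. Poly_Mapping.keys (coord l i * coord l j))"
        by (rule subsetD[OF keys_sum that])
      then obtain l where "l \<in> {1..m} - {i + j - 1}" "\<beta> \<in> Poly_Mapping.keys (coord l i * coord l j)" ..
      then have "l \<in> {1..m}" "l \<noteq> i + j - 1"
        "\<beta> = Poly_Mapping.single (l, i) 1 + Poly_Mapping.single (l, j) 1"
        by (auto simp: coord_mult_coord simp del: One_nat_def)
      then show ?thesis using less[of i j l] q by (simp add: ij \<mu>_def wt_add wt_single del: One_nat_def)
    qed
    ultimately show "has_leading_monomial wt (case q of (i, j) \<Rightarrow> r_sq m i j) (\<mu> q)"
      unfolding has_leading_monomial_def ij by auto
    fix \<alpha>
    show "mult_of q (\<mu> q' + \<alpha>) = mult_of q \<alpha> + (if q = q' then 1 else 0)"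
      if q': "q' \<in> index_pairs k" for q'
    proof (cases "q = q'")
      case True
      then have "q' = (i, j)" by (simp add: ij)
      then show ?thesis
        by (simp add: ij mult_of_def \<mu>_def lookup_add lookup_single_pair min_def del: One_nat_def)
    next
      case False
      obtain a b where ab: "q' = (a, b)" by (cases q')
      have "1 \<le> a" "a \<le> b" using q' ab by (auto simp: index_pairs_def)
      \<comment> \<open>In a common row a + b = i + j, so by a \<le> b and i \<le> j one shared
        column would make the two pairs equal.\<close>
      then have "a + b - 1 = i + j - 1 \<Longrightarrow> a \<noteq> i \<and> a \<noteq> j \<and> b \<noteq> i \<and> b \<noteq> j"
        using False bounds unfolding ij ab prod.inject by arith
      then have "Poly_Mapping.lookup (\<mu> q') (i + j - 1, i) = 0"
        "Poly_Mapping.lookup (\<mu> q') (i + j - 1, j) = 0"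
        unfolding ab \<mu>_def prod.case lookup_add lookup_single_pair by auto
      then show ?thesis using False
        by (auto simp: ij mult_of_def lookup_add simp del: One_nat_def)
    qed
    show "\<exists>\<beta>. \<alpha> = \<mu> q + \<beta>" if "mult_of q \<alpha> > 0"
    proof -
      have "\<alpha> = \<mu> q + (\<alpha> - \<mu> q)"
        using that
        by (intro poly_mapping_eqI)
           (auto simp: ij mult_of_def \<mu>_def lookup_add lookup_minus lookup_single_pair
             simp del: One_nat_def split: if_splits)
      then show ?thesis ..
    qed
  qed
  then show ?thesis by blast
qed

context spinor_module
begin

abbreviation "rr i j \<equiv> poly_act scale (r_sq m i j)"

lemma regular_seq_r_sq:
  assumes "2 * k \<le> m" "distinct ps" "set ps \<subseteq> index_pairs k"
  shows "regular_seq {0} (map (\<lambda>(i, j). rr i j) ps)"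
proof -
  obtain \<mu> wt mult_of where "coprime_leading_monomials m scale act
      (index_pairs k) (\<lambda>(i, j). r_sq m i j) \<mu> wt mult_of"
    using coprime_leading_monomials_r_sq[OF assms(1)] by blast
  then interpret coprime_leading_monomials m scale act
    "index_pairs k" "\<lambda>(i, j). r_sq m i j" \<mu> wt mult_of .
  have "ideal_of {} = {0}" by (simp add: ideal_of_def)
  then show ?thesis
    using regular_seq_ideal_of[of "{}" ps] assms by (simp add: case_prod_unfold)
qed

text \<open>The spinor type is just an abelian group; it is the complex scalars that exclude
  2-torsion.\<close>

lemma double_cancel:
  fixes f g :: "'s spoly"
  assumes "f + f = g + g"
  shows "f = g"
proof (rule poly_mapping_eqI)
  fix \<beta>
  have double: "scale 2 s = s + s" for s using scale_left_distrib[of 1 1 s] by simp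
  have "scale 2 (Poly_Mapping.lookup f \<beta>) = scale 2 (Poly_Mapping.lookup g \<beta>)"
    unfolding double lookup_add[symmetric] assms ..
  then show "Poly_Mapping.lookup f \<beta> = Poly_Mapping.lookup g \<beta>"
    by (subst (asm) scale_cancel_left) simp
qed

lemma vector_var_swap: "vv i (vv j f) = - vv j (vv i f) - (rr i j f + rr i j f)"
proof -
  have "- 2 * r_sq m i j = - (r_sq m i j + r_sq m i j)" by simp
  then have *: "vv i (vv j f) + vv j (vv i f) = - (rr i j f + rr i j f)"
    unfolding vector_var_anticommute
    by (simp only: additive.minus[OF additive_poly_act_left] poly_act_add_left)
  have "vv i (vv j f) = (vv i (vv j f) + vv j (vv i f)) - vv j (vv i f)" by simp
  then show ?thesis unfolding * by simp
qed

lemma vector_var_square: "vv i (vv i f) = - rr i i f"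
proof (rule double_cancel)
  have "vv i (vv i f) + vv i (vv i f) = - (rr i i f + rr i i f)"
    by (subst vector_var_swap) simp
  then show "vv i (vv i f) + vv i (vv i f) = - rr i i f + - rr i i f" by simp
qed

text \<open>Row i holds all pairs whose smaller index is i. It is complete before any x_j with j > i
  occurs, so r_ij^2 is available when x_j has to move past x_i.\<close>

definition vv_row :: "nat \<Rightarrow> nat \<Rightarrow> ('s spoly \<Rightarrow> 's spoly) list" where
  "vv_row k i = vv i # map (rr i) [Suc i..<Suc k]"

definition rr_row :: "nat \<Rightarrow> nat \<Rightarrow> ('s spoly \<Rightarrow> 's spoly) list" where
  "rr_row k i = rr i i # map (rr i) [Suc i..<Suc k]"

text \<open>The rows are converted one after the other, \<open>W\<close> being the sum of the images
  of those already done. Invariance under the remaining x_j is what \<open>regular_seq_root\<close>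
  requires, and the anticommutation relation hands it on to the next row.\<close>

lemma regular_seq_vv_rows:
  assumes "add_subgroup W" "\<And>i j w. w \<in> W \<Longrightarrow> rr i j w \<in> W"
    and "\<And>j w. j \<ge> a \<Longrightarrow> j \<le> k \<Longrightarrow> w \<in> W \<Longrightarrow> vv j w \<in> W"
    and "regular_seq W (concat (map (rr_row k) [a..<Suc k]))"
  shows "regular_seq W (concat (map (vv_row k) [a..<Suc k]))"
  using assms
proof (induction "Suc k - a" arbitrary: a W)
  case (Suc n)
  then have a: "a \<le> k" by simp
  then have split: "[a..<Suc k] = a # [Suc a..<Suc k]" by (simp add: upt_conv_Cons del: upt_Suc)
  define rest where "rest = map (rr a) [Suc a..<Suc k]"
  define R where "R = concat (map (rr_row k) [Suc a..<Suc k])"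
  have add: "additive b" if "b \<in> set (vv_row k a)" for b
    using that by (auto simp: vv_row_def additive_vector_var additive_poly_act)
  have set_R: "\<exists>i j. b = rr i j" if "b \<in> set (rest @ R)" for b
    using that by (auto simp: rest_def R_def rr_row_def)
  have "regular_seq W (rr a a # (rest @ R))"
    using Suc.prems(4) by (simp add: split rr_row_def rest_def R_def del: upt_Suc)
  \<comment> \<open>The sign in x_a^2 = - r_aa^2 changes neither images nor injectivity.\<close>
  then have "regular_seq W ((\<lambda>f. vv a (vv a f)) # (rest @ R))"
  proof -
    have "adjoin_image (rr a a) W = adjoin_image (\<lambda>f. - rr a a f) W"
      unfolding adjoin_image_def
      by (auto simp flip: additive.minus[OF additive_poly_act])
        (metis minus_minus)
    moreover have "- x \<in> W \<longleftrightarrow> x \<in> W" for x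
      using add_subgroupD(3)[OF Suc.prems(1), of x] add_subgroupD(3)[OF Suc.prems(1), of "- x"] by auto
    ultimately show ?thesis
      using \<open>regular_seq W (rr a a # (rest @ R))\<close> by (simp add: vector_var_square)
  qed
  then have "regular_seq W (vv a # (rest @ R))"
  proof (rule regular_seq_root[OF Suc.prems(1) additive_vector_var, rotated -1])
    show "vv a w \<in> W" if "w \<in> W" for w using Suc.prems(3) a that by simp
    fix b assume "b \<in> set (rest @ R)"
    then obtain i j where b: "b = rr i j" using set_R by blast
    show "additive b" by (simp add: b additive_poly_act)
    show "vv a (b f) = b (vv a f)" for f by (simp add: b vector_var_poly_act)
    show "b w \<in> W" if "w \<in> W" for w using Suc.prems(2) that by (simp add: b)
    fix c f assume "c \<in> set (rest @ R)"
    then obtain i' j' where c: "c = rr i' j'" using set_R by blast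
    show "b (c f) = c (b f)" unfolding b c by (rule poly_act_commute)
  qed
  then have seq: "regular_seq W (vv_row k a @ R)" by (simp add: vv_row_def rest_def)
  define V where "V = fold adjoin_image (vv_row k a) W"
  have V: "add_subgroup V"
    unfolding V_def by (rule add_subgroup_fold_adjoin_image[OF Suc.prems(1) add])
  have WV: "w \<in> V" if "w \<in> W" for w
    unfolding V_def by (rule fold_adjoin_image_base[OF that add])
  have vvV: "vv a f \<in> V" for f
    unfolding V_def by (rule fold_adjoin_image_image[OF Suc.prems(1) add, where a = "vv a"]) (simp_all add: vv_row_def)
  have rrV: "rr a j f \<in> V" if "a < j" "j \<le> k" for j f
    unfolding V_def
    by (rule fold_adjoin_image_image[OF Suc.prems(1) add, where a = "rr a j"])
      (use that in \<open>simp_all add: vv_row_def del: upt_Suc\<close>)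
  have "regular_seq V (concat (map (vv_row k) [Suc a..<Suc k]))"
  proof (rule Suc.hyps(1)[OF _ V])
    show "n = Suc k - Suc a" using Suc.hyps(2) by simp
    show "rr i j v \<in> V" if "v \<in> V" for i j v
    proof (rule fold_adjoin_image_closed[OF V additive_poly_act _ _ that[unfolded V_def]])
      show "rr i j w \<in> V" if "w \<in> W" for w using WV Suc.prems(2) that by simp
      fix b f assume "b \<in> set (vv_row k a)"
      then consider "b = vv a" | l where "b = rr a l" "a < l" "l \<le> k"
        by (auto simp: vv_row_def simp del: upt_Suc)
      then show "rr i j (b f) \<in> V"
        using vvV[of "rr i j f"] rrV[of _ "rr i j f"]
        by cases (simp_all add: vector_var_poly_act poly_act_commute[of "r_sq m i j"])
    qed
    show "vv j v \<in> V" if j: "j \<ge> Suc a" "j \<le> k" and "v \<in> V" for j v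
    proof (rule fold_adjoin_image_closed[OF V additive_vector_var _ _ that(3)[unfolded V_def]])
      show "vv j w \<in> V" if "w \<in> W" for w using WV Suc.prems(3)[of j w] that j by simp
      fix b f assume "b \<in> set (vv_row k a)"
      then consider "b = vv a" | l where "b = rr a l" "a < l" "l \<le> k"
        by (auto simp: vv_row_def simp del: upt_Suc)
      then show "vv j (b f) \<in> V"
      proof cases
        \<comment> \<open>Moving x_j past x_a costs a multiple of r_aj^2, which belongs to row a
          since a < j.\<close>
        case 1
        then show ?thesis
          unfolding 1 vector_var_swap[of j a] r_sq_commute[of m j a]
          using vvV rrV[of j] j by (intro add_subgroupD[OF V]) auto
      next
        case 2
        then show ?thesis using rrV[of l "vv j f"] by (simp add: vector_var_poly_act)
      qed
    qed
    show "regular_seq V (concat (map (rr_row k) [Suc a..<Suc k]))"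
      using seq by (simp add: regular_seq_append V_def R_def del: upt_Suc)
  qed
  then show ?case
    using seq by (simp add: split regular_seq_append V_def del: upt_Suc)
qed simp

end

section \<open>Positive definite forms\<close>

text \<open>Scalars are restricted to the reals, so that symmetric bilinear forms suffice and no
  conjugation enters.\<close>

locale pos_def_form = vector_space sc
  for sc :: "real \<Rightarrow> 'v::ab_group_add \<Rightarrow> 'v" +
  fixes Q :: "'v \<Rightarrow> 'v \<Rightarrow> real"
  assumes form_sym: "Q x y = Q y x"
    and form_add: "Q (x + y) z = Q x z + Q y z"
    and form_scale: "Q (sc c x) y = c * Q x y"
    and form_pos: "x \<noteq> 0 \<Longrightarrow> Q x x > 0"
begin

lemma form_add_right: "Q x (y + z) = Q x y + Q x z"
  by (metis form_add form_sym)

lemma form_scale_right: "Q x (sc c y) = c * Q x y"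
  by (metis form_scale form_sym)

lemma form_zero [simp]: "Q 0 y = 0" "Q y 0 = 0"
  using form_add[of 0 0 y] form_sym[of y 0] by auto

lemma form_minus: "Q (- x) y = - Q x y"
  using form_add[of x "- x" y] by simp

lemma form_minus_right: "Q x (- y) = - Q x y"
  by (metis form_minus form_sym)

lemma form_diff: "Q (x - y) z = Q x z - Q y z"
  using form_add[of x "- y" z] by (simp add: form_minus)

lemma form_nonneg: "Q x x \<ge> 0"
  using form_pos[of x] by (cases "x = 0") auto

lemma form_orthogonal_span:
  assumes "\<And>b. b \<in> B \<Longrightarrow> Q x b = 0" "y \<in> span B"
  shows "Q x y = 0"
  using assms(2) by (induction rule: span_induct_alt) (simp_all add: form_add_right form_scale_right assms(1))

text \<open>Gram-Schmidt: the new vector \<open>b\<close> is replaced by its component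
  \<open>c\<close> orthogonal to \<open>B\<close>; if that component vanishes, the old projection
  still works.\<close>

lemma orthogonal_projection:
  assumes "finite B"
  shows "\<exists>w\<in>span B. \<forall>b\<in>B. Q (f - w) b = 0"
  using assms
proof (induction B arbitrary: f rule: finite_induct)
  case (insert b B)
  have sub: "w \<in> span (insert b B)" if "w \<in> span B" for w
    using span_mono[of B "insert b B"] that by blast
  obtain v where v: "v \<in> span B" "\<And>c. c \<in> B \<Longrightarrow> Q (b - v) c = 0" using insert.IH by blast
  obtain w where w: "w \<in> span B" "\<And>c. c \<in> B \<Longrightarrow> Q (f - w) c = 0" using insert.IH by blast
  define c where "c = b - v"
  have Q_b: "Q g b = Q g c" if "\<And>a. a \<in> B \<Longrightarrow> Q g a = 0" for g
    using form_orthogonal_span[OF that v(1)] form_add_right[of g c v] by (simp add: c_def)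
  show ?case
  proof (cases "c = 0")
    case True
    then have "Q (f - w) b = 0" using Q_b[OF w(2)] by simp
    then show ?thesis using w sub by blast
  next
    case False
    define w' where "w' = w + sc (Q (f - w) c / Q c c) c"
    have c: "c \<in> span (insert b B)"
      unfolding c_def by (intro span_diff span_base sub v) simp
    have "w' \<in> span (insert b B)"
      unfolding w'_def by (rule span_add[OF sub[OF w(1)] span_scale[OF c]])
    moreover have Q_w': "Q (f - w') a = Q (f - w) a - Q (f - w) c / Q c c * Q c a" for a
      by (simp add: w'_def form_diff form_add form_scale)
    moreover have orth: "Q (f - w') a = 0" if "a \<in> B" for a
      using w(2) v(2) that by (simp add: Q_w' c_def)
    moreover have "Q (f - w') b = 0"
    proof -
      have "Q (f - w') b = Q (f - w') c" using orth by (rule Q_b)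
      also have "\<dots> = 0" using form_pos[OF False] by (simp add: Q_w')
      finally show ?thesis .
    qed
    ultimately show ?thesis by blast
  qed
qed simp

end

text \<open>A Hamel basis is declared orthonormal; vectors have finitely many nonzero coordinates,
  so the form is a finite sum.\<close>

lemma pos_def_form_exists:
  fixes sc :: "real \<Rightarrow> 'v::ab_group_add \<Rightarrow> 'v"
  assumes "vector_space sc"
  shows "\<exists>Q. pos_def_form sc Q"
proof -
  interpret vector_space sc by fact
  define E where "E = extend_basis {}"
  have E: "independent E" "span E = UNIV"
    by (simp_all add: E_def independent_extend_basis independent_empty)
  define R where "R = representation E"
  have fin: "finite {b. R x b \<noteq> 0}" for x by (simp add: R_def finite_representation)
  have R: "R (x + y) = (\<lambda>b. R x b + R y b)" "R (sc c x) = (\<lambda>b. c * R x b)" for x y c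
    using E by (simp_all add: R_def representation_add representation_scale)
  define Q where "Q x y = (\<Sum>b | R x b \<noteq> 0. R x b * R y b)" for x y
  have Q: "Q x y = (\<Sum>b\<in>A. R x b * R y b)" if "finite A" "{b. R x b \<noteq> 0} \<subseteq> A" for x y A
    unfolding Q_def using that by (intro sum.mono_neutral_left) auto
  have "pos_def_form sc Q"
  proof (unfold_locales)
    fix x y z c
    let ?A = "{b. R x b \<noteq> 0} \<union> {b. R y b \<noteq> 0}"
    have A: "finite ?A" using fin by simp
    show "Q x y = Q y x" by (subst (1 2) Q[OF A]) (auto simp: mult.commute)
    show "Q (x + y) z = Q x z + Q y z"
      by (subst (1 2 3) Q[OF A]) (auto simp: R algebra_simps sum.distrib)
    show "Q (sc c x) y = c * Q x y"
      by (subst (1 2) Q[OF A]) (auto simp: R algebra_simps sum_distrib_left)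
    show "Q x x > 0" if "x \<noteq> 0"
    proof -
      have "{b. R x b \<noteq> 0} \<noteq> {}"
      proof
        assume "{b. R x b \<noteq> 0} = {}"
        moreover have "(\<Sum>b | R x b \<noteq> 0. sc (R x b) b) = x"
          unfolding R_def using E by (intro sum_nonzero_representation_eq) auto
        ultimately show False using that by simp
      qed
      then show ?thesis
        unfolding Q_def by (intro sum_pos fin) (auto simp: zero_less_mult_iff linorder_neq_iff)
    qed
  qed
  then show ?thesis by blast
qed

lemma vector_space_of_real:
  assumes "vector_space (scale :: complex \<Rightarrow> 'v::ab_group_add \<Rightarrow> 'v)"
  shows "vector_space (\<lambda>r. scale (complex_of_real r))"
proof -
  interpret vector_space scale by fact
  show ?thesis
    by unfold_locales (simp_all add: scale_right_distrib scale_left_distrib)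
qed


section \<open>The Fischer decomposition\<close>

text \<open>The weights of the Fischer form. Raising the exponent of x_v by one multiplies the
  weight by the factor that differentiation produces, which makes x_v adjoint to its
  derivative.\<close>

definition multi_fact :: "('a \<Rightarrow>\<^sub>0 nat) \<Rightarrow> real" where
  "multi_fact \<beta> = (\<Prod>v\<in>Poly_Mapping.keys \<beta>. fact (Poly_Mapping.lookup \<beta> v))"

lemma single_add_minus_single:
  "Poly_Mapping.lookup \<beta> v > 0 \<Longrightarrow>
    Poly_Mapping.single v (1::nat) + (\<beta> - Poly_Mapping.single v 1) = \<beta>"
  by (intro poly_mapping_eqI) (auto simp: lookup_add lookup_minus lookup_single when_def)

lemma multi_fact_pos: "multi_fact \<beta> > 0"
  by (simp add: multi_fact_def prod_pos)

lemma multi_fact_single_add: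
  "multi_fact (Poly_Mapping.single v 1 + \<beta>) = real (Poly_Mapping.lookup \<beta> v + 1) * multi_fact \<beta>"
proof -
  define K where "K = insert v (Poly_Mapping.keys \<beta>)"
  have ext: "multi_fact \<gamma> = (\<Prod>w\<in>K. fact (Poly_Mapping.lookup \<gamma> w))"
    if "Poly_Mapping.keys \<gamma> \<subseteq> K" for \<gamma>
    unfolding multi_fact_def using that by (intro prod.mono_neutral_left) (auto simp: K_def in_keys_iff)
  have "Poly_Mapping.keys (Poly_Mapping.single v 1 + \<beta>) \<subseteq> K"
    using keys_add[of "Poly_Mapping.single v 1" \<beta>] by (auto simp: K_def split: if_splits)
  then have "multi_fact (Poly_Mapping.single v 1 + \<beta>)
      = (\<Prod>w\<in>K. fact (Poly_Mapping.lookup (Poly_Mapping.single v 1 + \<beta>) w))" by (rule ext)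
  also have "\<dots> = (\<Prod>w\<in>K. (if w = v then real (Poly_Mapping.lookup \<beta> v + 1) else 1) * fact (Poly_Mapping.lookup \<beta> w))"
    by (intro prod.cong) (auto simp: lookup_add lookup_single)
  also have "\<dots> = real (Poly_Mapping.lookup \<beta> v + 1) * (\<Prod>w\<in>K. fact (Poly_Mapping.lookup \<beta> w))"
    by (simp add: prod.distrib K_def)
  also have "(\<Prod>w\<in>K. fact (Poly_Mapping.lookup \<beta> w)) = multi_fact \<beta>"
    by (rule ext[symmetric]) (auto simp: K_def)
  finally show ?thesis .
qed

context spinor_module
begin

abbreviation rscale :: "real \<Rightarrow> 's \<Rightarrow> 's" where
  "rscale r \<equiv> scale (complex_of_real r)"

abbreviation act_basis :: "nat set \<Rightarrow> 's \<Rightarrow> 's" where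
  "act_basis A \<equiv> act (Poly_Mapping.single A 1)"

lemma cl_sign_cases: "cl_sign A B \<in> {1, -1}"
  by (simp add: cl_sign_def minus_one_power_iff)

lemma basis_in_clifford: "A \<subseteq> {1..m} \<Longrightarrow> Poly_Mapping.single A c \<in> clifford m"
  by (auto simp: clifford_def)

lemma act_single:
  assumes "A \<subseteq> {1..m}"
  shows "act (Poly_Mapping.single A c) s = scale c (act_basis A s)"
proof -
  have "Poly_Mapping.single A c = cl_scale c (Poly_Mapping.single A 1)"
    by (simp add: cl_scale_def)
  then show ?thesis by (simp only: act_scale[OF basis_in_clifford[OF assms]])
qed

lemma act_basis_gen:
  assumes "A \<subseteq> {1..m}" "i \<in> {1..m}"
  shows "act_basis A (act (cl_gen i) s) = scale (cl_sign A {i}) (act_basis (sym_diff A {i}) s)"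
    and "act (cl_gen i) (act_basis A s) = scale (cl_sign {i} A) (act_basis (sym_diff {i} A) s)"
proof -
  have sd: "sym_diff A {i} \<subseteq> {1..m}" "sym_diff {i} A \<subseteq> {1..m}" using assms by auto
  note A = basis_in_clifford[OF assms(1), of 1]
  have "act_basis A (act (cl_gen i) s) = act (Poly_Mapping.single (sym_diff A {i}) (cl_sign A {i})) s"
    unfolding act_mult[OF A cl_gen_in_clifford[OF assms(2)], symmetric]
    by (simp add: cl_gen_def cl_mult_single)
  then show "act_basis A (act (cl_gen i) s) = scale (cl_sign A {i}) (act_basis (sym_diff A {i}) s)"
    by (simp only: act_single[OF sd(1), of "cl_sign A {i}"])
  have "act (cl_gen i) (act_basis A s) = act (Poly_Mapping.single (sym_diff {i} A) (cl_sign {i} A)) s"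
    unfolding act_mult[OF cl_gen_in_clifford[OF assms(2)] A, symmetric]
    by (simp add: cl_gen_def cl_mult_single)
  then show "act (cl_gen i) (act_basis A s) = scale (cl_sign {i} A) (act_basis (sym_diff {i} A) s)"
    by (simp only: act_single[OF sd(2), of "cl_sign {i} A"])
qed

text \<open>Averaging an arbitrary form over the basis \<open>e\<^sub>A\<close> makes the generators orthogonal, hence skew.\<close>

lemma invariant_form_exists:
  "\<exists>F. pos_def_form rscale F
    \<and> (\<forall>i\<in>{1..m}. \<forall>s t. F (act (cl_gen i) s) t = - F s (act (cl_gen i) t))"
proof -
  obtain Q where "pos_def_form rscale Q"
    using pos_def_form_exists[OF vector_space_of_real[OF vector_space_axioms]] by blast
  then interpret Q: pos_def_form rscale Q .
  define F where "F s t = (\<Sum>A\<in>Pow {1..m}. Q (act_basis A s) (act_basis A t))" for s t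
  have cl: "Poly_Mapping.single A 1 \<in> clifford m" if "A \<in> Pow {1..m}" for A
    using that by (auto simp: clifford_def)
  have F: "pos_def_form rscale F"
  proof
    fix x y z c
    show "F x y = F y x" unfolding F_def by (subst Q.form_sym) simp
    show "F (x + y) z = F x z + F y z"
      unfolding F_def sum.distrib[symmetric] by (intro sum.cong) (simp_all add: act_hom cl Q.form_add)
    show "F (rscale c x) y = c * F x y"
      unfolding F_def sum_distrib_left by (intro sum.cong) (simp_all add: act_hom cl Q.form_scale)
    show "F x x > 0" if "x \<noteq> 0"
    proof -
      have "Q x x > 0" using that by (rule Q.form_pos)
      \<comment> \<open>The summand for the empty set is the original form; the others are
        nonnegative.\<close>
      then have "Q (act_basis {} x) (act_basis {} x) > 0" using act_one[of x] by (simp add: cl_one_def)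
      then show ?thesis unfolding F_def by (intro sum_pos2[of _ "{}"]) (auto intro: Q.form_nonneg)
    qed
  qed
  interpret F: pos_def_form rscale F by (rule F)
  have orth: "F (act (cl_gen i) s) (act (cl_gen i) t) = F s t" if i: "i \<in> {1..m}" for i s t
  proof -
    have "F (act (cl_gen i) s) (act (cl_gen i) t)
        = (\<Sum>A\<in>Pow {1..m}. Q (act_basis (sym_diff A {i}) s) (act_basis (sym_diff A {i}) t))"
      unfolding F_def
    proof (intro sum.cong refl)
      fix A assume "A \<in> Pow {1..m}"
      then have A: "A \<subseteq> {1..m}" by simp
      \<comment> \<open>The same sign appears in both arguments and cancels.\<close>
      show "Q (act_basis A (act (cl_gen i) s)) (act_basis A (act (cl_gen i) t))
          = Q (act_basis (sym_diff A {i}) s) (act_basis (sym_diff A {i}) t)"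
        using cl_sign_cases[of A "{i}"] unfolding act_basis_gen[OF A i]
        by (auto simp: Q.form_minus Q.form_minus_right)
    qed
    also have "\<dots> = F s t"
      unfolding F_def
      by (rule sum.reindex_bij_witness[where i = "\<lambda>A. sym_diff A {i}" and j = "\<lambda>A. sym_diff A {i}"])
         (use i in auto)
    finally show ?thesis .
  qed
  \<comment> \<open>An orthogonal map with square -1 is skew.\<close>
  have "F (act (cl_gen i) s) t = - F s (act (cl_gen i) t)" if i: "i \<in> {1..m}" for i s t
    using orth[OF i, of "act (cl_gen i) s" t] i by (simp add: act_gen_square F.form_minus)
  with F show ?thesis by blast
qed

lemma lookup_partial_deriv:
  "Poly_Mapping.lookup (partial_deriv scale v f) \<beta>
     = scale (of_nat (Poly_Mapping.lookup \<beta> v + 1)) (Poly_Mapping.lookup f (Poly_Mapping.single v 1 + \<beta>))"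
proof -
  have *: "Poly_Mapping.lookup (Poly_Mapping.single (\<gamma> - Poly_Mapping.single v 1)
        (scale (of_nat (Poly_Mapping.lookup \<gamma> v)) s)) \<beta>
      = (if \<gamma> = Poly_Mapping.single v 1 + \<beta> then scale (of_nat (Poly_Mapping.lookup \<beta> v + 1)) s else 0)"
    for \<gamma> s
  proof (cases "Poly_Mapping.lookup \<gamma> v = 0")
    case True
    then have "\<gamma> \<noteq> Poly_Mapping.single v 1 + \<beta>" by (auto simp: lookup_add)
    then show ?thesis using True by simp
  next
    case False
    then have "\<gamma> = Poly_Mapping.single v 1 + (\<gamma> - Poly_Mapping.single v 1)"
      using single_add_minus_single[of \<gamma> v] by simp
    then have "\<gamma> - Poly_Mapping.single v 1 = \<beta> \<longleftrightarrow> \<gamma> = Poly_Mapping.single v 1 + \<beta>"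
      by (metis add_diff_cancel_left')
    then show ?thesis by (auto simp: lookup_single lookup_add when_def)
  qed
  have "Poly_Mapping.lookup (partial_deriv scale v f) \<beta>
      = (\<Sum>\<gamma>\<in>Poly_Mapping.keys f. if \<gamma> = Poly_Mapping.single v 1 + \<beta>
          then scale (of_nat (Poly_Mapping.lookup \<beta> v + 1)) (Poly_Mapping.lookup f \<gamma>) else 0)"
    unfolding partial_deriv_def lookup_sum * ..
  also have "\<dots> = scale (of_nat (Poly_Mapping.lookup \<beta> v + 1)) (Poly_Mapping.lookup f (Poly_Mapping.single v 1 + \<beta>))"
    by (auto simp: in_keys_iff)
  finally show ?thesis .
qed

lemma lookup_dirac:
  "Poly_Mapping.lookup (dirac m scale act j f) \<beta> = (\<Sum>i=1..m. act (cl_gen i)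
     (scale (of_nat (Poly_Mapping.lookup \<beta> (i, j) + 1))
       (Poly_Mapping.lookup f (Poly_Mapping.single (i, j) 1 + \<beta>))))"
  unfolding dirac_def lookup_sum
  by (intro sum.cong refl) (simp only: lookup_cliff_act cl_gen_in_clifford lookup_partial_deriv)

lemma additive_dirac: "additive (dirac m scale act j)"
proof
  fix f g
  show "dirac m scale act j (f + g) = dirac m scale act j f + dirac m scale act j g"
    unfolding poly_mapping_eq_iff fun_eq_iff lookup_dirac lookup_add sum.distrib[symmetric]
    by (intro allI sum.cong) (simp_all add: act_hom cl_gen_in_clifford scale_right_distrib)
qed

lemma lookup_sp_scale:
  "Poly_Mapping.lookup (sp_scale scale c f) \<beta> = scale c (Poly_Mapping.lookup f \<beta>)"
  by (simp add: sp_scale_def lookup_map_additive)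

lemma dirac_sp_scale: "dirac m scale act j (sp_scale scale c f) = sp_scale scale c (dirac m scale act j f)"
  unfolding poly_mapping_eq_iff fun_eq_iff lookup_dirac lookup_sp_scale scale_sum_right
  by (intro allI sum.cong) (simp_all add: act_hom cl_gen_in_clifford mult.commute)

lemma vector_var_sp_scale: "vv j (sp_scale scale c f) = sp_scale scale c (vv j f)"
  by (simp add: sp_scale_eq_poly_act vector_var_poly_act)

definition fischer_form :: "('s \<Rightarrow> 's \<Rightarrow> real) \<Rightarrow> 's spoly \<Rightarrow> 's spoly \<Rightarrow> real" where
  "fischer_form F f g = (\<Sum>\<beta>\<in>Poly_Mapping.keys f.
     multi_fact \<beta> * F (Poly_Mapping.lookup f \<beta>) (Poly_Mapping.lookup g \<beta>))"

lemma fischer_form_superset: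
  assumes "pos_def_form rscale F" "finite K" "Poly_Mapping.keys f \<subseteq> K"
  shows "fischer_form F f g
    = (\<Sum>\<beta>\<in>K. multi_fact \<beta> * F (Poly_Mapping.lookup f \<beta>) (Poly_Mapping.lookup g \<beta>))"
proof -
  interpret F: pos_def_form rscale F by fact
  show ?thesis
    unfolding fischer_form_def using assms(2,3)
    by (intro sum.mono_neutral_left) (auto simp: in_keys_iff)
qed

lemma pos_def_form_fischer:
  assumes "pos_def_form rscale F"
  shows "pos_def_form (\<lambda>r. sp_scale scale (complex_of_real r)) (fischer_form F)"
proof -
  interpret F: pos_def_form rscale F by fact
  interpret V: vector_space "\<lambda>r. sp_scale scale (complex_of_real r) :: 's spoly \<Rightarrow> 's spoly"
    by (rule vector_space_of_real[OF vector_space_sp_scale[OF vector_space_axioms]])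
  show ?thesis
  proof (unfold_locales)
    fix x y z :: "'s spoly" and c
    let ?A = "Poly_Mapping.keys x \<union> Poly_Mapping.keys y"
    have A: "finite ?A" by simp
    note ext = fischer_form_superset[OF assms A]
    show "fischer_form F x y = fischer_form F y x"
      by (subst (1 2) ext) (auto simp: F.form_sym intro!: sum.cong)
    show "fischer_form F (x + y) z = fischer_form F x z + fischer_form F y z"
      using keys_add[of x y]
      by (subst (1 2 3) ext) (auto simp: lookup_add F.form_add algebra_simps sum.distrib)
    show "fischer_form F (sp_scale scale (complex_of_real c) x) y = c * fischer_form F x y"
      by (subst (1 2) ext)
         (auto simp: in_keys_iff lookup_sp_scale F.form_scale sum_distrib_left algebra_simps)
    show "fischer_form F x x > 0" if "x \<noteq> 0"
      unfolding fischer_form_def using that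
      by (intro sum_pos) (auto simp: in_keys_iff intro!: mult_pos_pos multi_fact_pos F.form_pos)
  qed
qed

lemma fischer_form_coord:
  assumes "pos_def_form rscale F"
  shows "fischer_form F (poly_act scale (coord a j) f) g = fischer_form F f (partial_deriv scale (a, j) g)"
proof -
  interpret F: pos_def_form rscale F by fact
  let ?e = "Poly_Mapping.single (a, j) (1 :: nat)"
  have inj: "inj_on ((+) ?e) (Poly_Mapping.keys f)" by (auto intro: inj_onI)
  have "Poly_Mapping.keys (poly_act scale (coord a j) f) \<subseteq> (+) ?e ` Poly_Mapping.keys f"
    using keys_poly_act[of "coord a j" f] by (auto simp: coord_def)
  then have "fischer_form F (poly_act scale (coord a j) f) g = (\<Sum>\<beta>\<in>Poly_Mapping.keys f.
      multi_fact (?e + \<beta>) * F (Poly_Mapping.lookup f \<beta>) (Poly_Mapping.lookup g (?e + \<beta>)))"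
    by (subst fischer_form_superset[OF assms, of "(+) ?e ` Poly_Mapping.keys f"])
       (simp_all add: sum.reindex[OF inj] coord_def lookup_poly_act_single del: One_nat_def)
  also have "\<dots> = fischer_form F f (partial_deriv scale (a, j) g)"
    unfolding fischer_form_def
  proof (intro sum.cong refl)
    fix \<beta>
    have "F s (scale (of_nat n) t) = n * F s t" for s t and n :: nat
      using F.form_scale_right[of s "real n" t] by simp
    then show "multi_fact (?e + \<beta>) * F (Poly_Mapping.lookup f \<beta>) (Poly_Mapping.lookup g (?e + \<beta>))
        = multi_fact \<beta> * F (Poly_Mapping.lookup f \<beta>)
          (Poly_Mapping.lookup (partial_deriv scale (a, j) g) \<beta>)"
      by (simp only: multi_fact_single_add lookup_partial_deriv) (simp add: mult_ac)
  qed
  finally show ?thesis .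
qed

lemma fischer_form_cliff_act:
  assumes "pos_def_form rscale F" "i \<in> {1..m}"
    and "\<And>s t. F (act (cl_gen i) s) t = - F s (act (cl_gen i) t)"
  shows "fischer_form F (cliff_act act (cl_gen i) f) g = - fischer_form F f (cliff_act act (cl_gen i) g)"
proof -
  have "Poly_Mapping.keys (cliff_act act (cl_gen i) f) \<subseteq> Poly_Mapping.keys f"
    using assms(2) by (auto simp: in_keys_iff lookup_cliff_act cl_gen_in_clifford act_hom
        simp del: atLeastAtMost_iff)
  then show ?thesis
    using assms(2)
    by (subst (1 2) fischer_form_superset[OF assms(1), of "Poly_Mapping.keys f"])
       (simp_all add: lookup_cliff_act cl_gen_in_clifford assms(3) sum_negf del: atLeastAtMost_iff)
qed

lemma fischer_form_vector_var:
  assumes "pos_def_form rscale F"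
    and "\<And>i s t. i \<in> {1..m} \<Longrightarrow> F (act (cl_gen i) s) t = - F s (act (cl_gen i) t)"
  shows "fischer_form F (vv j f) g = - fischer_form F f (dirac m scale act j g)"
proof -
  interpret Q: pos_def_form "\<lambda>r. sp_scale scale (complex_of_real r)" "fischer_form F"
    by (rule pos_def_form_fischer[OF assms(1)])
  have add: "additive (\<lambda>f. fischer_form F f g)" "additive (fischer_form F f)" for f g
    by (simp_all add: additive_def Q.form_add Q.form_add_right)
  have "fischer_form F (vv j f) g
      = (\<Sum>i=1..m. fischer_form F (cliff_act act (cl_gen i) (poly_act scale (coord i j) f)) g)"
    unfolding vector_var_def by (rule additive.sum[OF add(1)])
  also have "\<dots> = (\<Sum>i=1..m. - fischer_form F f (cliff_act act (cl_gen i) (partial_deriv scale (i, j) g)))"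
  proof (intro sum.cong refl)
    fix i assume i: "i \<in> {1..m}"
    show "fischer_form F (cliff_act act (cl_gen i) (poly_act scale (coord i j) f)) g
        = - fischer_form F f (cliff_act act (cl_gen i) (partial_deriv scale (i, j) g))"
      unfolding cliff_act_poly_act[OF cl_gen_in_clifford[OF i]] fischer_form_coord[OF assms(1)]
      by (rule fischer_form_cliff_act[OF assms(1) i assms(2)[OF i]])
  qed
  also have "\<dots> = - fischer_form F f (dirac m scale act j g)"
    by (simp add: dirac_def additive.sum[OF add(2)[of f]] sum_negf)
  finally show ?thesis .
qed

lemma fischer_form_exists:
  "\<exists>Q. pos_def_form (\<lambda>r. sp_scale scale (complex_of_real r)) Q
    \<and> (\<forall>j f g. Q (vv j f) g = - Q f (dirac m scale act j g))"
proof -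
  obtain F where F: "pos_def_form rscale F"
    "\<And>i s t. i \<in> {1..m} \<Longrightarrow> F (act (cl_gen i) s) t = - F s (act (cl_gen i) t)"
    using invariant_form_exists by blast
  then show ?thesis using pos_def_form_fischer[OF F(1)] fischer_form_vector_var[OF F] by blast
qed

end

section \<open>Orthogonality of monogenic polynomials and induction on the degree\<close>

context spinor_module
begin

text \<open>By adjointness \<open>f\<close> is orthogonal to the images of all x_j, hence also to
  those of r_ij^2, since 2 r_ij^2 = - x_i x_j - x_j x_i. Lying in the sum of these images,
  \<open>f\<close> is orthogonal to itself.\<close>

lemma monogenic_orthogonal:
  assumes "f \<in> monogenics m k scale act" "1 \<le> a"
    and "f \<in> fold adjoin_image (concat (map (vv_row k) [a..<Suc k])) {0}"
  shows "f = 0"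
proof -
  obtain Q where Q: "pos_def_form (\<lambda>r. sp_scale scale (complex_of_real r)) Q"
    "\<And>j f g. Q (vv j f) g = - Q f (dirac m scale act j g)"
    using fischer_form_exists by blast
  interpret Q: pos_def_form "\<lambda>r. sp_scale scale (complex_of_real r)" Q by (rule Q(1))
  have vv: "Q (vv j g) f = 0" if "1 \<le> j" "j \<le> k" for j g
    using assms(1) that by (simp add: Q(2) monogenics_def)
  have rr: "Q (rr i j g) f = 0" if "1 \<le> i" "i \<le> k" "1 \<le> j" "j \<le> k" for i j g
  proof -
    have "rr i j g + rr i j g = - vv j (vv i g) - vv i (vv j g)"
      by (subst (2) vector_var_swap) simp
    then have "Q (rr i j g) f + Q (rr i j g) f = Q (- vv j (vv i g) - vv i (vv j g)) f"
      by (metis Q.form_add)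
    then show ?thesis using vv that by (simp add: Q.form_diff Q.form_minus)
  qed
  have "Q f f \<in> {0}"
  proof (rule fold_adjoin_image_closed[where T = "\<lambda>g. Q g f", OF _ _ _ _ assms(3)])
    show "add_subgroup {0 :: real}" by (simp add: add_subgroup_def)
    show "additive (\<lambda>g. Q g f)" by (simp add: additive_def Q.form_add)
    show "Q w f \<in> {0}" if "w \<in> {0}" for w using that by simp
    show "Q (b g) f \<in> {0}" if "b \<in> set (concat (map (vv_row k) [a..<Suc k]))" for b g
      using that assms(2) by (auto simp: vv_row_def vv rr simp del: upt_Suc)
  qed
  then show ?thesis using Q.form_pos[of f] by force
qed

text \<open>The degree bound is strict, so d = 0 gives the empty set and a trivial start of the
  degree induction.\<close>

definition bounded_exponents :: "nat \<Rightarrow> nat \<Rightarrow> ((nat \<times> nat) \<Rightarrow>\<^sub>0 nat) set" where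
  "bounded_exponents k d = {\<beta>. Poly_Mapping.keys \<beta> \<subseteq> {1..m} \<times> {1..k}
     \<and> (\<Sum>v\<in>{1..m} \<times> {1..k}. Poly_Mapping.lookup \<beta> v) < d}"

lemma bounded_exponents_single_add:
  assumes "v \<in> {1..m} \<times> {1..k}"
  shows "Poly_Mapping.single v 1 + \<beta> \<in> bounded_exponents k (Suc d) \<longleftrightarrow> \<beta> \<in> bounded_exponents k d"
proof -
  have "(\<Sum>w\<in>{1..m} \<times> {1..k}. Poly_Mapping.lookup (Poly_Mapping.single v 1 + \<beta>) w)
      = Suc (\<Sum>w\<in>{1..m} \<times> {1..k}. Poly_Mapping.lookup \<beta> w)"
    using assms by (simp add: lookup_add sum.distrib lookup_single when_def)
  moreover have "Poly_Mapping.keys (Poly_Mapping.single v 1 + \<beta>) = insert v (Poly_Mapping.keys \<beta>)"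
    by (auto simp: in_keys_iff lookup_add lookup_single when_def split: if_splits)
  ultimately show ?thesis using assms by (simp add: bounded_exponents_def)
qed

lemma bounded_exponents_minus_single:
  assumes "\<beta> \<in> bounded_exponents k (Suc d)" "Poly_Mapping.lookup \<beta> v > 0"
  shows "v \<in> {1..m} \<times> {1..k}" "\<beta> - Poly_Mapping.single v 1 \<in> bounded_exponents k d"
proof -
  show v: "v \<in> {1..m} \<times> {1..k}" using assms by (auto simp: bounded_exponents_def in_keys_iff)
  show "\<beta> - Poly_Mapping.single v 1 \<in> bounded_exponents k d"
    using bounded_exponents_single_add[OF v, of "\<beta> - Poly_Mapping.single v 1" d] assms
    by (simp add: single_add_minus_single del: One_nat_def)
qed

lemma finite_bounded_exponents: "finite (bounded_exponents k d)"
proof (induction d)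
  case 0
  then show ?case by (simp add: bounded_exponents_def)
next
  case (Suc d)
  have "bounded_exponents k (Suc d)
      \<subseteq> insert 0 (\<Union>v\<in>{1..m} \<times> {1..k}. (+) (Poly_Mapping.single v 1) ` bounded_exponents k d)"
  proof
    fix \<beta> assume \<beta>: "\<beta> \<in> bounded_exponents k (Suc d)"
    show "\<beta> \<in> insert 0 (\<Union>v\<in>{1..m} \<times> {1..k}. (+) (Poly_Mapping.single v 1) ` bounded_exponents k d)"
    proof (cases "\<beta> = 0")
      case False
      then obtain v where v: "Poly_Mapping.lookup \<beta> v > 0"
        by (metis gr0I lookup_zero poly_mapping_eqI)
      have "\<beta> \<in> (+) (Poly_Mapping.single v 1) ` bounded_exponents k d"
        using bounded_exponents_minus_single(2)[OF \<beta> v] single_add_minus_single[OF v, symmetric]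
        by (rule rev_image_eqI)
      then show ?thesis using bounded_exponents_minus_single(1)[OF \<beta> v] by blast
    qed simp
  qed
  then show ?case by (rule finite_subset) (simp add: Suc)
qed

lemma vector_var_single:
  "vv j (Poly_Mapping.single \<beta> s)
    = (\<Sum>i=1..m. Poly_Mapping.single (Poly_Mapping.single (i, j) 1 + \<beta>) (act (cl_gen i) s))"
  unfolding vector_var_def coord_def
  by (intro sum.cong refl) (simp only: poly_act_single_single cliff_act_single cl_gen_in_clifford scale_one)

lemma dirac_single:
  "dirac m scale act j (Poly_Mapping.single \<beta> s)
    = (\<Sum>i=1..m. Poly_Mapping.single (\<beta> - Poly_Mapping.single (i, j) 1)
        (scale (of_nat (Poly_Mapping.lookup \<beta> (i, j))) (act (cl_gen i) s)))"
proof -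
  have "partial_deriv scale v (Poly_Mapping.single \<beta> s) = Poly_Mapping.single (\<beta> - Poly_Mapping.single v 1)
      (scale (of_nat (Poly_Mapping.lookup \<beta> v)) s)" for v
    by (cases "s = 0") (simp_all add: partial_deriv_def)
  then show ?thesis
    unfolding dirac_def
    by (intro sum.cong refl) (simp only: cliff_act_single cl_gen_in_clifford act_hom(2))
qed

lemma in_spinor_polys_iff:
  "f \<in> spinor_polys m k \<longleftrightarrow>
    (\<forall>\<alpha>. Poly_Mapping.lookup f \<alpha> \<noteq> 0 \<longrightarrow> Poly_Mapping.keys \<alpha> \<subseteq> {1..m} \<times> {1..k})"
  by (auto simp: spinor_polys_def in_keys_iff)

lemma spinor_polys_closed:
  "f \<in> spinor_polys m k \<Longrightarrow> g \<in> spinor_polys m k \<Longrightarrow> f + g \<in> spinor_polys m k"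
  "f \<in> spinor_polys m k \<Longrightarrow> sp_scale scale c f \<in> spinor_polys m k"
  "0 \<in> spinor_polys m k"
  unfolding in_spinor_polys_iff lookup_add lookup_sp_scale
  by (metis add.right_neutral, metis scale_zero_right, simp)

text \<open>By induction on the degree: subtracting from \<open>f\<close> its projection to the span of the images of
  the \<open>x\<^sub>j\<close> leaves a polynomial \<open>u\<close> with \<open>\<langle>\<partial>\<^sub>j u, \<partial>\<^sub>j u\<rangle> = - \<langle>x\<^sub>j \<partial>\<^sub>j u, u\<rangle> = 0\<close>.  The spinors \<open>T\<close>
  restrict the coefficients to a finite dimensional space.\<close>

lemma span_bounded_subset:
  assumes Y: "module.subspace (sp_scale scale) Y" "monogenics m k scale act \<subseteq> Y"
      "\<And>j y. j \<in> {1..k} \<Longrightarrow> y \<in> Y \<Longrightarrow> vv j y \<in> Y"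
    and T: "finite T" "\<And>i t. i \<in> {1..m} \<Longrightarrow> t \<in> T \<Longrightarrow> act (cl_gen i) t \<in> T \<or> - act (cl_gen i) t \<in> T"
  shows "module.span (\<lambda>r. sp_scale scale (complex_of_real r))
     ((\<lambda>(\<beta>, t). Poly_Mapping.single \<beta> t) ` (bounded_exponents k d \<times> T)) \<subseteq> Y"
proof -
  obtain Q where Q: "pos_def_form (\<lambda>r. sp_scale scale (complex_of_real r)) Q"
    "\<And>j f g. Q (vv j f) g = - Q f (dirac m scale act j g)"
    using fischer_form_exists by blast
  interpret Q: pos_def_form "\<lambda>r. sp_scale scale (complex_of_real r)" Q by (rule Q(1))
  interpret C: vector_space "sp_scale scale :: complex \<Rightarrow> 's spoly \<Rightarrow> 's spoly"
    by (rule vector_space_sp_scale[OF vector_space_axioms])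
  define B where "B d = (\<lambda>(\<beta>, t). Poly_Mapping.single \<beta> t) ` (bounded_exponents k d \<times> T)" for d
  have fin: "finite (B d)" for d by (simp add: B_def finite_bounded_exponents T(1))
  have Y': "Q.subspace Y" using Y(1) by (simp add: Q.subspace_def C.subspace_def)
  \<comment> \<open>\<open>T\<close> is closed under the generators only up to sign, and real
    multiples absorb the sign.\<close>
  have scaled: "Poly_Mapping.single \<beta> (rscale r (act (cl_gen i) t)) \<in> Q.span (B d)"
    if "\<beta> \<in> bounded_exponents k d" "t \<in> T" "i \<in> {1..m}" for \<beta> r i t d
  proof -
    have base: "Poly_Mapping.single \<beta> (rscale c s) \<in> Q.span (B d)" if "s \<in> T" for s c
    proof -
      have "Poly_Mapping.single \<beta> s \<in> Q.span (B d)"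
        using that \<open>\<beta> \<in> _\<close> by (intro Q.span_base) (auto simp: B_def)
      from Q.span_scale[OF this, of c] show ?thesis by (simp add: sp_scale_def)
    qed
    show ?thesis
    proof (cases "act (cl_gen i) t \<in> T")
      case False
      then have "- act (cl_gen i) t \<in> T" using T(2) that by blast
      from base[OF this, of "- r"] show ?thesis by simp
    qed (rule base)
  qed
  have dirac_base: "dirac m scale act j b \<in> Q.span (B d)" if "b \<in> B (Suc d)" for b j d
  proof -
    obtain \<beta> t where b: "b = Poly_Mapping.single \<beta> t" "\<beta> \<in> bounded_exponents k (Suc d)" "t \<in> T"
      using \<open>b \<in> _\<close> by (auto simp: B_def)
    show ?thesis
      unfolding b(1) dirac_single
    proof (rule Q.span_sum)
      fix i assume i: "i \<in> {1..m}"
      show "Poly_Mapping.single (\<beta> - Poly_Mapping.single (i, j) 1)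
        (scale (of_nat (Poly_Mapping.lookup \<beta> (i, j))) (act (cl_gen i) t)) \<in> Q.span (B d)"
      proof (cases "Poly_Mapping.lookup \<beta> (i, j) = 0")
        case False
        then show ?thesis
          using scaled[OF bounded_exponents_minus_single(2)[OF b(2)] b(3) i, of "(i, j)"
            "real (Poly_Mapping.lookup \<beta> (i, j))"] by simp
      qed (simp add: Q.span_zero)
    qed
  qed
  have dirac_span: "dirac m scale act j f \<in> Q.span (B d)" if "f \<in> Q.span (B (Suc d))" for f j d
    using that
  proof (induction rule: Q.span_induct_alt)
    case base
    show ?case by (simp add: additive.zero[OF additive_dirac] Q.span_zero)
  next
    case (step c x y)
    then show ?case
      by (simp add: additive.add[OF additive_dirac] dirac_sp_scale Q.span_add Q.span_scale dirac_base)
  qed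
  have vv_base: "vv j b \<in> Q.span (B (Suc d))" if "b \<in> B d" "j \<in> {1..k}" for b j d
  proof -
    obtain \<beta> t where b: "b = Poly_Mapping.single \<beta> t" "\<beta> \<in> bounded_exponents k d" "t \<in> T"
      using \<open>b \<in> _\<close> by (auto simp: B_def)
    show ?thesis
      unfolding b(1) vector_var_single
    proof (rule Q.span_sum)
      fix i assume i: "i \<in> {1..m}"
      then have "Poly_Mapping.single (i, j) 1 + \<beta> \<in> bounded_exponents k (Suc d)"
        using bounded_exponents_single_add[of "(i, j)" k \<beta> d] that(2) b(2) by simp
      from scaled[OF this b(3) i, of 1]
      show "Poly_Mapping.single (Poly_Mapping.single (i, j) 1 + \<beta>) (act (cl_gen i) t)
          \<in> Q.span (B (Suc d))" by simp
    qed
  qed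
  have spinor: "f \<in> spinor_polys m k" if "f \<in> Q.span (B d)" for f d
    using that
  proof (induction rule: Q.span_induct_alt)
    case (step c x y)
    then have "x \<in> spinor_polys m k"
      by (auto simp: B_def bounded_exponents_def spinor_polys_def split: if_splits)
    with step show ?case by (intro spinor_polys_closed)
  qed (rule spinor_polys_closed)
  have "Q.span (B d) \<subseteq> Y" for d
  proof (induction d)
    case 0
    have "B 0 = {}" by (simp add: B_def bounded_exponents_def)
    then show ?case using Q.subspace_0[OF Y'] by simp
  next
    case (Suc d)
    show ?case
    proof
      fix f assume f: "f \<in> Q.span (B (Suc d))"
      \<comment> \<open>Projections are available only onto spans of finite sets. The x_j raise the
        degree by one, so \<open>G\<close> stays inside the span of
        \<open>B (Suc d)\<close>.\<close>
      define G where "G = (\<Union>j\<in>{1..k}. vv j ` B d)"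
      have "finite G" by (simp add: G_def fin)
      then obtain w where w: "w \<in> Q.span G" "\<And>b. b \<in> G \<Longrightarrow> Q (f - w) b = 0"
        using Q.orthogonal_projection by blast
      have "G \<subseteq> Y" using Suc Y(3) Q.span_superset[of "B d"] by (auto simp: G_def)
      then have wY: "w \<in> Y" using w(1) Q.span_minimal[OF _ Y'] by blast
      have "Q.span G \<subseteq> Q.span (B (Suc d))"
        using vv_base by (intro Q.span_minimal Q.subspace_span) (auto simp: G_def)
      then have u: "f - w \<in> Q.span (B (Suc d))" using f w(1) Q.span_diff by blast
      have "dirac m scale act j (f - w) = 0" if j: "j \<in> {1..k}" for j
      proof -
        \<comment> \<open>The Dirac derivative of \<open>f - w\<close> has lower degree and lies in
          the span of \<open>B d\<close>, so it is itself an admissible \<open>g\<close>.\<close>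
        have "Q (vv j g) (f - w) = 0" if "g \<in> Q.span (B d)" for g
          using that
        proof (induction rule: Q.span_induct_alt)
          case (step c x y)
          have "vv j x \<in> G" using step(1) j by (auto simp: G_def)
          then have "Q (vv j x) (f - w) = 0" using w(2) Q.form_sym by metis
          with step show ?case
            by (simp add: additive.add[OF additive_vector_var] vector_var_sp_scale Q.form_add Q.form_scale)
        qed (simp add: additive.zero[OF additive_vector_var])
        from this[OF dirac_span[OF u, of j]]
        have "Q (dirac m scale act j (f - w)) (dirac m scale act j (f - w)) = 0" by (simp add: Q(2))
        then show ?thesis using Q.form_pos by force
      qed
      then have "f - w \<in> Y" using Y(2) spinor[OF u] by (auto simp: monogenics_def)
      from Q.subspace_add[OF Y' this wY] show "f \<in> Y" by simp
    qed
  qed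
  then show ?thesis by (simp add: B_def)
qed

text \<open>A given polynomial has finitely many coefficients, and the basis elements e_A permute
  the vectors obtained from them up to sign. This yields the finite set \<open>T\<close> required
  for the truncated statement.\<close>

lemma spinor_polys_subset:
  assumes Y: "module.subspace (sp_scale scale) Y" "monogenics m k scale act \<subseteq> Y"
      "\<And>j y. j \<in> {1..k} \<Longrightarrow> y \<in> Y \<Longrightarrow> vv j y \<in> Y"
  shows "spinor_polys m k \<subseteq> Y"
proof
  fix f :: "'s spoly" assume f: "f \<in> spinor_polys m k"
  interpret R: vector_space "\<lambda>r. sp_scale scale (complex_of_real r) :: 's spoly \<Rightarrow> 's spoly"
    by (rule vector_space_of_real[OF vector_space_sp_scale[OF vector_space_axioms]])
  define T where "T = (\<lambda>(A, \<gamma>). act_basis A (Poly_Mapping.lookup f \<gamma>)) ` (Pow {1..m} \<times> Poly_Mapping.keys f)"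
  define deg where "deg \<gamma> = (\<Sum>v\<in>{1..m} \<times> {1..k}. Poly_Mapping.lookup \<gamma> v)" for \<gamma> :: "nat \<times> nat \<Rightarrow>\<^sub>0 nat"
  \<comment> \<open>A crude bound for all degrees occurring in \<open>f\<close>; \<open>Suc\<close>
    because the bound is strict.\<close>
  define d where "d = Suc (\<Sum>\<gamma>\<in>Poly_Mapping.keys f. deg \<gamma>)"
  have "act (cl_gen i) t \<in> T \<or> - act (cl_gen i) t \<in> T" if i: "i \<in> {1..m}" and "t \<in> T" for i t
  proof -
    obtain A \<gamma> where A: "A \<subseteq> {1..m}" and \<gamma>: "\<gamma> \<in> Poly_Mapping.keys f"
      and t: "t = act_basis A (Poly_Mapping.lookup f \<gamma>)" using \<open>t \<in> T\<close> by (auto simp: T_def)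
    have "sym_diff {i} A \<in> Pow {1..m}" using A i by auto
    then have "act_basis (sym_diff {i} A) (Poly_Mapping.lookup f \<gamma>) \<in> T"
      using \<gamma> unfolding T_def by (intro image_eqI[of _ _ "(sym_diff {i} A, \<gamma>)"]) auto
    then show ?thesis
      using cl_sign_cases[of "{i}" A] unfolding t act_basis_gen(2)[OF A i] by auto
  qed
  moreover have "finite T" by (simp add: T_def)
  ultimately have span: "R.span ((\<lambda>(\<beta>, t). Poly_Mapping.single \<beta> t) ` (bounded_exponents k d \<times> T)) \<subseteq> Y"
    by (intro span_bounded_subset Y)
  have "(\<Sum>\<gamma>\<in>Poly_Mapping.keys f. Poly_Mapping.single \<gamma> (Poly_Mapping.lookup f \<gamma>))
      \<in> R.span ((\<lambda>(\<beta>, t). Poly_Mapping.single \<beta> t) ` (bounded_exponents k d \<times> T))"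
  proof (intro R.span_sum R.span_base)
    fix \<gamma> assume \<gamma>: "\<gamma> \<in> Poly_Mapping.keys f"
    have "Poly_Mapping.lookup f \<gamma> = act_basis {} (Poly_Mapping.lookup f \<gamma>)"
      using act_one[of "Poly_Mapping.lookup f \<gamma>"] by (simp add: cl_one_def)
    then have "Poly_Mapping.lookup f \<gamma> \<in> T"
      using \<gamma> unfolding T_def by (intro image_eqI[of _ _ "({}, \<gamma>)"]) auto
    moreover have "deg \<gamma> \<le> (\<Sum>\<gamma>\<in>Poly_Mapping.keys f. deg \<gamma>)"
      using \<gamma> by (intro member_le_sum) auto
    then have "\<gamma> \<in> bounded_exponents k d"
      using f \<gamma> by (auto simp: bounded_exponents_def d_def deg_def spinor_polys_def)
    ultimately show "Poly_Mapping.single \<gamma> (Poly_Mapping.lookup f \<gamma>)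
        \<in> (\<lambda>(\<beta>, t). Poly_Mapping.single \<beta> t) ` (bounded_exponents k d \<times> T)" by auto
  qed
  then show "f \<in> Y" using span by (auto simp: sum_single_lookup)
qed

end

section \<open>Internal direct sums\<close>

lemma (in module) span_UN_decomposition:
  assumes "\<And>i. i \<in> I \<Longrightarrow> subspace (V i)" "w \<in> span (\<Union>i\<in>I. V i)"
  shows "\<exists>v. (\<forall>i\<in>I. v i \<in> V i) \<and> (\<forall>i. i \<notin> I \<longrightarrow> v i = 0) \<and>
    finite {i. v i \<noteq> 0} \<and> w = (\<Sum>i | v i \<noteq> 0. v i)"
  using assms(2)
proof (induction rule: span_induct_alt)
  case base
  show ?case by (rule exI[of _ "\<lambda>_. 0"]) (simp add: assms(1) subspace_0)
next
  case (step c x y)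
  obtain i where i: "i \<in> I" "x \<in> V i" using step(1) by blast
  obtain v where v: "\<And>i. i \<in> I \<Longrightarrow> v i \<in> V i" "\<And>i. i \<notin> I \<Longrightarrow> v i = 0" "finite {i. v i \<noteq> 0}"
    "y = (\<Sum>i | v i \<noteq> 0. v i)" using step(2) by blast
  define u where "u = v(i := scale c x + v i)"
  have fin: "finite (insert i {i. v i \<noteq> 0})" using v(3) by simp
  have sub: "{i. u i \<noteq> 0} \<subseteq> insert i {i. v i \<noteq> 0}" by (auto simp: u_def)
  have "(\<Sum>j | u j \<noteq> 0. u j) = (\<Sum>j\<in>insert i {i. v i \<noteq> 0}. u j)"
    using fin sub by (intro sum.mono_neutral_left) auto
  also have "\<dots> = (\<Sum>j\<in>insert i {i. v i \<noteq> 0}. (if j = i then scale c x else 0) + v j)"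
    by (intro sum.cong) (auto simp: u_def)
  also have "\<dots> = scale c x + (\<Sum>j\<in>insert i {i. v i \<noteq> 0}. v j)"
    using fin by (simp add: sum.distrib)
  also have "(\<Sum>j\<in>insert i {i. v i \<noteq> 0}. v j) = y"
    unfolding v(4) using fin by (intro sum.mono_neutral_right) auto
  finally have "scale c x + y = (\<Sum>j | u j \<noteq> 0. u j)" by simp
  moreover have "u j \<in> V j" if "j \<in> I" for j
    using that v(1) i assms(1) by (auto simp: u_def intro!: subspace_add subspace_scale)
  moreover have "u j = 0" if "j \<notin> I" for j using that v(2) i by (auto simp: u_def)
  moreover have "finite {i. u i \<noteq> 0}" using sub fin by (rule finite_subset)
  ultimately show ?case by blast
qed

lemma (in module) internal_direct_sumI:
  assumes "subspace W" "\<And>i. i \<in> I \<Longrightarrow> subspace (V i)" "\<And>i. i \<in> I \<Longrightarrow> V i \<subseteq> W"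
    and "W \<subseteq> span (\<Union>i\<in>I. V i)"
    and indep: "\<And>A v i. finite A \<Longrightarrow> A \<subseteq> I \<Longrightarrow> (\<And>i. i \<in> A \<Longrightarrow> v i \<in> V i) \<Longrightarrow> (\<Sum>i\<in>A. v i) = 0 \<Longrightarrow>
      i \<in> A \<Longrightarrow> v i = 0"
  shows "internal_direct_sum scale W I V"
  unfolding internal_direct_sum_def
proof (intro conjI ballI ex_ex1I)
  fix w assume "w \<in> W"
  then show "\<exists>v. (\<forall>i\<in>I. v i \<in> V i) \<and> (\<forall>i. i \<notin> I \<longrightarrow> v i = 0) \<and>
      finite {i. v i \<noteq> 0} \<and> w = (\<Sum>i | v i \<noteq> 0. v i)"
    using assms(4) by (intro span_UN_decomposition assms(2)) auto
  fix u v
  assume u: "(\<forall>i\<in>I. u i \<in> V i) \<and> (\<forall>i. i \<notin> I \<longrightarrow> u i = 0) \<and>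
      finite {i. u i \<noteq> 0} \<and> w = (\<Sum>i | u i \<noteq> 0. u i)"
    and v: "(\<forall>i\<in>I. v i \<in> V i) \<and> (\<forall>i. i \<notin> I \<longrightarrow> v i = 0) \<and>
      finite {i. v i \<noteq> 0} \<and> w = (\<Sum>i | v i \<noteq> 0. v i)"
  define A where "A = {i. u i \<noteq> 0} \<union> {i. v i \<noteq> 0}"
  have A: "finite A" "A \<subseteq> I" using u v by (auto simp: A_def)
  have "(\<Sum>i\<in>A. u i) = (\<Sum>i | u i \<noteq> 0. u i)" "(\<Sum>i\<in>A. v i) = (\<Sum>i | v i \<noteq> 0. v i)"
    using A(1) by (auto simp: A_def intro!: sum.mono_neutral_right)
  then have "(\<Sum>i\<in>A. u i) = w" "(\<Sum>i\<in>A. v i) = w" using u v by simp_all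
  then have "(\<Sum>i\<in>A. u i - v i) = 0" by (simp add: sum_subtractf)
  moreover have "u i - v i \<in> V i" if "i \<in> A" for i
    using that A(2) u v assms(2) by (auto intro!: subspace_diff)
  ultimately have eq: "u i - v i = 0" if "i \<in> A" for i
    using indep[OF A, of "\<lambda>i. u i - v i" i] that by blast
  show "u = v"
  proof
    fix i
    show "u i = v i" using eq[of i] by (cases "i \<in> A") (auto simp: A_def)
  qed
qed (use assms in auto)


section \<open>Spanning\<close>

lemma sorted_list_of_set_insert_least:
  fixes A :: "nat set"
  assumes "finite A" "\<And>b. b \<in> A \<Longrightarrow> a < b"
  shows "sorted_list_of_set (insert a A) = a # sorted_list_of_set A"
proof (rule sorted_list_of_set_unique[THEN iffD1])
  show "finite (insert a A)" using assms by simp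
  have "a \<notin> A" using assms(2) by blast
  then show "sorted_wrt (<) (a # sorted_list_of_set A) \<and>
      set (a # sorted_list_of_set A) = insert a A \<and>
      length (a # sorted_list_of_set A) = card (insert a A)"
    using assms by simp
qed

context spinor_module
begin

abbreviation "vvs \<equiv> vector_var_set m scale act"

lemma vector_var_set_insert:
  "finite J \<Longrightarrow> (\<And>j. j \<in> J \<Longrightarrow> a < j) \<Longrightarrow> vvs (insert a J) f = vv a (vvs J f)"
  unfolding vector_var_set_def by (subst sorted_list_of_set_insert_least) auto

lemma vector_var_set_poly_act: "vvs J (poly_act scale p f) = poly_act scale p (vvs J f)"
proof -
  have "foldr vv js (poly_act scale p f) = poly_act scale p (foldr vv js f)" for js
    by (induction js) (simp_all add: vector_var_poly_act)
  then show ?thesis by (simp add: vector_var_set_def)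
qed

lemma additive_vector_var_set: "additive (vvs J)"
proof -
  have "additive (foldr vv js)" for js
    by (induction js) (simp_all add: additive_def additive.add[OF additive_vector_var])
  then show ?thesis by (simp add: additive_def vector_var_set_def)
qed

definition r_power :: "nat \<Rightarrow> (nat \<times> nat \<Rightarrow> nat) \<Rightarrow> cpoly" where
  "r_power k n = (\<Prod>(i, j)\<in>index_pairs k. r_sq m i j ^ n (i, j))"

lemma r_power_mult:
  assumes "(i, j) \<in> index_pairs k"
  shows "r_sq m i j * r_power k n = r_power k (n((i, j) := Suc (n (i, j))))"
proof -
  have "r_power k (n((i, j) := Suc (n (i, j))))
      = (\<Prod>q\<in>index_pairs k. (if q = (i, j) then r_sq m i j else 1) * (case q of (a, b) \<Rightarrow> r_sq m a b ^ n (a, b)))"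
    unfolding r_power_def by (intro prod.cong) (auto split: if_splits)
  then show ?thesis
    using assms by (simp add: prod.distrib r_power_def finite_index_pairs)
qed

text \<open>Only J is cut down by \<open>a\<close>, while all r_ij^2 stay available. This permits a
  downward induction on the least index allowed in J.\<close>

definition generators :: "nat \<Rightarrow> nat \<Rightarrow> 's spoly set" where
  "generators k a = {poly_act scale (r_power k n) (vvs J f) | n J f.
     J \<subseteq> {a..k} \<and> f \<in> monogenics m k scale act}"

lemma rr_generators:
  assumes "(i, j) \<in> index_pairs k" "g \<in> generators k a"
  shows "rr i j g \<in> generators k a"
  using assms(2) unfolding generators_def
  by (auto simp: poly_act_mult[symmetric] r_power_mult[OF assms(1)]) blast

lemma vv_generators:
  assumes "g \<in> generators k (Suc a)" "a \<le> k"
  shows "vv a g \<in> generators k a"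
proof -
  obtain n J f where g: "g = poly_act scale (r_power k n) (vvs J f)" and J: "J \<subseteq> {Suc a..k}"
    and f: "f \<in> monogenics m k scale act" using assms(1) by (auto simp: generators_def)
  have "vvs (insert a J) f = vv a (vvs J f)"
    using J by (intro vector_var_set_insert) (auto intro: finite_subset)
  then have "vv a g = poly_act scale (r_power k n) (vvs (insert a J) f)"
    by (simp add: g vector_var_poly_act)
  moreover have "insert a J \<subseteq> {a..k}" using J assms(2) by auto
  ultimately show ?thesis using f unfolding generators_def by blast
qed

text \<open>If a lies in J, it is the least element, so x_a is the leftmost factor of x_J and scalar
  polynomials commute with it.\<close>

lemma generators_cases:
  assumes "g \<in> generators k a"
  obtains "g \<in> generators k (Suc a)" | h where "h \<in> generators k (Suc a)" "g = vv a h"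
proof -
  obtain n J f where g: "g = poly_act scale (r_power k n) (vvs J f)" and J: "J \<subseteq> {a..k}"
    and f: "f \<in> monogenics m k scale act" using assms(1) by (auto simp: generators_def)
  have ivl: "{a..k} - {a} = {Suc a..k}" by auto
  show ?thesis
  proof (cases "a \<in> J")
    case False
    then have "J \<subseteq> {Suc a..k}" using J ivl by blast
    then show ?thesis using f g that(1) unfolding generators_def by blast
  next
    case True
    have J': "J - {a} \<subseteq> {Suc a..k}" using J ivl by blast
    have "vvs (insert a (J - {a})) f = vv a (vvs (J - {a}) f)"
      using J' finite_subset[OF J] by (intro vector_var_set_insert) auto
    then have "g = vv a (poly_act scale (r_power k n) (vvs (J - {a}) f))"
      using True by (simp add: g vector_var_poly_act insert_absorb)
    then show ?thesis using that(2) J' f unfolding generators_def by blast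
  qed
qed

lemma span_closed_under_operator:
  assumes "additive T" "\<And>c f. T (sp_scale scale c f) = sp_scale scale c (T f)"
    and "\<And>g. g \<in> G \<Longrightarrow> T g \<in> module.span (sp_scale scale) H"
    and "f \<in> module.span (sp_scale scale) G"
  shows "T f \<in> module.span (sp_scale scale) H"
proof -
  interpret C: vector_space "sp_scale scale :: complex \<Rightarrow> 's spoly \<Rightarrow> 's spoly"
    by (rule vector_space_sp_scale[OF vector_space_axioms])
  show ?thesis
    using assms(4)
    by (induction rule: C.span_induct_alt)
       (simp_all add: additive.zero[OF assms(1)] additive.add[OF assms(1)] assms(2,3)
         C.span_zero C.span_add C.span_scale)
qed

text \<open>The relation \<open>x\<^sub>j x\<^sub>a = - x\<^sub>a x\<^sub>j - 2 r\<^sub>a\<^sub>j\<^sup>2\<close> moves \<open>x\<^sub>j\<close> to its place in \<open>x\<^sub>J\<close>.\<close>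

lemma vv_span_generators:
  assumes "1 \<le> a" "a \<le> j" "j \<le> k" "f \<in> module.span (sp_scale scale) (generators k a)"
  shows "vv j f \<in> module.span (sp_scale scale) (generators k a)"
  using assms
proof (induction "Suc k - a" arbitrary: a j f)
  case 0
  then show ?case by simp
next
  case (Suc l)
  interpret C: vector_space "sp_scale scale :: complex \<Rightarrow> 's spoly \<Rightarrow> 's spoly"
    by (rule vector_space_sp_scale[OF vector_space_axioms])
  have le: "a \<le> k" using Suc.prems by simp
  have "generators k (Suc a) \<subseteq> generators k a" unfolding generators_def by fastforce
  then have mono: "C.span (generators k (Suc a)) \<subseteq> C.span (generators k a)" by (rule C.span_mono)
  have vva: "vv a h \<in> C.span (generators k a)" if "h \<in> C.span (generators k (Suc a))" for h
    using additive_vector_var vector_var_sp_scale _ that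
    by (rule span_closed_under_operator) (rule C.span_base, rule vv_generators[OF _ le])
  show ?case
    using additive_vector_var vector_var_sp_scale _ Suc.prems(4)
  proof (rule span_closed_under_operator)
    fix g assume "g \<in> generators k a"
    then show "vv j g \<in> C.span (generators k a)"
    proof (cases rule: generators_cases)
      case 1
      show ?thesis
      proof (cases "j = a")
        case True
        then show ?thesis using vva[OF C.span_base[OF 1]] by simp
      next
        case False
        then have "vv j g \<in> C.span (generators k (Suc a))"
          using Suc.prems Suc.hyps(2) by (intro Suc.hyps(1) C.span_base 1) auto
        then show ?thesis using mono by blast
      qed
    next
      case (2 h)
      have r: "rr a j h \<in> C.span (generators k a)"
        using Suc.prems mono rr_generators[OF _ 2(1), of a j] C.span_base
        by (auto simp: index_pairs_def)
      show ?thesis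
      proof (cases "j = a")
        case True
        then show ?thesis using r by (simp add: 2(2) vector_var_square C.span_neg)
      next
        \<comment> \<open>Once x_j has passed x_a it meets \<open>h\<close>, whose vector variables
          all have index above a, so the induction hypothesis applies; the correction is a multiple
          of \<open>rr a j h\<close>.\<close>
        case False
        then have "vv j h \<in> C.span (generators k (Suc a))"
          using Suc.prems Suc.hyps(2) by (intro Suc.hyps(1) C.span_base 2) auto
        from vva[OF this] r show ?thesis
          unfolding 2(2) vector_var_swap[of j a] r_sq_commute[of m j a]
          by (intro C.span_diff C.span_neg C.span_add)
      qed
    qed
  qed
qed

lemma spinor_polys_subset_span_generators:
  "spinor_polys m k \<subseteq> module.span (sp_scale scale) (generators k 1)"
proof -
  interpret C: vector_space "sp_scale scale :: complex \<Rightarrow> 's spoly \<Rightarrow> 's spoly"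
    by (rule vector_space_sp_scale[OF vector_space_axioms])
  show ?thesis
  proof (rule spinor_polys_subset)
    show "monogenics m k scale act \<subseteq> C.span (generators k 1)"
    proof
      fix f assume "f \<in> monogenics m k scale act"
      moreover have "f = poly_act scale (r_power k (\<lambda>_. 0)) (vvs {} f)"
        by (simp add: r_power_def vector_var_set_def poly_act_one)
      ultimately have "f \<in> generators k 1" unfolding generators_def by blast
      then show "f \<in> C.span (generators k 1)" by (rule C.span_base)
    qed
  qed (auto intro: vv_span_generators simp del: One_nat_def)
qed


section \<open>Independence\<close>

text \<open>Exponents in the mixed sequence: x_i to the power 2 n + e equals (- r_ii^2)^n times
  x_i^e, so one number on the diagonal encodes both n_ii and membership in J.\<close>

definition exponent :: "nat set \<Rightarrow> (nat \<times> nat \<Rightarrow> nat) \<Rightarrow> nat \<times> nat \<Rightarrow> nat" where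
  "exponent J n = (\<lambda>(i, j). if i = j then 2 * n (i, i) + of_bool (i \<in> J) else n (i, j))"

definition pair_list :: "nat \<Rightarrow> nat \<Rightarrow> (nat \<times> nat) list" where
  "pair_list k a = concat (map (\<lambda>i. map (Pair i) [i..<Suc k]) [a..<Suc k])"

lemma set_pair_list: "set (pair_list k 1) = index_pairs k"
proof -
  have "q \<in> set (pair_list k 1) \<longleftrightarrow> q \<in> index_pairs k" for q
    by (cases q) (auto simp: pair_list_def index_pairs_def image_iff simp del: upt_Suc)
  then show ?thesis by blast
qed

lemma distinct_pair_list: "distinct (pair_list k a)"
proof -
  have "inj_on (\<lambda>i. map (Pair i) [i..<Suc k]) (set [a..<Suc k])"
    by (rule inj_on_inverseI[of _ "\<lambda>qs. fst (hd qs)"]) (simp add: hd_map del: upt_Suc)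
  then show ?thesis
    unfolding pair_list_def
    by (intro distinct_concat) (auto simp: distinct_map inj_on_def[of "Pair _"] simp del: upt_Suc)
qed

lemma rr_rows_eq: "concat (map (rr_row k) [a..<Suc k]) = map (\<lambda>(i, j). rr i j) (pair_list k a)"
proof -
  have "rr_row k i = map (\<lambda>(i, j). rr i j) (map (Pair i) [i..<Suc k])" if "i < Suc k" for i
    using that by (simp add: rr_row_def upt_conv_Cons del: upt_Suc)
  then show ?thesis
    by (auto simp: pair_list_def map_concat comp_def simp del: upt_Suc intro!: arg_cong[of _ _ concat])
qed

lemma op_monomial_append:
  "length gs = length es \<Longrightarrow>
    op_monomial (gs @ gs') (es @ es') f = op_monomial gs es (op_monomial gs' es' f)"
  by (induction gs es rule: list_induct2) simp_all

lemma poly_act_funpow: "(poly_act scale p ^^ e) f = poly_act scale (p ^ e) f"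
  by (induction e) (simp_all add: poly_act_one poly_act_mult)

lemma op_monomial_rr:
  "op_monomial (map (rr i) js) (map e js) f = poly_act scale (\<Prod>j\<leftarrow>js. r_sq m i j ^ e j) f"
  by (induction js) (simp_all add: poly_act_one poly_act_mult poly_act_funpow)

lemma vv_funpow: "(vv i ^^ (2 * n + of_bool b)) f = poly_act scale ((- r_sq m i i) ^ n) (if b then vv i f else f)"
proof (induction n)
  case 0
  then show ?case by (simp add: poly_act_one)
next
  case (Suc n)
  have "(vv i ^^ (2 * Suc n + of_bool b)) f = vv i (vv i ((vv i ^^ (2 * n + of_bool b)) f))"
    by simp
  then show ?case
    by (simp add: Suc vector_var_square poly_act_mult additive.minus[OF additive_poly_act_left])
qed

lemma op_monomial_vv_row:
  assumes "i \<le> k"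
  shows "op_monomial (vv_row k i) (map (exponent J n) (map (Pair i) [i..<Suc k])) f
    = poly_act scale ((-1) ^ n (i, i) * (\<Prod>j\<in>{i..k}. r_sq m i j ^ n (i, j)))
        (if i \<in> J then vv i f else f)"
proof -
  have upt: "[i..<Suc k] = i # [Suc i..<Suc k]" using assms by (simp add: upt_conv_Cons del: upt_Suc)
  have exps: "map (exponent J n) (map (Pair i) [Suc i..<Suc k]) = map (\<lambda>j. n (i, j)) [Suc i..<Suc k]"
    by (auto simp: exponent_def simp del: upt_Suc)
  have "{i..k} = insert i (set [Suc i..<Suc k])" using assms by (auto simp del: upt_Suc)
  then have prod: "(\<Prod>j\<in>{i..k}. r_sq m i j ^ n (i, j))
      = r_sq m i i ^ n (i, i) * (\<Prod>j\<leftarrow>[Suc i..<Suc k]. r_sq m i j ^ n (i, j))"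
    by (simp add: prod.distinct_set_conv_list[symmetric] del: upt_Suc set_upt) (simp del: upt_Suc)
  have "op_monomial (vv_row k i) (map (exponent J n) (map (Pair i) [i..<Suc k])) f
      = (vv i ^^ (2 * n (i, i) + of_bool (i \<in> J)))
          (poly_act scale (\<Prod>j\<leftarrow>[Suc i..<Suc k]. r_sq m i j ^ n (i, j)) f)"
    unfolding upt vv_row_def list.map(2) op_monomial.simps(1) exps op_monomial_rr
    by (simp add: exponent_def)
  also have "\<dots> = poly_act scale ((-1) ^ n (i, i) * (\<Prod>j\<in>{i..k}. r_sq m i j ^ n (i, j)))
      (if i \<in> J then vv i f else f)"
    unfolding vv_funpow prod power_minus[of "r_sq m i i"] poly_act_mult
    by (simp add: vector_var_poly_act)
  finally show ?thesis .
qed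

text \<open>The r_ij^2 commute with everything and are collected on the left; the odd diagonal
  exponents leave one x_i for each i in J, in increasing order. The signs come from x_i^2 = -
  r_ii^2.\<close>

lemma op_monomial_vv_rows:
  assumes "1 \<le> a"
  shows "op_monomial (concat (map (vv_row k) [a..<Suc k])) (map (exponent J n) (pair_list k a)) f
    = poly_act scale (\<Prod>i\<in>{a..k}. (-1) ^ n (i, i) * (\<Prod>j\<in>{i..k}. r_sq m i j ^ n (i, j)))
        (vvs (J \<inter> {a..k}) f)"
  using assms
proof (induction "Suc k - a" arbitrary: a)
  case 0
  then show ?case by (simp add: pair_list_def vector_var_set_def poly_act_one)
next
  case (Suc l)
  then have a: "a \<le> k" by simp
  then have upt: "[a..<Suc k] = a # [Suc a..<Suc k]" by (simp add: upt_conv_Cons del: upt_Suc)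
  have ivl: "{a..k} = insert a {Suc a..k}" using a by auto
  have pairs: "pair_list k a = map (Pair a) [a..<Suc k] @ pair_list k (Suc a)"
    unfolding pair_list_def by (simp add: upt del: upt_Suc)
  have rows: "concat (map (vv_row k) [a..<Suc k]) = vv_row k a @ concat (map (vv_row k) [Suc a..<Suc k])"
    unfolding upt by simp
  have len: "length (vv_row k a) = length (map (exponent J n) (map (Pair a) [a..<Suc k]))"
    using a by (simp add: vv_row_def del: upt_Suc)
  have "vvs (J \<inter> {a..k}) f
      = (if a \<in> J then vv a (vvs (J \<inter> {Suc a..k}) f) else vvs (J \<inter> {Suc a..k}) f)"
  proof (cases "a \<in> J")
    case True
    have "vvs (insert a (J \<inter> {Suc a..k})) f = vv a (vvs (J \<inter> {Suc a..k}) f)"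
      by (rule vector_var_set_insert) auto
    then show ?thesis using True by (simp add: ivl)
  qed (simp add: ivl)
  moreover have "l = Suc k - Suc a" using Suc.hyps(2) by simp
  ultimately show ?case
    using Suc.hyps(1)[of "Suc a"]
    unfolding rows pairs map_append op_monomial_append[OF len] op_monomial_vv_row[OF a]
    by (simp add: ivl poly_act_mult vector_var_poly_act del: upt_Suc)
qed

text \<open>Parity of a diagonal exponent recovers J, its half recovers n_ii; extensionality settles
  the values outside \<open>index_pairs k\<close>.\<close>

lemma exponent_inject:
  assumes "J \<subseteq> {1..k}" "J' \<subseteq> {1..k}" "n \<in> index_pairs k \<rightarrow>\<^sub>E UNIV" "n' \<in> index_pairs k \<rightarrow>\<^sub>E UNIV"
    and "map (exponent J n) (pair_list k 1) = map (exponent J' n') (pair_list k 1)"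
  shows "J = J' \<and> n = n'"
proof
  have eq: "exponent J n (i, j) = exponent J' n' (i, j)" if "(i, j) \<in> index_pairs k" for i j
    using assms(5) that unfolding map_eq_conv set_pair_list by blast
  have diag: "2 * n (i, i) + of_bool (i \<in> J) = 2 * n' (i, i) + of_bool (i \<in> J')" if "i \<in> {1..k}" for i
    using eq[of i i] that by (simp add: exponent_def index_pairs_def)
  have parity: "(i \<in> J) = (i \<in> J')" "n (i, i) = n' (i, i)" if "i \<in> {1..k}" for i
    using diag[OF that] by (auto simp: of_bool_def split: if_splits) presburger+
  show "J = J'" using parity(1) assms(1,2) by blast
  show "n = n'"
  proof (rule PiE_ext[OF assms(3,4)])
    fix q assume "q \<in> index_pairs k"
    then show "n q = n' q"
      using eq[of "fst q" "snd q"] parity(2)[of "fst q"]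
      by (cases q) (auto simp: exponent_def index_pairs_def split: if_splits)
  qed
qed

lemma monogenics_uminus: "f \<in> monogenics m k scale act \<Longrightarrow> - f \<in> monogenics m k scale act"
  by (simp add: monogenics_def spinor_polys_def in_keys_iff additive.minus[OF additive_dirac])

lemma r_power_Sigma: "r_power k n = (\<Prod>i\<in>{1..k}. \<Prod>j\<in>{i..k}. r_sq m i j ^ n (i, j))"
proof -
  have "index_pairs k = Sigma {1..k} (\<lambda>i. {i..k})" by (auto simp: index_pairs_def)
  then show ?thesis unfolding r_power_def by (simp add: prod.Sigma)
qed

lemma monogenic_components_independent:
  assumes "2 * k \<le> m" "finite A" "A \<subseteq> Pow {1..k} \<times> (index_pairs k \<rightarrow>\<^sub>E UNIV)"
    and "\<And>q. q \<in> A \<Longrightarrow> f q \<in> monogenics m k scale act"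
    and "(\<Sum>(J, n)\<in>A. poly_act scale (r_power k n) (vvs J (f (J, n)))) = 0"
    and "q \<in> A"
  shows "f q = 0"
proof -
  define gs where "gs = concat (map (vv_row k) [1..<Suc k])"
  define es where "es = (\<lambda>(J, n). map (exponent J n) (pair_list k 1))"
  \<comment> \<open>The signs from x_i^2 = - r_ii^2 are moved into the monogenic factors, which are
    closed under negation.\<close>
  define sgn :: "nat set \<times> (nat \<times> nat \<Rightarrow> nat) \<Rightarrow> cpoly"
    where "sgn = (\<lambda>(J, n). \<Prod>i\<in>{1..k}. (-1) ^ n (i, i))"
  have sgn: "sgn q = 1 \<or> sgn q = - 1" for q
  proof -
    have "sgn q = (-1) ^ (\<Sum>i\<in>{1..k}. snd q (i, i))"
      by (simp add: sgn_def case_prod_unfold power_sum)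
    then show ?thesis by (simp add: minus_one_power_iff)
  qed
  have poly_minus: "poly_act scale (- 1) g = - g" for g
    using additive.minus[OF additive_poly_act_left, of 1 g] by (simp add: poly_act_one)
  define F where "F q = poly_act scale (sgn q) (f q)" for q
  have F: "F q = f q \<or> F q = - f q" for q
    using sgn[of q] by (auto simp: F_def poly_act_one poly_minus)
  have inj: "inj_on es A"
  proof (rule inj_onI)
    fix x y assume "x \<in> A" "y \<in> A" "es x = es y"
    then show "x = y"
      using assms(3) exponent_inject[of "fst x" k "fst y" "snd x" "snd y"]
      by (cases x, cases y) (auto simp: es_def)
  qed
  have mono: "op_monomial gs (es (J, n)) (F (J, n)) = poly_act scale (r_power k n) (vvs J (f (J, n)))"
    if "(J, n) \<in> A" for J n
  proof -
    have "J \<inter> {1..k} = J" using that assms(3) by auto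
    then have "op_monomial gs (es (J, n)) (F (J, n))
        = poly_act scale (sgn (J, n) * r_power k n) (vvs J (F (J, n)))"
      unfolding gs_def es_def
      by (simp add: op_monomial_vv_rows prod.distrib r_power_Sigma sgn_def del: upt_Suc)
    also have "\<dots> = poly_act scale (sgn (J, n) * sgn (J, n)) (poly_act scale (r_power k n) (vvs J (f (J, n))))"
      unfolding F_def vector_var_set_poly_act poly_act_mult[symmetric] by (simp only: mult_ac)
    also have "sgn (J, n) * sgn (J, n) = 1" using sgn[of "(J, n)"] by auto
    finally show ?thesis by (simp add: poly_act_one)
  qed
  have add: "additive g" if "g \<in> set gs" for g
    using that by (auto simp: gs_def vv_row_def additive_vector_var additive_poly_act simp del: upt_Suc)
  \<comment> \<open>Independence is stated for families indexed by exponent lists, so the family is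
    transported along the injection \<open>es\<close>.\<close>
  have "F (the_inv_into A es (es q)) = 0"
  proof (rule regular_seq_independent[where W = "{0}" and gs = gs and E = "es ` A"
        and F = "\<lambda>x. F (the_inv_into A es x)" and M = "monogenics m k scale act"])
    show "add_subgroup {0 :: 's spoly}" by (simp add: add_subgroup_def)
    show "additive g" if "g \<in> set gs" for g using that by (rule add)
    show "regular_seq {0} gs"
      unfolding gs_def
    proof (rule regular_seq_vv_rows)
      show "regular_seq {0} (concat (map (rr_row k) [1..<Suc k]))"
        unfolding rr_rows_eq using assms(1) distinct_pair_list set_pair_list
        by (intro regular_seq_r_sq) auto
    qed (auto simp: add_subgroup_def poly_act_zero_right additive.zero[OF additive_vector_var])
    show "g = 0" if "g \<in> monogenics m k scale act" "g \<in> fold adjoin_image gs {0}" for g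
      using that monogenic_orthogonal[of g k 1] by (simp add: gs_def)
    show "finite (es ` A)" using assms(2) by simp
    show "length x = length gs" if "x \<in> es ` A" for x
    proof -
      have "length (concat (map (vv_row k) [1..<Suc k])) = length (concat (map (rr_row k) [1..<Suc k]))"
        by (simp add: length_concat comp_def vv_row_def rr_row_def del: upt_Suc)
      then show ?thesis using that unfolding gs_def es_def rr_rows_eq by auto
    qed
    show "F (the_inv_into A es x) \<in> monogenics m k scale act" if "x \<in> es ` A" for x
    proof -
      have "the_inv_into A es x \<in> A" using that by (intro the_inv_into_into[OF inj]) auto
      then show ?thesis using F[of "the_inv_into A es x"] assms(4) monogenics_uminus by metis
    qed
    have "(\<Sum>x\<in>es ` A. op_monomial gs x (F (the_inv_into A es x)))
        = (\<Sum>q\<in>A. op_monomial gs (es q) (F q))"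
      unfolding sum.reindex[OF inj] comp_def
      by (intro sum.cong) (simp_all add: the_inv_into_f_f[OF inj])
    also have "\<dots> = 0"
      unfolding assms(5)[symmetric] using mono by (intro sum.cong) auto
    finally show "(\<Sum>x\<in>es ` A. op_monomial gs x (F (the_inv_into A es x))) \<in> {0}" by simp
    show "es q \<in> es ` A" using assms(6) by simp
  qed
  then have "F q = 0" by (simp add: the_inv_into_f_f[OF inj assms(6)])
  then show ?thesis using F[of q] by auto
qed


section \<open>The direct sum decomposition\<close>

lemma poly_act_in_spinor_polys:
  assumes "\<And>\<alpha>. \<alpha> \<in> Poly_Mapping.keys p \<Longrightarrow> Poly_Mapping.keys \<alpha> \<subseteq> {1..m} \<times> {1..k}" "f \<in> spinor_polys m k"
  shows "poly_act scale p f \<in> spinor_polys m k"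
  unfolding spinor_polys_def
proof (intro CollectI ballI)
  fix \<gamma> assume "\<gamma> \<in> Poly_Mapping.keys (poly_act scale p f)"
  then obtain \<alpha> \<beta> where \<gamma>: "\<gamma> = \<alpha> + \<beta>" "\<alpha> \<in> Poly_Mapping.keys p" "\<beta> \<in> Poly_Mapping.keys f"
    using keys_poly_act[of p f] by blast
  then have "Poly_Mapping.keys \<alpha> \<subseteq> {1..m} \<times> {1..k}" "Poly_Mapping.keys \<beta> \<subseteq> {1..m} \<times> {1..k}"
    using assms by (auto simp: spinor_polys_def)
  then show "Poly_Mapping.keys \<gamma> \<subseteq> {1..m} \<times> {1..k}" using keys_add[of \<alpha> \<beta>] \<gamma>(1) by blast
qed

lemma spinor_polys_sum:
  fixes f :: "'i \<Rightarrow> 's spoly"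
  shows "(\<And>i. i \<in> I \<Longrightarrow> f i \<in> spinor_polys m k) \<Longrightarrow> sum f I \<in> spinor_polys m k"
  by (induction I rule: infinite_finite_induct) (simp_all add: spinor_polys_closed)

lemma coord_in_spinor_polys:
  "i \<in> {1..m} \<Longrightarrow> j \<in> {1..k} \<Longrightarrow> f \<in> spinor_polys m k \<Longrightarrow> poly_act scale (coord i j) f \<in> spinor_polys m k"
  by (rule poly_act_in_spinor_polys) (auto simp: coord_def split: if_splits)

lemma vector_var_in_spinor_polys:
  assumes "j \<in> {1..k}" "f \<in> spinor_polys m k"
  shows "vv j f \<in> spinor_polys m k"
  unfolding vector_var_def
proof (rule spinor_polys_sum)
  fix i assume i: "i \<in> {1..m}"
  have cl: "cl_gen i \<in> clifford m" by (rule cl_gen_in_clifford[OF i])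
  from coord_in_spinor_polys[OF i assms]
  show "cliff_act act (cl_gen i) (poly_act scale (coord i j) f) \<in> spinor_polys m k"
    unfolding in_spinor_polys_iff lookup_cliff_act[OF cl] by (metis act_hom(3)[OF cl])
qed

lemma rr_in_spinor_polys:
  "i \<in> {1..k} \<Longrightarrow> j \<in> {1..k} \<Longrightarrow> f \<in> spinor_polys m k \<Longrightarrow> rr i j f \<in> spinor_polys m k"
  unfolding r_sq_def poly_act_sum_left poly_act_mult
  by (intro spinor_polys_sum coord_in_spinor_polys)

lemma component_in_spinor_polys:
  assumes "J \<subseteq> {1..k}" "f \<in> spinor_polys m k"
  shows "poly_act scale (r_power k n) (vvs J f) \<in> spinor_polys m k"
proof -
  have pow: "poly_act scale (r_sq m i j ^ e) g \<in> spinor_polys m k"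
    if "(i, j) \<in> index_pairs k" "g \<in> spinor_polys m k" for i j e g
    using that by (induction e) (auto simp: poly_act_one poly_act_mult index_pairs_def intro!: rr_in_spinor_polys)
  have "poly_act scale (\<Prod>(i, j)\<in>A. r_sq m i j ^ n (i, j)) g \<in> spinor_polys m k"
    if "finite A" "A \<subseteq> index_pairs k" "g \<in> spinor_polys m k" for A g
    using that
  proof (induction A rule: finite_induct)
    case (insert q A)
    then show ?case using pow[of "fst q" "snd q"] by (simp add: poly_act_mult case_prod_unfold)
  qed (simp add: poly_act_one)
  moreover have "foldr vv js f \<in> spinor_polys m k" if "set js \<subseteq> {1..k}" for js
    using that by (induction js) (auto intro: vector_var_in_spinor_polys assms)
  then have "vvs J f \<in> spinor_polys m k"
    using assms(1) finite_subset[OF assms(1)] by (simp add: vector_var_set_def)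
  ultimately show ?thesis by (simp add: r_power_def finite_index_pairs)
qed

text \<open>Values of \<open>n\<close> outside \<open>index_pairs k\<close> do not influence
  \<open>r_power\<close>, so restriction gives the unique extensional representative used as index
  of the direct sum.\<close>

lemma generators_eq:
  "generators k 1 = (\<Union>(J, n)\<in>Pow {1..k} \<times> (index_pairs k \<rightarrow>\<^sub>E UNIV).
     (\<lambda>f. poly_act scale (r_power k n) (vvs J f)) ` monogenics m k scale act)"
proof -
  have restrict: "r_power k (restrict n (index_pairs k)) = r_power k n" for n
    unfolding r_power_def by (intro prod.cong) auto
  show ?thesis
  proof (intro equalityI subsetI)
    fix g assume "g \<in> generators k 1"
    then obtain n J f where "J \<in> Pow {1..k}" "f \<in> monogenics m k scale act"
      "g = poly_act scale (r_power k (restrict n (index_pairs k))) (vvs J f)"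
      unfolding restrict by (auto simp: generators_def)
    then show "g \<in> (\<Union>(J, n)\<in>Pow {1..k} \<times> (index_pairs k \<rightarrow>\<^sub>E UNIV).
       (\<lambda>f. poly_act scale (r_power k n) (vvs J f)) ` monogenics m k scale act)"
      by (intro UN_I[of "(J, restrict n (index_pairs k))"]) auto
  qed (auto simp: generators_def)
qed

lemma monogenic_direct_sum:
  assumes "2 * k \<le> m"
  shows "internal_direct_sum (sp_scale scale) (spinor_polys m k)
     (Pow {1..k} \<times> (index_pairs k \<rightarrow>\<^sub>E UNIV))
     (\<lambda>(J, n). (\<lambda>f. poly_act scale (r_power k n) (vvs J f)) ` monogenics m k scale act)"
proof -
  interpret C: vector_space "sp_scale scale :: complex \<Rightarrow> 's spoly \<Rightarrow> 's spoly"
    by (rule vector_space_sp_scale[OF vector_space_axioms])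
  have W: "C.subspace (spinor_polys m k)"
    by (intro C.subspaceI spinor_polys_closed)
  have M: "C.subspace (monogenics m k scale act)"
    unfolding monogenics_def
    by (intro C.subspaceI)
       (auto intro: spinor_polys_closed
         simp: additive.add[OF additive_dirac] additive.zero[OF additive_dirac] dirac_sp_scale)
  have V: "C.subspace ((\<lambda>f. poly_act scale (r_power k n) (vvs J f)) ` monogenics m k scale act)" for n J
  proof -
    have "Vector_Spaces.linear (sp_scale scale) (sp_scale scale) (\<lambda>f. poly_act scale (r_power k n) (vvs J f))"
      by unfold_locales
         (simp_all add: poly_act_add_right additive.add[OF additive_vector_var_set]
           sp_scale_eq_poly_act vector_var_set_poly_act poly_act_commute[of "r_power k n"])
    then interpret L: Vector_Spaces.linear "sp_scale scale" "sp_scale scale"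
      "\<lambda>f. poly_act scale (r_power k n) (vvs J f)" .
    show ?thesis by (rule L.subspace_image[OF M])
  qed
  show ?thesis
  proof (rule C.internal_direct_sumI)
    fix A v q
    assume A: "finite A" "A \<subseteq> Pow {1..k} \<times> (index_pairs k \<rightarrow>\<^sub>E UNIV)"
      and v: "\<And>i. i \<in> A \<Longrightarrow> v i \<in> (case i of (J, n) \<Rightarrow>
          (\<lambda>f. poly_act scale (r_power k n) (vvs J f)) ` monogenics m k scale act)"
      and sum: "(\<Sum>i\<in>A. v i) = 0" and q: "q \<in> A"
    have "\<forall>i\<in>A. \<exists>f\<in>monogenics m k scale act. v i = poly_act scale (r_power k (snd i)) (vvs (fst i) f)"
      using v by fastforce
    then obtain f where f: "\<And>i. i \<in> A \<Longrightarrow> f i \<in> monogenics m k scale act"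
      "\<And>i. i \<in> A \<Longrightarrow> v i = poly_act scale (r_power k (snd i)) (vvs (fst i) (f i))"
      by metis
    have "(\<Sum>(J, n)\<in>A. poly_act scale (r_power k n) (vvs J (f (J, n)))) = 0"
      unfolding sum[symmetric] by (intro sum.cong) (auto simp: f(2))
    from monogenic_components_independent[OF assms A f(1) this q] have "f q = 0" .
    then show "v q = 0"
      by (simp add: f(2) q additive.zero[OF additive_vector_var_set] poly_act_zero_right)
  next
    show "spinor_polys m k \<subseteq> C.span (\<Union>i\<in>Pow {1..k} \<times> (index_pairs k \<rightarrow>\<^sub>E UNIV). case i of (J, n) \<Rightarrow>
        (\<lambda>f. poly_act scale (r_power k n) (vvs J f)) ` monogenics m k scale act)"
      using spinor_polys_subset_span_generators[of k] unfolding generators_eq .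
  qed (use W V in \<open>auto simp: monogenics_def intro!: component_in_spinor_polys\<close>)
qed

end

theorem theorem1p1:
  fixes m k :: nat
    and scale :: "complex \<Rightarrow> 's::ab_group_add \<Rightarrow> 's"
    and act :: "cliff \<Rightarrow> 's \<Rightarrow> 's"
  assumes "m \<ge> 1" and "k \<ge> 1" and "m \<ge> 2 * k"
    and "spinor_module m scale act"
  shows "internal_direct_sum (sp_scale scale)
           (spinor_polys m k :: 's spoly set)
           (Pow {1..k} \<times> (index_pairs k \<rightarrow>\<^sub>E (UNIV :: nat set)))
           (\<lambda>(J, n). (\<lambda>f. poly_act scale (\<Prod>(i, j)\<in>index_pairs k. r_sq m i j ^ n (i, j))
                            (vector_var_set m scale act J f)) ` monogenics m k scale act)"
proof -
  interpret spinor_module m scale act by (rule assms(4))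
  show ?thesis using monogenic_direct_sum[OF assms(3)] unfolding r_power_def .
qed

end
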